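(* Let $\varphi\in\mathcal{S}_r$ and let $t$ be a positive integer such that every jump discontinuity of $\varphi$ in $(0,1)$ has the form $\frac{s}{t}$ for some integer $s$. Set $q=2t$ and $g(m)=J_\varphi(\frac{m}{t})$ for $m\geq1$. Then $\varphi\in\mathcal{C}$ if and only if there exists a primitive Dirichlet character $\psi$ modulo $q_0$ with $q_0\mid q$ such that: (1) $g(m)=g(\widehat m)\,\psi(\frac{m}{\widehat m})$ for every $m\geq1$, where $\widehat m=\gcd(m,\frac{q}{q_0})$; and (2) the Dirichlet polynomial $\sum_{d\mid\frac{q}{q_0}}(g\ast\mu\psi)(\frac{q}{dq_0})\,d^{-s}$ has a nonzero constant term and no zeros in $\mathbb{C}_0=\{s:\mathrm{Re}\,s>0\}$.
   Context: $L^2=L^2(0,1)$; each $\varphi\in L^2$ is identified with its odd $2$-periodic extension to $\mathbb{R}$. $\mathcal{C}$ is the set of $\varphi\in L^2$ such that the span of $\{\varphi(kx):k\in\mathbb{N}\}$ is dense in $L^2$. $\mathcal{S}_r$ is the class of complex step functions on $(0,1)$ (finitely many jumps) all of whose jump discontinuities in $(0,1)$ are rational. For $x\in\mathbb{R}$, $J_\varphi(x)=\varphi(x^+)-\varphi(x^-)$ (computed for the odd $2$-periodic extension). A Dirichlet character mod $q$ is a completely multiplicative $q$-periodic function $\chi:\mathbb{N}\to\mathbb{C}$ with $\chi(n)\ne0$ iff $\gcd(n,q)=1$; the principal character mod $q$ takes only values $0,1$. A character $\psi$ mod $d$ induces $\chi$ mod $q$ if $d\mid q$ and $\chi=\psi\chi_q$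 with $\chi_q$ principal mod $q$; $\chi$ is primitive if it is not induced by any character of modulus a proper divisor of $q$. $\mu$ is the Möbius function, $(f\ast h)(n)=\sum_{d\mid n}f(\frac nd)h(d)$ is Dirichlet convolution, and $\mu\psi$ denotes the pointwise product $n\mapsto\mu(n)\psi(n)$. *)

theory Defs
  imports "HOL-Analysis.Analysis" "HOL-Computational_Algebra.Squarefree"
begin

definition in_L2 :: "(real \<Rightarrow> complex) \<Rightarrow> bool" where
  "in_L2 f \<longleftrightarrow> f \<in> borel_measurable (restrict_space lebesgue {0<..<1})
      \<and> set_integrable lebesgue {0<..<1} (\<lambda>x. (cmod (f x))\<^sup>2)"

definition oddext :: "(real \<Rightarrow> complex) \<Rightarrow> real \<Rightarrow> complex" where
  "oddext \<phi> x = (let y = x - 2 * of_int \<lfloor>x / 2\<rfloor> in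
      if 0 < y \<and> y < 1 then \<phi> y
      else if 1 < y \<and> y < 2 then - \<phi> (2 - y) else 0)"

definition in_C :: "(real \<Rightarrow> complex) \<Rightarrow> bool" where
  "in_C \<phi> \<longleftrightarrow> in_L2 \<phi> \<and>
     (\<forall>f. in_L2 f \<longrightarrow> (\<forall>\<epsilon>>0. \<exists>(n::nat) (c::nat \<Rightarrow> complex).
        (LINT x:{0<..<1}|lebesgue.
           (cmod (f x - (\<Sum>k=1..n. c k * oddext \<phi> (real k * x))))\<^sup>2) < \<epsilon>))"

definition step_fun :: "(real \<Rightarrow> complex) \<Rightarrow> bool" where
  "step_fun \<phi> \<longleftrightarrow> (\<exists>(a::nat \<Rightarrow> real) (n::nat). a 0 = 0 \<and> a n = 1 \<and>
      (\<forall>i<n. a i < a (Suc i)) \<and>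
      (\<forall>i<n. \<exists>c. \<forall>x\<in>{a i<..<a (Suc i)}. \<phi> x = c))"

definition jump :: "(real \<Rightarrow> complex) \<Rightarrow> real \<Rightarrow> complex" where
  "jump \<phi> x = Lim (at_right x) (oddext \<phi>) - Lim (at_left x) (oddext \<phi>)"

definition S_r :: "(real \<Rightarrow> complex) set" where
  "S_r = {\<phi>. step_fun \<phi> \<and> (\<forall>x\<in>{0<..<1}. jump \<phi> x \<noteq> 0 \<longrightarrow> x \<in> \<rat>)}"

definition dirichlet_char :: "nat \<Rightarrow> (nat \<Rightarrow> complex) \<Rightarrow> bool" where
  "dirichlet_char q chi \<longleftrightarrow> q > 0 \<and>
     (\<forall>m n. chi (m * n) = chi m * chi n) \<and> chi 1 = 1 \<and>
     (\<forall>n. chi (n + q) = chi n) \<and>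
     (\<forall>n. chi n \<noteq> 0 \<longleftrightarrow> coprime n q)"

definition principal_char :: "nat \<Rightarrow> nat \<Rightarrow> complex" where
  "principal_char q n = (if coprime n q then 1 else 0)"

definition induces :: "nat \<Rightarrow> (nat \<Rightarrow> complex) \<Rightarrow> nat \<Rightarrow> (nat \<Rightarrow> complex) \<Rightarrow> bool" where
  "induces d \<psi> q chi \<longleftrightarrow> dirichlet_char d \<psi> \<and> d dvd q \<and>
      chi = (\<lambda>n. \<psi> n * principal_char q n)"

definition primitive_char :: "nat \<Rightarrow> (nat \<Rightarrow> complex) \<Rightarrow> bool" where
  "primitive_char q chi \<longleftrightarrow> dirichlet_char q chi \<and>
      \<not> (\<exists>d \<psi>. d dvd q \<and> d \<noteq> q \<and> induces d \<psi> q chi)"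

definition moebius_mu :: "nat \<Rightarrow> complex" where
  "moebius_mu n = (if n > 0 \<and> squarefree n then (-1) ^ card (prime_factors n) else 0)"

definition dconv :: "(nat \<Rightarrow> complex) \<Rightarrow> (nat \<Rightarrow> complex) \<Rightarrow> nat \<Rightarrow> complex" where
  "dconv f h n = (\<Sum>d | d dvd n. f (n div d) * h d)"

end

theory Submission
  imports Defs "HOL-Complex_Analysis.Complex_Analysis" "HOL-Number_Theory.Residues"
begin

text \<open>
  The sine coefficients of \<open>\<phi>\<close> are, up to a constant, \<open>b(n)/n\<close>, where \<open>b\<close> is the finite Fourier
  transform of the \<open>q\<close>-periodic jump sequence \<open>g\<close>. By completeness of the sines, \<open>\<phi> \<in> \<C>\<close> means that
  \<open>b(n)/n\<close> is cyclic in \<open>\<ell>\<^sup>2\<close> for the dilations \<open>e\<^sub>n \<mapsto> e\<^sub>k\<^sub>n\<close>.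

  Completely multiplicative sequences in \<open>\<ell>\<^sup>2\<close> are joint eigenvectors of the adjoint dilations, so a
  cyclic sequence is orthogonal to none of them. Varying the test sequence along primes in one
  residue class and passing to the limit gives an exponential sum without zeros, which must be a
  single exponential; hence \<open>b(an) = \<chi>(a) b(n)\<close> for all \<open>a\<close> coprime to \<open>q\<close>. Only residue classes that
  contain many primes are accessible in this way; a sieve shows that these classes generate all of
  them, so Dirichlet's theorem is not needed. The primitive character inducing \<open>\<chi>\<close> and the
  separability of Gauss sums turn the transformation law into condition (1), and they factor \<open>b(n)/n\<close>
  as the convolution of a completely multiplicative sequence with the coefficients of the Dirichlet
  polynomial in (2).

  It remains to decide when a Dirichlet polynomial \<open>P\<close> is cyclic. It cannot vanish at a point
  evaluation. Conversely, if \<open>P\<close> has no zeros, then \<open>1/P\<close> is bounded on each half plane \<open>Re s \<ge> \<delta>\<close>,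
  and comparing \<open>P\<close> with its reflection in the line \<open>Re s = \<delta>\<close> bounds \<open>P/P(\<cdot> + \<delta>)\<close> by a constant
  tending to \<open>1\<close>, which gives convergence to \<open>1\<close> in norm.
\<close>

subsection \<open>Moebius inversion\<close>

text \<open>The value of a test sequence at a prime must have norm below 1, because its powers have
  to be square summable. A weight \<open>z\<close> put on finitely many primes \<open>p\<close>
  therefore moves the exponent by only about \<open>z\<close> times the sum of \<open>1 / p\<close>,
  and this reaches every complex number only along residue classes on which the sum of reciprocals
  diverges. The limit has to be zero-free on the whole plane: an entire function of exponential type
  without zeros is \<open>G 0 * exp (\<alpha> * w)\<close>, and comparing derivatives at 0 leaves
  one effective frequency. A priori this frequency depends on the exponent \<open>s\<close> of the
  background sequence \<open>1 / n ^ s\<close>. It is a root of unity of bounded order, so one value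
  serves infinitely many \<open>s\<close>, and uniqueness of Dirichlet series turns identities
  between sums into an identity between sequences. The period is \<open>2 * t\<close> because the
  extension has period 2 and is sampled at the multiples of \<open>1 / t\<close>. Since the Fourier
  transform inverts the action of the units, the character of \<open>b\<close> is the conjugate of
  the one that governs \<open>g\<close>.\<close>

lemma moebius_mu_mult_prime:
  assumes "prime p" "\<not> p dvd d"
  shows "moebius_mu (p * d) = - moebius_mu d"
proof (cases "d > 0 \<and> squarefree d")
  case True
  have cop: "coprime p d" using assms by (simp add: prime_imp_coprime)
  have "squarefree (p * d)"
    using True assms cop by (auto simp: squarefree_mult_coprime squarefree_prime)
  moreover have "prime_factors (p * d) = insert p (prime_factors d)"
    using True assms by (auto simp: prime_factors_product prime_prime_factors)
  moreover have "p \<notin> prime_factors d" using assms by auto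
  ultimately show ?thesis
    using True assms by (auto simp: moebius_mu_def prime_gt_0_nat)
next
  case False
  have "\<not> (p * d > 0 \<and> squarefree (p * d))"
    using False by (metis nat_0_less_mult_iff squarefree_multD(2))
  then have "moebius_mu (p * d) = 0" unfolding moebius_mu_def by presburger
  moreover have "moebius_mu d = 0" using False unfolding moebius_mu_def by presburger
  ultimately show ?thesis by simp
qed

lemma moebius_mu_1 [simp]: "moebius_mu (Suc 0) = 1"
  by (simp add: moebius_mu_def)

text \<open>Fix a prime \<open>p\<close> dividing \<open>n\<close>. The divisors prime to
  \<open>p\<close> pair off with those divisible by \<open>p\<close> exactly once, with opposite
  signs, and the remaining divisors are not squarefree.\<close>

lemma sum_moebius_mu:
  assumes "n > 0"
  shows "(\<Sum>d | d dvd n. moebius_mu d) = (if n = 1 then 1 else 0)"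
proof (cases "n = 1")
  case False
  then obtain p where p: "prime p" "p dvd n" using prime_factor_nat by blast
  have fin: "finite {d. d dvd n}" using assms by simp
  define A where "A = {d. d dvd n \<and> \<not> p dvd d}"
  define B where "B = {d. d dvd n \<and> p dvd d \<and> \<not> p * p dvd d}"
  define C where "C = {d. d dvd n \<and> p * p dvd d}"
  have finA: "finite A" "finite B" "finite C" unfolding A_def B_def C_def using fin by auto
  have "{d. d dvd n} = (A \<union> B) \<union> C" by (auto simp: A_def B_def C_def)
  then have "(\<Sum>d | d dvd n. moebius_mu d) = sum moebius_mu ((A \<union> B) \<union> C)" by simp
  also have "\<dots> = sum moebius_mu (A \<union> B) + sum moebius_mu C"
    by (rule sum.union_disjoint) (use finA in \<open>auto simp: A_def B_def C_def\<close>)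
  also have "sum moebius_mu (A \<union> B) = sum moebius_mu A + sum moebius_mu B"
    by (rule sum.union_disjoint) (use finA in \<open>auto simp: A_def B_def C_def\<close>)
  also have "sum moebius_mu C = 0"
  proof (rule sum.neutral, safe)
    fix d assume "d \<in> C"
    then have "p\<^sup>2 dvd d" by (simp add: C_def power2_eq_square)
    then have "\<not> squarefree d" using p by (auto simp: squarefree_def)
    then show "moebius_mu d = 0" by (simp add: moebius_mu_def)
  qed
  also have "sum moebius_mu B = (\<Sum>d\<in>A. moebius_mu (p * d))"
  proof (rule sum.reindex_bij_betw [symmetric], rule bij_betwI [where g = "\<lambda>d. d div p"])
    show "(*) p \<in> A \<rightarrow> B"
      using p by (auto simp: A_def B_def intro!: divides_mult prime_imp_coprime)
    show "(\<lambda>d. d div p) \<in> B \<rightarrow> A"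
    proof safe
      fix d assume "d \<in> B"
      then obtain k where "d = p * k" "d dvd n" "\<not> p * p dvd d" by (auto simp: B_def)
      then show "d div p \<in> A" using p by (auto simp: A_def prime_gt_0_nat dest: dvd_mult_right)
    qed
  qed (use p in \<open>auto simp: A_def B_def prime_gt_0_nat\<close>)
  also have "\<dots> = - sum moebius_mu A"
    using p by (auto simp: A_def moebius_mu_mult_prime simp flip: sum_negf intro!: sum.cong)
  finally show ?thesis using False by simp
qed simp

subsection \<open>Dirichlet characters\<close>

text \<open>Take for \<open>k\<close> the product of the primes of \<open>q\<close> that do not
  divide \<open>x\<close>. Then each prime of \<open>q\<close> divides exactly one of
  \<open>x\<close> and \<open>k * e\<close>, hence not their sum.\<close>

lemma coprime_add_mult:
  fixes x e q :: nat
  assumes "coprime x e" "q > 0"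
  shows "\<exists>k. coprime (x + k * e) q"
proof -
  define k where "k = \<Prod>{p \<in> prime_factors q. \<not> p dvd x}"
  have "coprime (x + k * e) q"
  proof (rule ccontr)
    assume "\<not> coprime (x + k * e) q"
    then obtain p where p: "prime p" "p dvd x + k * e" "p dvd q"
      using coprime_iff_gcd_eq_1 by (metis gcd_nat.boundedE prime_factor_nat)
    show False
    proof (cases "p dvd x")
      case True
      then have "p dvd k * e" using p by (simp add: dvd_add_right_iff)
      moreover have "\<not> p dvd e"
        using True assms p by (meson coprime_common_divisor not_prime_unit)
      ultimately have "p dvd k" using p by (simp add: prime_dvd_mult_iff)
      then obtain r where "r \<in> prime_factors q" "\<not> r dvd x" "p dvd r"
        using p unfolding k_def by (auto simp: prime_dvd_prod_iff)
      then show False using p True by (metis in_prime_factors_imp_prime primes_dvd_imp_eq)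
    next
      case False
      then have "p dvd k" unfolding k_def
        using p assms by (intro dvd_prodI) (auto simp: prime_factors_dvd)
      then show False using p False by (metis dvd_add_left_iff dvd_mult2)
    qed
  qed
  then show ?thesis ..
qed

lemma coprime_lift:
  fixes x e q :: nat
  assumes "coprime x e" "q > 0"
  obtains y where "[y = x] (mod e)" "coprime y q" "y \<ge> x"
proof -
  obtain k where "coprime (x + k * e) q" using coprime_add_mult [OF assms] by blast
  then show thesis by (intro that [of "x + k * e"]) (auto simp: cong_def)
qed

lemma periodic_cong:
  fixes f :: "nat \<Rightarrow> 'a"
  assumes "\<And>n. f (n + q) = f n" "[m = n] (mod q)"
  shows "f m = f n"
proof -
  have *: "f (n + k * q) = f n" for k n
    by (induction k arbitrary: n) (simp_all add: assms(1) add.assoc [symmetric] add.commute [of q])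
  have "f k = f (k mod q)" for k
    using * [of "k mod q" "k div q"] by (simp add: mult.commute)
  then show ?thesis using assms(2) unfolding cong_def by metis
qed

lemma dirichlet_char_cong:
  "dirichlet_char q chi \<Longrightarrow> [m = n] (mod q) \<Longrightarrow> chi m = chi n"
  by (rule periodic_cong) (auto simp: dirichlet_char_def)

lemma dirichlet_char_mult: "dirichlet_char q chi \<Longrightarrow> chi (m * n) = chi m * chi n"
  by (simp add: dirichlet_char_def)

lemma dirichlet_char_1: "dirichlet_char q chi \<Longrightarrow> chi (Suc 0) = 1"
  by (simp add: dirichlet_char_def)

lemma dirichlet_char_eq_0_iff: "dirichlet_char q chi \<Longrightarrow> chi n = 0 \<longleftrightarrow> \<not> coprime n q"
  by (auto simp: dirichlet_char_def)

lemma dirichlet_char_pos: "dirichlet_char q chi \<Longrightarrow> q > 0"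
  by (simp add: dirichlet_char_def)

lemma dirichlet_char_power: "dirichlet_char q chi \<Longrightarrow> chi (a ^ k) = chi a ^ k"
  by (induction k) (auto simp: dirichlet_char_def)

lemma dirichlet_char_norm:
  assumes "dirichlet_char q chi"
  shows "norm (chi n) = (if coprime n q then 1 else 0)"
proof (cases "coprime n q")
  case True
  have q: "q > 0" using assms by (rule dirichlet_char_pos)
  have "chi n ^ totient q = chi (n ^ totient q)" by (simp add: dirichlet_char_power [OF assms])
  also have "\<dots> = chi 1"
    using True q by (intro dirichlet_char_cong [OF assms] euler_theorem) auto
  finally have "norm (chi n) ^ totient q = 1"
    using assms by (simp add: dirichlet_char_1 flip: norm_power)
  then have "norm (chi n) = 1"
    using q by (metis norm_ge_zero power_eq_1_iff totient_gt_0_iff gr_implies_not0 real_norm_def abs_norm_cancel)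
  then show ?thesis using True by simp
qed (use assms in \<open>simp add: dirichlet_char_eq_0_iff\<close>)

lemma dirichlet_char_cnj_mult:
  assumes "dirichlet_char q chi" "coprime n q"
  shows "cnj (chi n) * chi n = 1"
  using dirichlet_char_norm [OF assms(1), of n] assms(2)
  by (metis complex_norm_square mult.commute of_real_1 power_one)

text \<open>Being trivial on the units that reduce to 1 modulo \<open>d\<close>, the character is
  constant on the fibres of reduction, so its value at any lift of \<open>n\<close> to a unit modulo
  \<open>q\<close> can serve as \<open>\<psi> n\<close>. Primitivity enters the later arguments
  through this criterion.\<close>

lemma dirichlet_char_factor:
  assumes chi: "dirichlet_char q chi" and "d dvd q"
    and triv: "\<And>a. coprime a q \<Longrightarrow> [a = 1] (mod d) \<Longrightarrow> chi a = 1"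
  shows "\<exists>\<psi>. induces d \<psi> q chi"
proof -
  have q: "q > 0" using chi by (rule dirichlet_char_pos)
  have d: "d > 0" using q \<open>d dvd q\<close> by (auto elim: dvdE)
  have eq: "chi u = chi v" if uv: "[u = v] (mod d)" "coprime u q" "coprime v q" for u v
  proof -
    obtain w where w: "[v * w = 1] (mod q)" using uv(3) cong_solve_coprime_nat by auto
    have cw: "coprime w q" using w by (metis coprime_1_left cong_imp_coprime cong_sym coprime_mult_left_iff)
    have "[u * w = v * w] (mod d)" using that(1) by (simp add: cong_mult)
    also have "[v * w = 1] (mod d)" using w \<open>d dvd q\<close> by (rule cong_dvd_modulus_nat)
    finally have "chi (u * w) = 1" using that cw by (intro triv) auto
    moreover have "chi (v * w) = 1"
      using dirichlet_char_cong [OF chi w] chi by (simp add: dirichlet_char_1)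
    moreover have "chi w \<noteq> 0" using cw chi by (simp add: dirichlet_char_eq_0_iff)
    ultimately show ?thesis using dirichlet_char_mult [OF chi] by (metis mult_cancel_right)
  qed
  define lift where "lift n = (SOME y. [y = n] (mod d) \<and> coprime y q)" for n
  have lift: "[lift n = n] (mod d)" "coprime (lift n) q" if "coprime n d" for n
  proof -
    have "\<exists>y. [y = n] (mod d) \<and> coprime y q" using coprime_lift [OF that q] by blast
    then show "[lift n = n] (mod d)" "coprime (lift n) q"
      unfolding lift_def by (metis (mono_tags, lifting) someI_ex)+
  qed
  define \<psi> where "\<psi> n = (if coprime n d then chi (lift n) else 0)" for n
  have \<psi>: "\<psi> n = chi y" if "[y = n] (mod d)" "coprime y q" for n y
  proof -
    have "coprime n d"
      using that(1) coprime_divisors [OF dvd_refl \<open>d dvd q\<close> that(2)] by (rule cong_imp_coprime)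
    then have "\<psi> n = chi (lift n)" by (simp add: \<psi>_def)
    also have "\<dots> = chi y"
      using lift [OF \<open>coprime n d\<close>] that by (intro eq) (auto intro: cong_trans cong_sym)
    finally show ?thesis .
  qed
  have "dirichlet_char d \<psi>" unfolding dirichlet_char_def
  proof (intro conjI allI)
    fix m n
    show "\<psi> (m * n) = \<psi> m * \<psi> n"
    proof (cases "coprime m d \<and> coprime n d")
      case True
      then have "\<psi> (m * n) = chi (lift m * lift n)"
        using lift [of m] lift [of n] by (intro \<psi>) (auto simp: cong_mult)
      then show ?thesis using True by (simp add: \<psi>_def dirichlet_char_mult [OF chi])
    qed (auto simp: \<psi>_def)
  next
    show "\<psi> 1 = 1" using \<psi> [of 1 1] chi by (simp add: dirichlet_char_1)
  next
    fix n
    have c: "coprime (n + d) d \<longleftrightarrow> coprime n d"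
      by (simp add: coprime_iff_gcd_eq_1)
    show "\<psi> (n + d) = \<psi> n"
    proof (cases "coprime n d")
      case True
      have "\<psi> (n + d) = chi (lift n)"
        using lift [OF True] by (intro \<psi>) (auto simp: cong_def)
      then show ?thesis using True by (simp add: \<psi>_def)
    qed (simp add: \<psi>_def c)
  next
    fix n show "(\<psi> n \<noteq> 0) = coprime n d"
      using lift [of n] chi by (auto simp: \<psi>_def dirichlet_char_eq_0_iff)
  qed (use d in auto)
  moreover have "chi = (\<lambda>n. \<psi> n * principal_char q n)"
    using \<psi> [OF cong_refl] chi
    by (auto simp: fun_eq_iff principal_char_def dirichlet_char_eq_0_iff)
  ultimately show ?thesis using \<open>d dvd q\<close> unfolding induces_def by blast
qed

text \<open>Induction of characters is transitive, so a character of least inducing modulus cannot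
  be induced from a proper divisor of it.\<close>

lemma exists_primitive_inducing:
  assumes "dirichlet_char q chi"
  obtains q0 \<psi> where "primitive_char q0 \<psi>" "induces q0 \<psi> q chi"
proof -
  have "induces q chi q chi" unfolding induces_def
    using assms by (auto simp: fun_eq_iff principal_char_def dirichlet_char_eq_0_iff)
  then have ex: "\<exists>d. \<exists>\<psi>. induces d \<psi> q chi" by blast
  define q0 where "q0 = (LEAST d. \<exists>\<psi>. induces d \<psi> q chi)"
  obtain \<psi> where \<psi>: "induces q0 \<psi> q chi"
    using LeastI_ex [OF ex] unfolding q0_def by blast
  have "primitive_char q0 \<psi>" unfolding primitive_char_def
  proof (intro conjI notI)
    show "dirichlet_char q0 \<psi>" using \<psi> by (simp add: induces_def)
    then have pos: "q0 > 0" by (rule dirichlet_char_pos)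
    assume "\<exists>d \<psi>'. d dvd q0 \<and> d \<noteq> q0 \<and> induces d \<psi>' q0 \<psi>"
    then obtain d \<psi>' where d: "d dvd q0" "d \<noteq> q0" "induces d \<psi>' q0 \<psi>" by blast
    have "q0 dvd q" using \<psi> by (simp add: induces_def)
    have pc: "principal_char q0 n * principal_char q n = principal_char q n" for n
      using coprime_divisors [OF dvd_refl \<open>q0 dvd q\<close>, of n] by (simp add: principal_char_def)
    have "chi = (\<lambda>n. \<psi>' n * principal_char q n)"
      using d(3) \<psi> unfolding induces_def by (simp add: mult.assoc pc)
    then have "induces d \<psi>' q chi"
      using d(3) dvd_trans [OF d(1) \<open>q0 dvd q\<close>] unfolding induces_def by simp
    then have "q0 \<le> d" unfolding q0_def by (intro Least_le) blast
    then show False using d pos by (meson dvd_imp_le le_antisym)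
  qed
  then show thesis using \<psi> that by blast
qed

text \<open>If \<open>a\<close> is 1 modulo \<open>gcd q0 e\<close>, the Chinese remainder theorem
  for moduli with a common factor gives a number that is \<open>a\<close> modulo \<open>q0\<close>
  and 1 modulo \<open>e\<close>, and it lifts to a unit modulo \<open>q\<close>. So
  \<open>\<psi>\<close> is trivial on such units \<open>a\<close> and descends to modulus
  \<open>gcd q0 e\<close>, which primitivity forces to be \<open>q0\<close>.\<close>

lemma primitive_char_dvd:
  assumes prim: "primitive_char q0 \<psi>" and "q0 dvd q" "e dvd q" "q > 0"
    and triv: "\<And>a. coprime a q \<Longrightarrow> [a = 1] (mod e) \<Longrightarrow> \<psi> a = 1"
  shows "q0 dvd e"
proof -
  have \<psi>: "dirichlet_char q0 \<psi>" using prim by (simp add: primitive_char_def)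
  define d where "d = gcd q0 e"
  have "\<psi> a = 1" if a: "coprime a q0" "[a = 1] (mod d)" for a
  proof -
    have "\<exists>x. [x = a] (mod q0) \<and> [x = 1] (mod e)"
    proof -
      have pos: "q0 > 0" "e > 0" using assms by (auto elim: dvdE)
      have "[int a = 1] (mod (gcd (int q0) (int e)))"
        using a(2) unfolding d_def by (metis cong_int_iff gcd_int_int_eq of_nat_1)
      then have "gcd (int q0) (int e) dvd 1 - int a"
        by (metis cong_iff_dvd_diff cong_sym)
      then obtain k where k: "1 - int a = gcd (int q0) (int e) * k" by (elim dvdE)
      obtain u v where uv: "u * int q0 + v * int e = gcd (int q0) (int e)"
        using bezout_int by blast
      define y where "y = int a + u * k * int q0"
      have "1 = int a + (u * int q0 + v * int e) * k" using k uv by simp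
      then have y: "y = 1 - v * k * int e" unfolding y_def by (simp add: algebra_simps)
      define x where "x = nat (y mod (int q0 * int e))"
      have ix: "int x = y mod (int q0 * int e)" using pos by (simp add: x_def)
      have "[int x = int a] (mod int q0)"
        by (simp add: ix cong_def y_def mod_mod_cancel)
      moreover have "[int x = 1] (mod int e)"
      proof -
        have "int x mod int e = y mod int e" by (simp add: ix mod_mod_cancel)
        also have "[y = 1] (mod int e)" unfolding y by (simp add: cong_iff_dvd_diff)
        then have "y mod int e = 1 mod int e" by (simp add: cong_def)
        finally show ?thesis by (simp add: cong_def)
      qed
      ultimately show ?thesis by (metis cong_int_iff of_nat_1)
    qed
    then obtain x where x: "[x = a] (mod q0)" "[x = 1] (mod e)" by blast
    have "coprime x (q0 * e)"
      using x a by (metis cong_imp_coprime cong_sym coprime_1_left coprime_mult_right_iff)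
    then obtain y where y: "[y = x] (mod (q0 * e))" "coprime y q"
      using coprime_lift \<open>q > 0\<close> by blast
    have "\<psi> y = \<psi> a"
      using y x by (intro dirichlet_char_cong [OF \<psi>])
        (meson cong_modulus_mult_nat cong_trans)
    moreover have "\<psi> y = 1"
      using y x by (intro triv) (auto intro: cong_trans dest: cong_modulus_mult_nat simp: mult.commute [of q0])
    ultimately show ?thesis by simp
  qed
  then have "\<exists>\<psi>'. induces d \<psi>' q0 \<psi>"
    by (intro dirichlet_char_factor [OF \<psi>]) (auto simp: d_def)
  then have "d = q0" using prim unfolding primitive_char_def d_def by blast
  then show ?thesis unfolding d_def by (metis gcd_dvd2)
qed

subsection \<open>Finite Fourier transform and Gauss sums\<close>

definition unity_root :: "nat \<Rightarrow> nat \<Rightarrow> complex" where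
  "unity_root q k = exp (2 * of_real pi * \<i> * of_nat k / of_nat q)"

lemma unity_root_add: "unity_root q (j + k) = unity_root q j * unity_root q k"
  by (simp add: unity_root_def ring_distribs add_divide_distrib exp_add)

lemma unity_root_0 [simp]: "unity_root q 0 = 1"
  by (simp add: unity_root_def)

lemma unity_root_eq_1_iff: "q > 0 \<Longrightarrow> unity_root q k = 1 \<longleftrightarrow> q dvd k"
  unfolding unity_root_def by (rule complex_root_unity_eq_1) simp

lemma unity_root_mult: "unity_root q (k * j) = unity_root q k ^ j"
  by (induction j) (simp_all add: unity_root_add mult.commute)

lemma unity_root_cong: "q > 0 \<Longrightarrow> [j = k] (mod q) \<Longrightarrow> unity_root q j = unity_root q k"
  unfolding unity_root_def cong_def using complex_root_unity_eq [of q j k] by simp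

lemma unity_root_cancel: "r > 0 \<Longrightarrow> unity_root (r * q) (r * k) = unity_root q k"
  by (simp add: unity_root_def mult.assoc)

lemma norm_unity_root [simp]: "norm (unity_root q k) = 1"
  by (simp add: unity_root_def norm_exp_eq_Re)

lemma sum_unity_root:
  assumes "q > 0"
  shows "(\<Sum>m<q. unity_root q (k * m)) = (if q dvd k then of_nat q else 0)"
proof (cases "q dvd k")
  case True
  then show ?thesis using assms by (simp add: unity_root_mult unity_root_eq_1_iff [THEN iffD2])
next
  case False
  have "(1 - unity_root q k) * (\<Sum>m<q. unity_root q k ^ m) = 1 - unity_root q k ^ q"
    by (simp add: one_diff_power_eq)
  also have "unity_root q k ^ q = 1"
    using assms by (simp add: unity_root_eq_1_iff flip: unity_root_mult)
  finally show ?thesis using False assms by (simp add: unity_root_mult unity_root_eq_1_iff)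
qed

lemma fourier_unique:
  assumes "q > 0" and zero: "\<And>n. (\<Sum>m<q. g m * unity_root q (m * n)) = 0" and "m < q"
  shows "g m = 0"
proof -
  \<comment> \<open>Fourier inversion at \<open>m\<close>; the exponent \<open>q - m\<close> stands
    for \<open>-m\<close>, since exponents are natural numbers.\<close>
  have "0 = (\<Sum>n<q. unity_root q ((q - m) * n) * (\<Sum>j<q. g j * unity_root q (j * n)))"
    by (simp add: zero)
  also have "\<dots> = (\<Sum>j<q. \<Sum>n<q. g j * unity_root q ((q - m + j) * n))"
    by (subst sum.swap) (simp add: sum_distrib_left algebra_simps unity_root_add)
  also have "\<dots> = (\<Sum>j<q. g j * (if q dvd q - m + j then of_nat q else 0))"
    using assms by (simp add: sum_unity_root flip: sum_distrib_left)
  also have "\<dots> = (\<Sum>j<q. if j = m then g j * of_nat q else 0)"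
  proof (rule sum.cong [OF refl])
    fix j assume j: "j \<in> {..<q}"
    have "q dvd q - m + j \<longleftrightarrow> j = m"
    proof
      assume "q dvd q - m + j"
      then obtain c where c: "q - m + j = q * c" by (elim dvdE)
      have "q - m + j < q * 2" "0 < q - m + j" using j \<open>m < q\<close> by auto
      then have "q * c < q * 2" "0 < q * c" using c by simp_all
      then have "c < 2" "0 < c" by simp_all
      then have "c = 1" by simp
      then show "j = m" using c \<open>m < q\<close> by simp
    qed (use \<open>m < q\<close> in simp)
    then show "g j * (if q dvd q - m + j then of_nat q else 0) = (if j = m then g j * of_nat q else 0)"
      by auto
  qed
  also have "\<dots> = g m * of_nat q" using \<open>m < q\<close> by simp
  finally show ?thesis using \<open>q > 0\<close> by simp
qed

lemma sum_periodic_mult: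
  fixes f :: "nat \<Rightarrow> complex"
  assumes per: "\<And>n. f (n + q) = f n" and a: "coprime a q" and "q > 0"
  shows "(\<Sum>m<q. f (a * m)) = (\<Sum>m<q. f m)"
proof -
  have f: "f m = f (m mod q)" for m
    by (rule periodic_cong [where q = q]) (simp_all add: per)
  have inj: "inj_on (\<lambda>m. a * m mod q) {..<q}"
  proof (rule inj_onI)
    fix x y assume "x \<in> {..<q}" "y \<in> {..<q}" "a * x mod q = a * y mod q"
    then show "x = y" using a
      by (metis cong_def cong_mult_lcancel_nat lessThan_iff mod_less)
  qed
  have "(\<lambda>m. a * m mod q) ` {..<q} = {..<q}"
    using inj \<open>q > 0\<close> by (intro endo_inj_surj) auto
  then have "bij_betw (\<lambda>m. a * m mod q) {..<q} {..<q}" using inj by (simp add: bij_betw_def)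
  from sum.reindex_bij_betw [OF this, of f]
  have "(\<Sum>m<q. f (a * m mod q)) = (\<Sum>m<q. f m)" .
  then show ?thesis by (subst f) simp
qed

lemma sum_lessThan_mult:
  fixes f :: "nat \<Rightarrow> complex"
  assumes "q > 0"
  shows "(\<Sum>m<q * r. f m) = (\<Sum>u<q. \<Sum>v<r. f (u + q * v))"
proof -
  have "(\<Sum>m<q * r. f m) = (\<Sum>(u, v)\<in>{..<q} \<times> {..<r}. f (u + q * v))"
  proof (rule sum.reindex_bij_witness [of _ "\<lambda>(u, v). u + q * v" "\<lambda>m. (m mod q, m div q)"], goal_cases)
    case (2 m) then show ?case using assms by (auto simp: less_mult_imp_div_less mult.commute)
  next
    case (4 uv)
    obtain u v where uv: "uv = (u, v)" "u < q" "v < r" using 4 by auto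
    have "u + q * v < q * Suc v" using uv by simp
    also have "\<dots> \<le> q * r" using uv by (intro mult_le_mono2) simp
    finally show ?case using uv by simp
  qed auto
  then show ?thesis by (simp add: sum.cartesian_product)
qed

text \<open>Replacing \<open>m\<close> by \<open>a * m\<close> gives
  \<open>G (a * n) = cnj (\<psi> a) * G n\<close> for units \<open>a\<close>, which settles the case
  of a unit \<open>n\<close>. For other \<open>n\<close>, units congruent to 1 modulo
  \<open>q div gcd n q\<close> fix \<open>n\<close> modulo \<open>q\<close>; a nonzero
  \<open>G n\<close> would make \<open>\<psi>\<close> trivial on them, against primitivity. Finally
  \<open>G 1\<close> is nonzero because otherwise the whole transform of \<open>\<psi>\<close> would
  vanish.\<close>

lemma gauss_sum_separable:
  assumes prim: "primitive_char q \<psi>"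
  obtains \<tau> where "\<tau> \<noteq> 0" "\<And>n. (\<Sum>m<q. \<psi> m * unity_root q (m * n)) = \<tau> * cnj (\<psi> n)"
proof -
  have \<psi>: "dirichlet_char q \<psi>" using prim by (simp add: primitive_char_def)
  have q: "q > 0" using \<psi> by (rule dirichlet_char_pos)
  define G where "G n = (\<Sum>m<q. \<psi> m * unity_root q (m * n))" for n
  have G: "G (a * n) = cnj (\<psi> a) * G n" if "coprime a q" for a n
  proof -
    have "\<psi> a * G (a * n) = (\<Sum>m<q. \<psi> (a * m) * unity_root q (a * m * n))"
      by (simp add: G_def sum_distrib_left dirichlet_char_mult [OF \<psi>] algebra_simps)
    also have "\<dots> = G n" unfolding G_def
    proof (rule sum_periodic_mult [where f = "\<lambda>m. \<psi> m * unity_root q (m * n)", OF _ that q])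
      show "\<psi> (m + q) * unity_root q ((m + q) * n) = \<psi> m * unity_root q (m * n)" for m
        using q by (intro arg_cong2 [of _ _ _ _ "(*)"] dirichlet_char_cong [OF \<psi>] unity_root_cong)
          (auto simp: cong_def algebra_simps)
    qed
    finally have *: "\<psi> a * G (a * n) = G n" .
    show ?thesis
      unfolding * [symmetric] mult.assoc [symmetric] dirichlet_char_cnj_mult [OF \<psi> that] by simp
  qed
  have G0: "G n = 0" if n: "\<not> coprime n q" for n
  proof (rule ccontr)
    assume nz: "G n \<noteq> 0"
    define e where "e = q div gcd n q"
    have qe: "q = e * gcd n q" by (simp add: e_def)
    have "gcd n q \<noteq> 1" using n by (simp add: coprime_iff_gcd_eq_1)
    then have "e \<noteq> q" using qe q by (metis mult_cancel_left mult.right_neutral gr_implies_not0)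
    moreover have "e dvd q" using qe by (metis dvd_triv_left)
    ultimately have e: "e dvd q" "e \<noteq> q" by auto
    have "\<psi> a = 1" if a: "coprime a q" "[a = 1] (mod e)" for a
    proof -
      have "[a * n = 1 * n] (mod (e * gcd n q))"
      proof -
        define g where "g = gcd n q"
        obtain k where k: "n = g * k" unfolding g_def by (metis dvdE gcd_dvd1)
        have "[a * k = 1 * k] (mod e)" using a(2) by (intro cong_mult) auto
        then have "g * (a * k) mod (g * e) = g * k mod (g * e)"
          by (simp add: cong_def mod_mult_mult1)
        then show ?thesis unfolding g_def [symmetric] by (simp add: k cong_def algebra_simps)
      qed
      then have "[a * n = n] (mod q)" by (simp add: e_def)
      then have "G (a * n) = G n" unfolding G_def using q
        by (intro sum.cong refl arg_cong2 [of _ _ _ _ "(*)"] unity_root_cong)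
           (auto simp: cong_mult)
      then have "cnj (\<psi> a) = 1" using G [OF a(1), of n] nz by simp
      then show ?thesis by (metis complex_cnj_cnj complex_cnj_one)
    qed
    then have "\<exists>\<psi>'. induces e \<psi>' q \<psi>" using e by (intro dirichlet_char_factor [OF \<psi>]) auto
    then show False using prim e unfolding primitive_char_def by blast
  qed
  have sep: "G n = G 1 * cnj (\<psi> n)" for n
  proof (cases "coprime n q")
    case True
    then show ?thesis using G [of n 1] by simp
  next
    case False
    then show ?thesis using G0 \<psi> by (simp add: dirichlet_char_eq_0_iff)
  qed
  have "G 1 \<noteq> 0"
  proof
    assume "G 1 = 0"
    then have "G n = 0" for n using sep [of n] by simp
    then have "\<psi> m = 0" if "m < q" for m
      using fourier_unique [OF q, of \<psi>] that unfolding G_def by blast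
    then have "\<psi> (1 mod q) = 0" using q by simp
    moreover have "\<psi> (1 mod q) = \<psi> 1" by (rule dirichlet_char_cong [OF \<psi>]) simp
    ultimately show False using \<psi> by (simp add: dirichlet_char_1)
  qed
  then show thesis using sep that unfolding G_def by blast
qed

text \<open>The index 0 is traded for \<open>q\<close> because the divisor formulas for
  \<open>g\<close> hold for \<open>m \<ge> 1\<close> only.\<close>

lemma sum_lessThan_periodic_shift:
  fixes f :: "nat \<Rightarrow> complex"
  assumes "f q = f 0" "q > 0"
  shows "(\<Sum>m<q. f m) = (\<Sum>m=1..q. f m)"
proof -
  obtain q' where q': "q = Suc q'" using assms(2) gr0_implies_Suc by blast
  have "(\<Sum>m<Suc q'. f m) = f 0 + (\<Sum>m<q'. f (Suc m))" by (rule sum.lessThan_Suc_shift)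
  also have "(\<Sum>m<q'. f (Suc m)) = (\<Sum>m\<in>{1..q'}. f m)"
    by (simp add: sum.atLeast1_atMost_eq)
  finally show ?thesis using assms by (simp add: q')
qed

lemma sum_multiples:
  fixes f :: "nat \<Rightarrow> complex"
  assumes "d > 0" "d dvd q"
  shows "(\<Sum>m=1..q. if d dvd m then f m else 0) = (\<Sum>m=1..q div d. f (d * m))"
proof -
  obtain r where r: "q = d * r" using assms by (elim dvdE)
  have "(\<Sum>m=1..q. if d dvd m then f m else 0) = (\<Sum>m | m \<in> {1..q} \<and> d dvd m. f m)"
    by (rule sum.inter_filter [symmetric]) simp
  also have "\<dots> = (\<Sum>m=1..r. f (d * m))"
  proof (rule sum.reindex_bij_witness [of _ "\<lambda>m. d * m" "\<lambda>m. m div d"], goal_cases)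
    case (2 m)
    then obtain k where "m = d * k" by blast
    then show ?case using 2 assms by (simp add: r Suc_le_eq)
  qed (use assms in \<open>auto simp: r Suc_le_eq\<close>)
  finally show ?thesis using assms by (simp add: r)
qed

text \<open>Write \<open>m = u + q0 * v\<close>. The character sees only \<open>u\<close>, and the
  sum over \<open>v\<close> is a complete sum of roots of unity of order \<open>r\<close>, which
  forces \<open>r\<close> to divide \<open>n\<close>.\<close>

lemma gauss_sum_multiple_modulus:
  assumes \<psi>: "dirichlet_char q0 \<psi>"
    and gauss: "\<And>n. (\<Sum>m<q0. \<psi> m * unity_root q0 (m * n)) = \<tau> * cnj (\<psi> n)"
    and "r > 0"
  shows "(\<Sum>m<q0 * r. \<psi> m * unity_root (q0 * r) (m * n)) =
    (if r dvd n then of_nat r * \<tau> * cnj (\<psi> (n div r)) else 0)"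
proof -
  have q0: "q0 > 0" using \<psi> by (rule dirichlet_char_pos)
  have "(\<Sum>m<q0 * r. \<psi> m * unity_root (q0 * r) (m * n)) =
      (\<Sum>u<q0. \<Sum>v<r. \<psi> (u + q0 * v) * unity_root (q0 * r) ((u + q0 * v) * n))"
    by (rule sum_lessThan_mult [OF q0])
  also have "\<dots> = (\<Sum>u<q0. \<Sum>v<r. \<psi> u * unity_root (q0 * r) (u * n) * unity_root r (n * v))"
  proof (intro sum.cong refl)
    fix u v
    have "\<psi> (u + q0 * v) = \<psi> u" by (rule dirichlet_char_cong [OF \<psi>]) (simp add: cong_def)
    moreover have "unity_root (q0 * r) ((u + q0 * v) * n) =
        unity_root (q0 * r) (u * n) * unity_root (q0 * r) (q0 * (n * v))"
      by (simp add: algebra_simps flip: unity_root_add)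
    ultimately show "\<psi> (u + q0 * v) * unity_root (q0 * r) ((u + q0 * v) * n) =
        \<psi> u * unity_root (q0 * r) (u * n) * unity_root r (n * v)"
      using q0 by (simp add: unity_root_cancel)
  qed
  also have "\<dots> = (\<Sum>u<q0. \<psi> u * unity_root (q0 * r) (u * n)) * (if r dvd n then of_nat r else 0)"
    by (simp add: sum_unity_root [OF \<open>r > 0\<close>] sum_distrib_right flip: sum_distrib_left)
  also have "\<dots> = (if r dvd n then of_nat r * \<tau> * cnj (\<psi> (n div r)) else 0)"
  proof (cases "r dvd n")
    case True
    then obtain k where k: "n = r * k" by (elim dvdE)
    have "(\<Sum>u<q0. \<psi> u * unity_root (q0 * r) (u * n)) = (\<Sum>u<q0. \<psi> u * unity_root (r * q0) (r * (u * k)))"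
      by (simp add: k algebra_simps)
    also have "\<dots> = \<tau> * cnj (\<psi> k)" using \<open>r > 0\<close> by (simp add: unity_root_cancel gauss)
    finally show ?thesis using True \<open>r > 0\<close> by (simp add: k)
  qed simp
  finally show ?thesis .
qed

section \<open>Transforms of twisted divisor sums, and the gcd rule\<close>

lemma bij_betw_divisors:
  "N > 0 \<Longrightarrow> bij_betw (\<lambda>d. N div d) {d. d dvd N} {d. d dvd (N::nat)}"
proof (rule bij_betwI [where g = "\<lambda>d. N div d"])
  assume "N > 0"
  have "N div d dvd N" if "d dvd N" for d
    using that by (metis dvd_mult_div_cancel dvd_triv_right)
  then show "(\<lambda>d. N div d) \<in> {d. d dvd N} \<rightarrow> {d. d dvd N}" "(\<lambda>d. N div d) \<in> {d. d dvd N} \<rightarrow> {d. d dvd N}"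
    by auto
qed (simp_all add: div_div_eq_right)

text \<open>Each term of \<open>g\<close> is a copy of \<open>\<psi>\<close> stretched by a divisor
  \<open>d\<close> of \<open>N\<close>. Its transform is a Gauss sum to the modulus
  \<open>q0 * (N div d)\<close> and lives on the multiples of the complementary divisor
  \<open>e = N div d\<close>. This is the origin of the reversed argument in the coefficients of the
  Dirichlet polynomial.\<close>

lemma fourier_twisted_convolution:
  assumes \<psi>: "dirichlet_char q0 \<psi>"
    and gauss: "\<And>n. (\<Sum>m<q0. \<psi> m * unity_root q0 (m * n)) = \<tau> * cnj (\<psi> n)"
    and "N > 0" and per: "g (q0 * N) = g 0"
    and g: "\<And>m. m \<ge> 1 \<Longrightarrow> g m = (\<Sum>d | d dvd gcd m N. h d * \<psi> (m div d))"
  shows "(\<Sum>m<q0 * N. g m * unity_root (q0 * N) (m * n)) =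
    \<tau> * (\<Sum>e | e dvd N. if e dvd n then h (N div e) * of_nat e * cnj (\<psi> (n div e)) else 0)"
proof -
  define q where "q = q0 * N"
  have q0: "q0 > 0" using \<psi> by (rule dirichlet_char_pos)
  have q: "q > 0" using q0 \<open>N > 0\<close> by (simp add: q_def)
  have ur: "unity_root q (q * n) = 1" for n using q by (simp add: unity_root_eq_1_iff)
  have fin: "finite {d. d dvd N}" using \<open>N > 0\<close> by simp
  have "(\<Sum>m<q. g m * unity_root q (m * n)) = (\<Sum>m=1..q. g m * unity_root q (m * n))"
    using per q by (intro sum_lessThan_periodic_shift) (simp_all add: q_def [symmetric] ur)
  also have "\<dots> = (\<Sum>m=1..q. \<Sum>d | d dvd N. if d dvd m then h d * \<psi> (m div d) * unity_root q (m * n) else 0)"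
  proof (intro sum.cong refl)
    fix m assume "m \<in> {1..q}"
    then have "g m = (\<Sum>d | d dvd gcd m N. h d * \<psi> (m div d))" by (intro g) simp
    also have "{d. d dvd gcd m N} = {d. d \<in> {d. d dvd N} \<and> d dvd m}" by auto
    also have "(\<Sum>d\<in>\<dots>. h d * \<psi> (m div d)) = (\<Sum>d | d dvd N. if d dvd m then h d * \<psi> (m div d) else 0)"
      using fin by (rule sum.inter_filter)
    finally show "g m * unity_root q (m * n) =
        (\<Sum>d | d dvd N. if d dvd m then h d * \<psi> (m div d) * unity_root q (m * n) else 0)"
      by (simp add: sum_distrib_right if_distrib if_distribR cong: if_cong)
  qed
  also have "\<dots> = (\<Sum>d | d dvd N. \<Sum>m=1..q. if d dvd m then h d * \<psi> (m div d) * unity_root q (m * n) else 0)"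
    by (rule sum.swap)
  also have "\<dots> = (\<Sum>d | d dvd N. h d * (if N div d dvd n then of_nat (N div d) * \<tau> * cnj (\<psi> (n div (N div d))) else 0))"
  proof (intro sum.cong refl)
    fix d assume "d \<in> {d. d dvd N}"
    then obtain r where r: "N = d * r" by auto
    then have pos: "d > 0" "r > 0" using \<open>N > 0\<close> by auto
    have "(\<Sum>m=1..q. if d dvd m then h d * \<psi> (m div d) * unity_root q (m * n) else 0) =
        (\<Sum>m=1..q div d. h d * \<psi> (d * m div d) * unity_root q (d * m * n))"
      using pos by (intro sum_multiples) (auto simp: q_def r)
    also have "q div d = q0 * r" using pos by (simp add: q_def r)
    also have "(\<Sum>m=1..q0 * r. h d * \<psi> (d * m div d) * unity_root q (d * m * n)) =
        h d * (\<Sum>m=1..q0 * r. \<psi> m * unity_root (q0 * r) (m * n))"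
      unfolding sum_distrib_left
    proof (intro sum.cong refl)
      fix m
      have "unity_root q (d * m * n) = unity_root (d * (q0 * r)) (d * (m * n))"
        by (simp add: q_def r algebra_simps)
      then show "h d * \<psi> (d * m div d) * unity_root q (d * m * n) =
          h d * (\<psi> m * unity_root (q0 * r) (m * n))"
        using pos by (simp add: unity_root_cancel)
    qed
    also have "(\<Sum>m=1..q0 * r. \<psi> m * unity_root (q0 * r) (m * n)) = (\<Sum>m<q0 * r. \<psi> m * unity_root (q0 * r) (m * n))"
    proof (rule sum_lessThan_periodic_shift [symmetric])
      have "\<psi> (q0 * r) = \<psi> 0" by (rule dirichlet_char_cong [OF \<psi>]) (simp add: cong_def)
      then show "\<psi> (q0 * r) * unity_root (q0 * r) (q0 * r * n) = \<psi> 0 * unity_root (q0 * r) (0 * n)"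
        using pos q0 unity_root_eq_1_iff [of "q0 * r" "q0 * r * n"] by simp
    qed (use pos q0 in simp)
    also have "\<dots> = (if r dvd n then of_nat r * \<tau> * cnj (\<psi> (n div r)) else 0)"
      using pos by (intro gauss_sum_multiple_modulus [OF \<psi> gauss]) auto
    also have "r = N div d" using pos by (simp add: r)
    finally show "(\<Sum>m=1..q. if d dvd m then h d * \<psi> (m div d) * unity_root q (m * n) else 0) =
        h d * (if N div d dvd n then of_nat (N div d) * \<tau> * cnj (\<psi> (n div (N div d))) else 0)" .
  qed
  also have "\<dots> = (\<Sum>d | d dvd N. h (N div (N div d)) *
      (if N div d dvd n then of_nat (N div d) * \<tau> * cnj (\<psi> (n div (N div d))) else 0))"
    using \<open>N > 0\<close> by (intro sum.cong) (auto simp: div_div_eq_right)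
  also have "\<dots> = (\<Sum>e | e dvd N. h (N div e) * (if e dvd n then of_nat e * \<tau> * cnj (\<psi> (n div e)) else 0))"
    by (rule sum.reindex_bij_betw [OF bij_betw_divisors [OF \<open>N > 0\<close>]])
  finally have *: "(\<Sum>m<q. g m * unity_root q (m * n)) =
    (\<Sum>e | e dvd N. h (N div e) * (if e dvd n then of_nat e * \<tau> * cnj (\<psi> (n div e)) else 0))" .
  show ?thesis
    unfolding sum_distrib_left * [unfolded q_def] by (rule sum.cong) (auto simp: mult_ac)
qed

text \<open>Since \<open>\<psi>\<close> is completely multiplicative, its Dirichlet inverse is its
  pointwise product with \<open>moebius_mu\<close>. Along a chain of divisors \<open>e\<close>,
  \<open>d\<close>, \<open>m\<close> the two values of \<open>\<psi>\<close> combine to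
  \<open>\<psi> (m div e)\<close>, which does not depend on \<open>d\<close>, and the sum of the
  Moebius function removes every \<open>e\<close> except \<open>m\<close>.\<close>

lemma dconv_moebius_inverse:
  assumes \<psi>: "dirichlet_char q0 \<psi>" and "m > 0"
  shows "g m = (\<Sum>d | d dvd m. dconv g (\<lambda>n. moebius_mu n * \<psi> n) d * \<psi> (m div d))"
proof -
  have fin: "finite {d. d dvd m}" using \<open>m > 0\<close> by simp
  have "(\<Sum>d | d dvd m. dconv g (\<lambda>n. moebius_mu n * \<psi> n) d * \<psi> (m div d)) =
      (\<Sum>d | d dvd m. \<Sum>e | e dvd d. g e * moebius_mu (d div e) * \<psi> (d div e) * \<psi> (m div d))"
  proof (intro sum.cong refl)
    fix d assume "d \<in> {d. d dvd m}"
    then have "d > 0" using \<open>m > 0\<close> by (auto intro: Nat.gr0I)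
    have "dconv g (\<lambda>n. moebius_mu n * \<psi> n) d =
        (\<Sum>e | e dvd d. g (d div e) * (moebius_mu (d div (d div e)) * \<psi> (d div (d div e))))"
      unfolding dconv_def using \<open>d > 0\<close> by (intro sum.cong refl) (auto simp: div_div_eq_right)
    also have "\<dots> = (\<Sum>e | e dvd d. g e * (moebius_mu (d div e) * \<psi> (d div e)))"
      by (rule sum.reindex_bij_betw [OF bij_betw_divisors [OF \<open>d > 0\<close>]])
    finally show "dconv g (\<lambda>n. moebius_mu n * \<psi> n) d * \<psi> (m div d) =
        (\<Sum>e | e dvd d. g e * moebius_mu (d div e) * \<psi> (d div e) * \<psi> (m div d))"
      by (simp add: sum_distrib_right mult.assoc)
  qed
  also have "\<dots> = (\<Sum>(d, e)\<in>(SIGMA d:{d. d dvd m}. {e. e dvd d}).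
      g e * moebius_mu (d div e) * \<psi> (d div e) * \<psi> (m div d))"
    using \<open>m > 0\<close> fin by (subst sum.Sigma) (auto intro!: finite_divisors_nat Nat.gr0I)
  also have "\<dots> = (\<Sum>(e, k)\<in>(SIGMA e:{e. e dvd m}. {k. k dvd m div e}).
      g e * \<psi> (m div e) * moebius_mu k)"
  proof (rule sum.reindex_bij_witness [of _ "\<lambda>(e, k). (e * k, e)" "\<lambda>(d, e). (e, d div e)"], goal_cases)
    case (1 x)
    then show ?case using \<open>m > 0\<close> by (auto simp: dvd_pos_nat)
  next
    case (2 x)
    then obtain e k j where *: "x = (e * k, e)" "m = e * k * j" by (auto elim!: dvdE)
    then have "e > 0" "k > 0" using \<open>m > 0\<close> by auto
    then show ?case using * by auto
  next
    case (3 x)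
    then show ?case using \<open>m > 0\<close> by (auto simp: dvd_pos_nat)
  next
    case (4 x)
    then obtain e k where "x = (e, k)" "e dvd m" "k dvd m div e" by auto
    then show ?case using \<open>m > 0\<close> by (auto simp: dvd_pos_nat dvd_div_iff_mult mult.commute)
  next
    case (5 x)
    then obtain e k j where *: "x = (e * k, e)" "m = e * k * j" by (auto elim!: dvdE)
    then have "e > 0" "k > 0" using \<open>m > 0\<close> by auto
    then show ?case using * by (simp add: mult.assoc dirichlet_char_mult [OF \<psi>])
  qed
  also have "\<dots> = (\<Sum>e | e dvd m. \<Sum>k | k dvd m div e. g e * \<psi> (m div e) * moebius_mu k)"
    using \<open>m > 0\<close> fin by (subst sum.Sigma) (auto intro!: finite_divisors_nat Nat.gr0I simp: dvd_div_eq_0_iff)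
  also have "\<dots> = (\<Sum>e | e dvd m. if e = m then g m else 0)"
  proof (intro sum.cong refl)
    fix e assume "e \<in> {e. e dvd m}"
    then obtain k where k: "m = e * k" by auto
    then have "e > 0" "k > 0" using \<open>m > 0\<close> by auto
    then show "(\<Sum>k | k dvd m div e. g e * \<psi> (m div e) * moebius_mu k) = (if e = m then g m else 0)"
      using \<psi> by (auto simp: k sum_moebius_mu dirichlet_char_1 simp flip: sum_distrib_left)
  qed
  also have "\<dots> = g m" using fin by simp
  finally show ?thesis ..
qed

text \<open>The inversion formula is applied at \<open>gcd m N\<close> instead of \<open>m\<close>;
  the remaining factor \<open>\<psi> (m div gcd m N)\<close> is absorbed into the terms by
  multiplicativity. So only divisors of \<open>N\<close> occur.\<close>

lemma twisted_convolution_of_gcd_rule: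
  assumes \<psi>: "dirichlet_char q0 \<psi>" and "N > 0"
    and g: "\<And>m. m \<ge> 1 \<Longrightarrow> g m = g (gcd m N) * \<psi> (m div gcd m N)" and "m \<ge> 1"
  shows "g m = (\<Sum>d | d dvd gcd m N. dconv g (\<lambda>n. moebius_mu n * \<psi> n) d * \<psi> (m div d))"
proof -
  define c where "c = gcd m N"
  obtain k where k: "m = c * k" unfolding c_def by (metis dvdE gcd_dvd1)
  have c: "c > 0" using \<open>N > 0\<close> by (simp add: c_def)
  have "g m = g c * \<psi> k" using g [OF \<open>m \<ge> 1\<close>] c unfolding c_def [symmetric] by (simp add: k)
  also have "\<dots> = (\<Sum>d | d dvd c. dconv g (\<lambda>n. moebius_mu n * \<psi> n) d * \<psi> (c div d) * \<psi> k)"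
    by (subst dconv_moebius_inverse [OF \<psi> c, of g]) (simp add: sum_distrib_right)
  also have "\<dots> = (\<Sum>d | d dvd c. dconv g (\<lambda>n. moebius_mu n * \<psi> n) d * \<psi> (m div d))"
  proof (intro sum.cong refl)
    fix d assume "d \<in> {d. d dvd c}"
    then have "m div d = c div d * k" by (auto simp: k div_mult_swap mult.commute)
    then show "dconv g (\<lambda>n. moebius_mu n * \<psi> n) d * \<psi> (c div d) * \<psi> k =
        dconv g (\<lambda>n. moebius_mu n * \<psi> n) d * \<psi> (m div d)"
      by (simp add: dirichlet_char_mult [OF \<psi>])
  qed
  finally show ?thesis unfolding c_def .
qed

text \<open>Up to a unit, \<open>m\<close> modulo \<open>q\<close> is its gcd \<open>d\<close> with
  \<open>q\<close>, so \<open>g m = \<psi> a * g d\<close> for a unit \<open>a\<close> lifting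
  \<open>m div d\<close>. If \<open>d\<close> divides \<open>N\<close>, then \<open>d\<close> is
  also the gcd of \<open>m\<close> with \<open>N\<close> and this is the claim. Otherwise both sides
  are 0.\<close>

lemma gcd_rule_of_equivariant:
  assumes prim: "primitive_char q0 \<psi>" and ind: "induces q0 \<psi> q chi" and "q > 0"
    and per: "\<And>m. g (m + q) = g m"
    and eqv: "\<And>a m. coprime a q \<Longrightarrow> g (a * m) = chi a * g m"
    and "m \<ge> 1"
  shows "g m = g (gcd m (q div q0)) * \<psi> (m div gcd m (q div q0))"
proof -
  have \<psi>: "dirichlet_char q0 \<psi>" and "q0 dvd q" using prim ind by (auto simp: primitive_char_def induces_def)
  have chi: "chi a = \<psi> a" if "coprime a q" for a
    using ind that by (simp add: induces_def principal_char_def)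
  define N where "N = q div q0"
  have qN: "q = q0 * N" using \<open>q0 dvd q\<close> by (simp add: N_def)
  have N: "N > 0" using qN \<open>q > 0\<close> by (auto intro: Nat.gr0I)
  define d where "d = gcd m q"
  define e where "e = q div d"
  define u where "u = m div d"
  have d: "d > 0" using \<open>q > 0\<close> by (simp add: d_def)
  have m: "m = d * u" and q: "q = d * e" by (simp_all add: d_def e_def u_def)
  have "coprime u e" unfolding u_def e_def d_def using \<open>q > 0\<close> by (intro div_gcd_coprime) simp
  then obtain a where a: "[a = u] (mod e)" "coprime a q" using coprime_lift \<open>q > 0\<close> by blast
  have gcong: "g x = g y" if "[x = y] (mod (e * d))" for x y
  proof (rule periodic_cong [where q = q])
    show "g (n + q) = g n" for n by (rule per)
    show "[x = y] (mod q)" using that q by (simp add: mult.commute)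
  qed
  have "[a * d = u * d] (mod (e * d))" using a(1) by (simp add: cong_def mod_mult_mult2)
  then have "g (a * d) = g m" using gcong m by (simp add: mult.commute)
  then have gm: "g m = \<psi> a * g d" using eqv [OF a(2)] chi a(2) by simp
  show ?thesis
  proof (cases "d dvd N")
    case True
    then obtain k where k: "N = d * k" by (elim dvdE)
    have ek: "e = q0 * k" using q d by (simp add: qN k)
    then have "coprime u k" using \<open>coprime u e\<close> by simp
    then have "gcd m N = d" by (simp add: m k gcd_mult_distrib_nat [symmetric])
    moreover have "[a = u] (mod q0)" using a(1) ek by (auto intro: cong_dvd_modulus_nat)
    then have "\<psi> u = \<psi> a" using dirichlet_char_cong [OF \<psi>] by metis
    ultimately show ?thesis using gm d by (simp add: N_def [symmetric] m)
  next
    case False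
    \<comment> \<open>Units congruent to 1 modulo \<open>e\<close> fix \<open>d\<close> modulo
      \<open>q\<close>. Were \<open>g d\<close> nonzero, \<open>\<psi>\<close> would be trivial on
      them, so \<open>q0\<close> would divide \<open>e\<close> and \<open>d\<close> would divide
      \<open>N\<close>.\<close>
    have "g d = 0"
    proof (rule ccontr)
      assume nz: "g d \<noteq> 0"
      have "q0 dvd e"
      proof (rule primitive_char_dvd [OF prim \<open>q0 dvd q\<close> _ \<open>q > 0\<close>])
        show "e dvd q" by (simp add: q)
        fix b assume b: "coprime b q" "[b = 1] (mod e)"
        then have "[b * d = 1 * d] (mod (e * d))" by (simp add: cong_def mod_mult_mult2)
        then have "g (b * d) = g (1 * d)" by (rule gcong)
        then have "g (b * d) = g d" by simp
        then show "\<psi> b = 1" using eqv [OF b(1), of d] chi [OF b(1)] nz by simp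
      qed
      then obtain k where "e = q0 * k" by (elim dvdE)
      then have "N = d * k" using q qN dirichlet_char_pos [OF \<psi>] by simp
      then show False using False by simp
    qed
    \<comment> \<open>The quotient \<open>r\<close> of \<open>d\<close> by \<open>gcd m N\<close> is
      a common factor of \<open>q0\<close> and the argument, and it exceeds 1 because
      \<open>d\<close> does not divide \<open>N\<close>.\<close>
    moreover have "\<psi> (m div gcd m N) = 0"
    proof -
      define c where "c = gcd m N"
      have c: "c > 0" using N by (simp add: c_def)
      have "c dvd m" "c dvd N" by (simp_all add: c_def)
      then have "c dvd d" unfolding d_def qN by (intro gcd_greatest dvd_mult)
      then obtain r where r: "d = c * r" by (elim dvdE)
      have "c dvd N" by (simp add: c_def)
      then obtain l where l: "N = c * l" by (elim dvdE)
      have "coprime (m div c) (N div c)" unfolding c_def using N by (intro div_gcd_coprime) simp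
      moreover have "N div c = l" using l c by simp
      ultimately have "coprime (m div c) l" by simp
      then have cl: "coprime r l" using r m c by (simp add: mult.assoc)
      have "r \<noteq> 1" using False r \<open>c dvd N\<close> by auto
      have "c * (q0 * l) = c * (r * e)" using q qN r l by (simp add: mult_ac)
      then have "r dvd q0 * l" using c by simp
      then have "r dvd q0" using cl by (simp add: coprime_dvd_mult_left_iff)
      moreover have "r dvd m div c" using m r c by (simp add: mult.assoc)
      ultimately have "\<not> coprime (m div c) q0"
        using \<open>r \<noteq> 1\<close> by (metis coprime_common_divisor nat_dvd_1_iff_1)
      then show ?thesis using \<psi> unfolding c_def by (simp add: dirichlet_char_eq_0_iff)
    qed
    ultimately show ?thesis using gm by (simp add: N_def)
  qed
qed

subsection \<open>Square summable sequences and dilations\<close>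

definition l2 :: "(nat \<Rightarrow> complex) \<Rightarrow> bool" where
  "l2 x \<longleftrightarrow> summable (\<lambda>n. (norm (x n))\<^sup>2)"

definition l2norm :: "(nat \<Rightarrow> complex) \<Rightarrow> real" where
  "l2norm x = sqrt (\<Sum>n. (norm (x n))\<^sup>2)"

text \<open>This operator moves the basis vector at \<open>n\<close> to \<open>k * n\<close>, as the
  substitution of \<open>k * x\<close> does in a sine series. It fixes the index 0, where the
  coefficient sequences of interest vanish.\<close>

definition dil :: "nat \<Rightarrow> (nat \<Rightarrow> complex) \<Rightarrow> nat \<Rightarrow> complex" where
  "dil k a n = (if k dvd n then a (n div k) else 0)"

definition unit_seq :: "nat \<Rightarrow> complex" where
  "unit_seq n = (if n = 1 then 1 else 0)"

lemma L2_set_le_l2norm: "l2 x \<Longrightarrow> finite A \<Longrightarrow> L2_set (\<lambda>n. norm (x n)) A \<le> l2norm x"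
  unfolding L2_set_def l2norm_def l2_def by (intro real_sqrt_le_mono sum_le_suminf) auto

lemma l2_bound:
  assumes "\<And>m. L2_set (\<lambda>n. norm (x n)) {..<m} \<le> B"
  shows "l2 x" "l2norm x \<le> B"
proof -
  have B: "B \<ge> 0" using order_trans [OF L2_set_nonneg assms] .
  have *: "(\<Sum>n<m. (norm (x n))\<^sup>2) \<le> B\<^sup>2" for m
    using assms [of m] B unfolding L2_set_def by (simp add: sqrt_le_D)
  then show "l2 x" unfolding l2_def
    by (intro bounded_imp_summable [where B = "B\<^sup>2"]) (use * [of "Suc _"] in \<open>auto simp: lessThan_Suc_atMost\<close>)
  then have "(\<Sum>n. (norm (x n))\<^sup>2) \<le> B\<^sup>2" unfolding l2_def by (intro suminf_le_const *)
  then show "l2norm x \<le> B" unfolding l2norm_def by (metis B real_sqrt_le_mono real_sqrt_abs abs_of_nonneg)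
qed

lemma l2_add:
  assumes "l2 x" "l2 y"
  shows "l2 (\<lambda>n. x n + y n)" "l2norm (\<lambda>n. x n + y n) \<le> l2norm x + l2norm y"
proof -
  have "L2_set (\<lambda>n. norm (x n + y n)) {..<m} \<le> l2norm x + l2norm y" for m
  proof -
    have "L2_set (\<lambda>n. norm (x n + y n)) {..<m} \<le> L2_set (\<lambda>n. norm (x n) + norm (y n)) {..<m}"
      by (intro L2_set_mono norm_triangle_ineq) auto
    also have "\<dots> \<le> L2_set (\<lambda>n. norm (x n)) {..<m} + L2_set (\<lambda>n. norm (y n)) {..<m}"
      by (rule L2_set_triangle_ineq)
    also have "\<dots> \<le> l2norm x + l2norm y" using assms by (intro add_mono L2_set_le_l2norm) auto
    finally show ?thesis .
  qed
  then show "l2 (\<lambda>n. x n + y n)" "l2norm (\<lambda>n. x n + y n) \<le> l2norm x + l2norm y"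
    by (rule l2_bound)+
qed

lemma l2_scale:
  assumes "l2 x"
  shows "l2 (\<lambda>n. c * x n)" "l2norm (\<lambda>n. c * x n) = norm c * l2norm x"
  using assms unfolding l2_def l2norm_def
  by (simp_all add: norm_mult power_mult_distrib suminf_mult real_sqrt_mult)

lemma l2_zero: "l2 (\<lambda>n. 0)" "l2norm (\<lambda>n. 0) = 0"
  by (simp_all add: l2_def l2norm_def)



lemma l2_diff:
  assumes "l2 x" "l2 y"
  shows "l2 (\<lambda>n. x n - y n)" "l2norm (\<lambda>n. x n - y n) \<le> l2norm x + l2norm y"
  using l2_add [OF assms(1) l2_scale(1) [OF assms(2), of "-1"]] l2_scale(2) [OF assms(2), of "-1"] by simp_all

lemma l2_sum:
  assumes "finite A" "\<And>i. i \<in> A \<Longrightarrow> l2 (x i)"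
  shows "l2 (\<lambda>n. \<Sum>i\<in>A. x i n)" "l2norm (\<lambda>n. \<Sum>i\<in>A. x i n) \<le> (\<Sum>i\<in>A. l2norm (x i))"
proof -
  have "l2 (\<lambda>n. \<Sum>i\<in>A. x i n) \<and> l2norm (\<lambda>n. \<Sum>i\<in>A. x i n) \<le> (\<Sum>i\<in>A. l2norm (x i))"
    using assms
  proof (induction A rule: finite_induct)
    case (insert i A)
    then have IH: "l2 (\<lambda>n. \<Sum>i\<in>A. x i n)" "l2norm (\<lambda>n. \<Sum>i\<in>A. x i n) \<le> (\<Sum>i\<in>A. l2norm (x i))" by auto
    have xi: "l2 (x i)" using insert by auto
    show ?case using l2_add [OF xi IH(1)] IH(2) insert.hyps by simp
  qed (simp add: l2_zero)
  then show "l2 (\<lambda>n. \<Sum>i\<in>A. x i n)" "l2norm (\<lambda>n. \<Sum>i\<in>A. x i n) \<le> (\<Sum>i\<in>A. l2norm (x i))" by auto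
qed

lemma l2_finite_support:
  assumes "\<And>n. n \<notin> A \<Longrightarrow> x n = 0" "finite A"
  shows "l2 x" "l2norm x = sqrt (\<Sum>n\<in>A. (norm (x n))\<^sup>2)"
  unfolding l2_def l2norm_def using assms by (auto intro!: summable_finite suminf_finite)

lemma l2_unit_seq: "l2 unit_seq"
  by (rule l2_finite_support [of "{1}"]) (auto simp: unit_seq_def)

lemma dil_reindex:
  fixes f :: "nat \<Rightarrow> 'a::real_normed_vector"
  assumes "k > 0" "\<And>n. \<not> k dvd n \<Longrightarrow> f n = 0"
  shows "summable f \<longleftrightarrow> summable (\<lambda>n. f (k * n))" "suminf f = (\<Sum>n. f (k * n))"
proof -
  have mono: "strict_mono (\<lambda>n. k * n)" using assms(1) by (simp add: strict_mono_def)
  have range: "f n = 0" if "n \<notin> range (\<lambda>n. k * n)" for n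
    using that by (intro assms(2)) (auto simp: dvd_def)
  show "summable f \<longleftrightarrow> summable (\<lambda>n. f (k * n))"
    using summable_mono_reindex [OF mono, of f] range by simp
  show "suminf f = (\<Sum>n. f (k * n))"
    using suminf_mono_reindex [OF mono, of f] range by simp
qed

lemma dil_times [simp]: "k > 0 \<Longrightarrow> dil k a (k * n) = a n"
  by (simp add: dil_def)

lemma l2_dil:
  assumes "k > 0" "l2 a"
  shows "l2 (dil k a)" "l2norm (dil k a) = l2norm a"
proof -
  have z: "(norm (dil k a n))\<^sup>2 = 0" if "\<not> k dvd n" for n using that by (simp add: dil_def)
  show "l2 (dil k a)" using assms dil_reindex(1) [of k, OF _ z] unfolding l2_def by simp
  show "l2norm (dil k a) = l2norm a" using assms dil_reindex(2) [of k, OF _ z] unfolding l2norm_def by simp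
qed

lemma dil_dil: "k > 0 \<Longrightarrow> m > 0 \<Longrightarrow> dil m (dil k a) = dil (m * k) a"
  by (auto simp: dil_def fun_eq_iff dvd_div_iff_mult div_mult2_eq mult.commute)

lemma dil_1 [simp]: "dil (Suc 0) a = a"
  by (simp add: dil_def fun_eq_iff)

lemma dil_sum_scale: "dil m (\<lambda>n. \<Sum>k\<in>A. c k * x k n) = (\<lambda>n. \<Sum>k\<in>A. c k * dil m (x k) n)"
  by (auto simp: dil_def fun_eq_iff)

section \<open>The closed span of the dilates\<close>

definition dspan :: "(nat \<Rightarrow> complex) \<Rightarrow> (nat \<Rightarrow> complex) set" where
  "dspan a = {x. \<exists>K c. x = (\<lambda>n. \<Sum>k=1..K. c k * dil k a n)}"

definition dclosure :: "(nat \<Rightarrow> complex) \<Rightarrow> (nat \<Rightarrow> complex) set" where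
  "dclosure a = {x. l2 x \<and> (\<forall>\<epsilon>>0. \<exists>y\<in>dspan a. l2norm (\<lambda>n. x n - y n) < \<epsilon>)}"

text \<open>Testing the first basis vector is enough, because the closure is invariant under
  dilations and these move \<open>unit_seq\<close> to all other basis vectors; see
  \<open>dclosure_everything\<close>.\<close>

definition cyclic_seq :: "(nat \<Rightarrow> complex) \<Rightarrow> bool" where
  "cyclic_seq a \<longleftrightarrow> unit_seq \<in> dclosure a"

lemma dspan_l2: "l2 a \<Longrightarrow> y \<in> dspan a \<Longrightarrow> l2 y"
  unfolding dspan_def by (auto intro!: l2_sum(1) l2_scale(1) l2_dil)

lemma dspan_dil: "m > 0 \<Longrightarrow> dil m a \<in> dspan a"
  unfolding dspan_def
  by (intro CollectI exI [of _ m] exI [of _ "\<lambda>k. if k = m then 1 else 0"]) (auto simp: fun_eq_iff mult_delta_left)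

lemma dspan_scale: "x \<in> dspan a \<Longrightarrow> (\<lambda>n. c * x n) \<in> dspan a"
proof -
  assume "x \<in> dspan a"
  then obtain K d where "x = (\<lambda>n. \<Sum>k=1..K. d k * dil k a n)" by (auto simp: dspan_def)
  then have "(\<lambda>n. c * x n) = (\<lambda>n. \<Sum>k=1..K. (c * d k) * dil k a n)"
    by (simp add: sum_distrib_left mult.assoc)
  then show ?thesis unfolding dspan_def by (auto intro!: exI [of _ K])
qed

lemma dspan_add:
  assumes "x \<in> dspan a" "y \<in> dspan a"
  shows "(\<lambda>n. x n + y n) \<in> dspan a"
proof -
  obtain K c where x: "x = (\<lambda>n. \<Sum>k=1..K. c k * dil k a n)" using assms by (auto simp: dspan_def)
  obtain L d where y: "y = (\<lambda>n. \<Sum>k=1..L. d k * dil k a n)" using assms by (auto simp: dspan_def)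
  have ext: "(\<Sum>k=1..K. c k * dil k a n) = (\<Sum>k=1..max K L. (if k \<le> K then c k else 0) * dil k a n)" for n K L c
    by (rule sum.mono_neutral_cong_left) auto
  have "(\<lambda>n. x n + y n) = (\<lambda>n. \<Sum>k=1..max K L. ((if k \<le> K then c k else 0) + (if k \<le> L then d k else 0)) * dil k a n)"
  proof
    fix n
    show "x n + y n = (\<Sum>k=1..max K L. ((if k \<le> K then c k else 0) + (if k \<le> L then d k else 0)) * dil k a n)"
      unfolding x y ext [of c n K L] ext [of d n L K] max.commute [of L K] distrib_right sum.distrib ..
  qed
  then show ?thesis unfolding dspan_def
    by (intro CollectI exI [of _ "max K L"] exI [of _ "\<lambda>k. (if k \<le> K then c k else 0) + (if k \<le> L then d k else 0)"])
qed

lemma dspan_sum: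
  assumes "finite A" "\<And>i. i \<in> A \<Longrightarrow> x i \<in> dspan a"
  shows "(\<lambda>n. \<Sum>i\<in>A. x i n) \<in> dspan a"
  using assms
proof (induction A rule: finite_induct)
  case empty
  have "(\<lambda>n. 0) \<in> dspan a" unfolding dspan_def by (intro CollectI exI [of _ 0]) simp
  then show ?case by simp
qed (simp add: dspan_add)

lemma dspan_dil_closed:
  assumes "m > 0" "x \<in> dspan a"
  shows "dil m x \<in> dspan a"
proof -
  obtain K c where x: "x = (\<lambda>n. \<Sum>k=1..K. c k * dil k a n)" using assms by (auto simp: dspan_def)
  show ?thesis unfolding x dil_sum_scale
    using assms(1) by (intro dspan_sum dspan_scale) (auto simp: dil_dil intro!: dspan_dil)
qed

lemma dclosure_l2: "x \<in> dclosure a \<Longrightarrow> l2 x"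
  by (simp add: dclosure_def)

lemma dclosureE:
  assumes "x \<in> dclosure a" "\<epsilon> > 0"
  obtains y where "y \<in> dspan a" "l2norm (\<lambda>n. x n - y n) < \<epsilon>"
  using assms by (auto simp: dclosure_def)

lemma dspan_subset_dclosure: "l2 a \<Longrightarrow> x \<in> dspan a \<Longrightarrow> x \<in> dclosure a"
  unfolding dclosure_def by (auto simp: dspan_l2 l2_zero intro!: bexI [of _ x])

lemma dclosure_limit:
  assumes "l2 a" "l2 x" "\<And>\<epsilon>. \<epsilon> > 0 \<Longrightarrow> \<exists>y\<in>dclosure a. l2norm (\<lambda>n. x n - y n) < \<epsilon>"
  shows "x \<in> dclosure a"
  unfolding dclosure_def
proof (intro CollectI conjI assms(2) allI impI)
  fix \<epsilon> :: real assume "\<epsilon> > 0"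
  then obtain y where y: "y \<in> dclosure a" "l2norm (\<lambda>n. x n - y n) < \<epsilon> / 2"
    using assms(3) [of "\<epsilon> / 2"] by auto
  then obtain z where z: "z \<in> dspan a" "l2norm (\<lambda>n. y n - z n) < \<epsilon> / 2"
    using dclosureE [of y a "\<epsilon> / 2"] \<open>\<epsilon> > 0\<close> by auto
  have l: "l2 y" "l2 z" using y z assms dclosure_l2 dspan_l2 by auto
  have "l2norm (\<lambda>n. (x n - y n) + (y n - z n)) \<le> l2norm (\<lambda>n. x n - y n) + l2norm (\<lambda>n. y n - z n)"
    by (intro l2_add l2_diff l assms)
  then show "\<exists>y\<in>dspan a. l2norm (\<lambda>n. x n - y n) < \<epsilon>" using y z by (intro bexI [of _ z]) auto
qed

lemma dclosure_scale:
  assumes "l2 a" "x \<in> dclosure a"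
  shows "(\<lambda>n. c * x n) \<in> dclosure a"
proof (rule dclosure_limit [OF assms(1)])
  have x: "l2 x" using assms dclosure_l2 by blast
  show "l2 (\<lambda>n. c * x n)" using x by (rule l2_scale)
  fix \<epsilon> :: real assume "\<epsilon> > 0"
  then have "\<epsilon> / (norm c + 1) > 0" by (simp add: add_nonneg_pos)
  then obtain y where y: "y \<in> dspan a" "l2norm (\<lambda>n. x n - y n) < \<epsilon> / (norm c + 1)"
    using assms(2) unfolding dclosure_def by auto
  have "l2norm (\<lambda>n. c * x n - c * y n) = norm c * l2norm (\<lambda>n. x n - y n)"
    using l2_scale(2) [OF l2_diff(1) [OF x dspan_l2 [OF assms(1) y(1)]], of c] by (simp add: algebra_simps)
  also have "\<dots> \<le> norm c * (\<epsilon> / (norm c + 1))" using y by (intro mult_left_mono) auto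
  also have "\<dots> < \<epsilon>"
  proof -
    have "norm c + 1 > 0" by (simp add: add_nonneg_pos)
    then show ?thesis using \<open>\<epsilon> > 0\<close> by (simp add: pos_divide_less_eq algebra_simps)
  qed
  finally show "\<exists>y\<in>dclosure a. l2norm (\<lambda>n. c * x n - y n) < \<epsilon>"
    using y(1) by (intro bexI [of _ "\<lambda>n. c * y n"]) (auto intro!: dspan_subset_dclosure assms dspan_scale)
qed

lemma dclosure_add:
  assumes "l2 a" "x \<in> dclosure a" "y \<in> dclosure a"
  shows "(\<lambda>n. x n + y n) \<in> dclosure a"
proof (rule dclosure_limit [OF assms(1)])
  have l: "l2 x" "l2 y" using assms dclosure_l2 by auto
  show "l2 (\<lambda>n. x n + y n)" using l by (rule l2_add)
  fix \<epsilon> :: real assume "\<epsilon> > 0"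
  then have "\<epsilon> / 2 > 0" by simp
  then obtain u v where u: "u \<in> dspan a" "l2norm (\<lambda>n. x n - u n) < \<epsilon> / 2"
    and v: "v \<in> dspan a" "l2norm (\<lambda>n. y n - v n) < \<epsilon> / 2"
    using dclosureE assms(2,3) by metis
  have "l2norm (\<lambda>n. (x n - u n) + (y n - v n)) \<le> l2norm (\<lambda>n. x n - u n) + l2norm (\<lambda>n. y n - v n)"
    by (intro l2_add l2_diff l dspan_l2 [OF assms(1)] u v)
  then have "l2norm (\<lambda>n. x n + y n - (u n + v n)) < \<epsilon>" using u v by (simp add: algebra_simps)
  then show "\<exists>z\<in>dclosure a. l2norm (\<lambda>n. x n + y n - z n) < \<epsilon>"
    using u(1) v(1) by (intro bexI [of _ "\<lambda>n. u n + v n"]) (auto intro!: dspan_subset_dclosure assms dspan_add)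
qed

lemma dclosure_sum:
  assumes "l2 a" "finite A" "\<And>i. i \<in> A \<Longrightarrow> x i \<in> dclosure a"
  shows "(\<lambda>n. \<Sum>i\<in>A. x i n) \<in> dclosure a"
  using assms(2,3)
proof (induction A rule: finite_induct)
  case empty
  then show ?case using dspan_subset_dclosure [OF assms(1) dspan_sum [of "{}"]] by simp
qed (simp add: dclosure_add assms(1))

lemma dclosure_dil:
  assumes "l2 a" "x \<in> dclosure a" "m > 0"
  shows "dil m x \<in> dclosure a"
proof (rule dclosure_limit [OF assms(1)])
  have x: "l2 x" using assms dclosure_l2 by auto
  show "l2 (dil m x)" using x assms by (intro l2_dil)
  fix \<epsilon> :: real assume "\<epsilon> > 0"
  then obtain u where u: "u \<in> dspan a" "l2norm (\<lambda>n. x n - u n) < \<epsilon>"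
    using assms(2) unfolding dclosure_def by auto
  have "(\<lambda>n. dil m x n - dil m u n) = dil m (\<lambda>n. x n - u n)" by (auto simp: dil_def fun_eq_iff)
  then have "l2norm (\<lambda>n. dil m x n - dil m u n) < \<epsilon>"
    using l2_dil(2) [OF assms(3) l2_diff(1) [OF x dspan_l2 [OF assms(1) u(1)]]] u(2) by simp
  then show "\<exists>z\<in>dclosure a. l2norm (\<lambda>n. dil m x n - z n) < \<epsilon>"
    using u(1) assms by (intro bexI [of _ "dil m u"]) (auto intro!: dspan_subset_dclosure dspan_dil_closed)
qed

lemma dclosure_trans:
  assumes "l2 a" "p \<in> dclosure a"
  shows "dclosure p \<subseteq> dclosure a"
proof
  fix x assume x: "x \<in> dclosure p"
  show "x \<in> dclosure a"
  proof (rule dclosure_limit [OF assms(1) dclosure_l2 [OF x]])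
    fix \<epsilon> :: real assume "\<epsilon> > 0"
    then obtain y where y: "y \<in> dspan p" "l2norm (\<lambda>n. x n - y n) < \<epsilon>" using x unfolding dclosure_def by auto
    obtain K c where yc: "y = (\<lambda>n. \<Sum>k=1..K. c k * dil k p n)" using y by (auto simp: dspan_def)
    have "y \<in> dclosure a" unfolding yc
      using assms by (intro dclosure_sum dclosure_scale dclosure_dil) auto
    then show "\<exists>y\<in>dclosure a. l2norm (\<lambda>n. x n - y n) < \<epsilon>" using y by blast
  qed
qed

text \<open>Truncations of \<open>x\<close> are combinations of dilates of \<open>unit_seq\<close>.
  The value at 0 must vanish since no such dilate is supported there.\<close>

lemma dclosure_everything:
  assumes "l2 a" "cyclic_seq a" "l2 x" "x 0 = 0"
  shows "x \<in> dclosure a"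
proof (rule dclosure_limit [OF assms(1,3)])
  fix \<epsilon> :: real assume "\<epsilon> > 0"
  have "summable (\<lambda>n. (norm (x n))\<^sup>2)" using assms by (simp add: l2_def)
  then obtain N where N: "norm (\<Sum>i. (norm (x (i + N)))\<^sup>2) < \<epsilon>\<^sup>2"
    using suminf_exist_split [of "\<epsilon>\<^sup>2" "\<lambda>n. (norm (x n))\<^sup>2"] \<open>\<epsilon> > 0\<close> by auto
  define y where "y = (\<lambda>n. \<Sum>k\<in>{1..<N}. x k * dil k unit_seq n)"
  have dk: "dil k unit_seq n = (if n = k then 1 else 0)" if "k > 0" for k n
    using that by (auto simp: dil_def unit_seq_def elim!: dvdE)
  have y: "y n = (if n < N then x n else 0)" for n
    using assms(4) by (cases "n = 0") (auto simp: y_def dk mult_delta_right)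
  have "y \<in> dclosure a" unfolding y_def
    using assms by (intro dclosure_sum dclosure_scale dclosure_dil) (auto simp: cyclic_seq_def)
  moreover have "l2norm (\<lambda>n. x n - y n) < \<epsilon>"
  proof -
    have l: "summable (\<lambda>n. (norm (x n - y n))\<^sup>2)"
      using l2_diff(1) [OF assms(3) dclosure_l2 [OF \<open>y \<in> dclosure a\<close>]] by (simp add: l2_def)
    have "(\<Sum>n. (norm (x n - y n))\<^sup>2) = (\<Sum>i. (norm (x (i + N) - y (i + N)))\<^sup>2) + (\<Sum>i<N. (norm (x i - y i))\<^sup>2)"
      by (rule suminf_split_initial_segment [OF l])
    also have "\<dots> = (\<Sum>i. (norm (x (i + N)))\<^sup>2)" by (simp add: y)
    also have "\<dots> < \<epsilon>\<^sup>2" using N by simp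
    finally show ?thesis unfolding l2norm_def using \<open>\<epsilon> > 0\<close> by (simp add: real_sqrt_less_iff real_less_lsqrt)
  qed
  ultimately show "\<exists>y\<in>dclosure a. l2norm (\<lambda>n. x n - y n) < \<epsilon>" by blast
qed

lemma cyclic_seq_scale:
  assumes "l2 a" "c \<noteq> 0"
  shows "cyclic_seq (\<lambda>n. c * a n) \<longleftrightarrow> cyclic_seq a"
proof -
  have imp: "cyclic_seq a" if "cyclic_seq (\<lambda>n. c * a n)" "l2 a" for a c
  proof -
    have "(\<lambda>n. c * a n) \<in> dclosure a"
      using that dspan_dil [of 1 a] by (intro dclosure_scale dspan_subset_dclosure) auto
    then show ?thesis using dclosure_trans [of a] that unfolding cyclic_seq_def by auto
  qed
  show ?thesis
  proof
    assume "cyclic_seq a"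
    then have "cyclic_seq (\<lambda>n. inverse c * (c * a n))" using assms by (simp flip: mult.assoc)
    then show "cyclic_seq (\<lambda>n. c * a n)" using imp [of "inverse c" "\<lambda>n. c * a n"] assms l2_scale by blast
  qed (use imp assms in blast)
qed

text \<open>The pairing carries no conjugate, so completely multiplicative sequences enter it as
  they are and are eigenvectors without a twist.\<close>

lemma l2_inner:
  assumes "l2 x" "l2 y"
  shows "summable (\<lambda>n. x n * y n)" "norm (\<Sum>n. x n * y n) \<le> l2norm x * l2norm y"
proof -
  have "(\<Sum>n<m. norm (x n * y n)) \<le> l2norm x * l2norm y" for m
  proof -
    have "(\<Sum>n<m. \<bar>norm (x n)\<bar> * \<bar>norm (y n)\<bar>) \<le> L2_set (\<lambda>n. norm (x n)) {..<m} * L2_set (\<lambda>n. norm (y n)) {..<m}"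
      by (rule L2_set_mult_ineq)
    also have "\<dots> \<le> l2norm x * l2norm y"
      using assms by (intro mult_mono L2_set_le_l2norm order_trans [OF L2_set_nonneg L2_set_le_l2norm]) auto
    finally show ?thesis by (simp add: norm_mult)
  qed
  note * = this
  have s: "summable (\<lambda>n. norm (x n * y n))"
    by (rule bounded_imp_summable [where B = "l2norm x * l2norm y"]) (use * [of "Suc _"] in \<open>auto simp: lessThan_Suc_atMost\<close>)
  then show "summable (\<lambda>n. x n * y n)" by (rule summable_norm_cancel)
  have "norm (\<Sum>n. x n * y n) \<le> (\<Sum>n. norm (x n * y n))" using s by (rule summable_norm)
  also have "\<dots> \<le> l2norm x * l2norm y" using s * by (rule suminf_le_const)
  finally show "norm (\<Sum>n. x n * y n) \<le> l2norm x * l2norm y" .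
qed

text \<open>Completely multiplicative sequences in \<open>\<ell>\<^sup>2\<close> are joint eigenvectors of the adjoints of the
  dilations, so a cyclic sequence cannot be orthogonal to one of them.\<close>

lemma cyclic_seq_evaluation:
  assumes a: "l2 a" "cyclic_seq a"
    and lam: "l2 lam" "lam 1 = 1" "\<And>m n. lam (m * n) = lam m * lam n"
  shows "(\<Sum>n. a n * lam n) \<noteq> 0"
proof
  assume zero: "(\<Sum>n. a n * lam n) = 0"
  have d: "(\<Sum>n. dil k a n * lam n) = 0" if "k > 0" for k
  proof -
    have "(\<Sum>n. dil k a n * lam n) = (\<Sum>n. dil k a (k * n) * lam (k * n))"
      using that by (intro dil_reindex) (auto simp: dil_def)
    also have "\<dots> = (\<Sum>n. lam k * (a n * lam n))" by (simp only: dil_times [OF that] lam(3)) (simp add: mult_ac)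
    also have "\<dots> = 0" using zero l2_inner(1) [OF a(1) lam(1)] by (simp add: suminf_mult)
    finally show ?thesis .
  qed
  define L where "L = l2norm lam + 1"
  have "l2norm lam \<ge> 0"
    using order_trans [OF L2_set_nonneg L2_set_le_l2norm [OF lam(1), of "{}"]] by simp
  then have L: "L > 0" by (simp add: L_def)
  obtain y where y: "y \<in> dspan a" "l2norm (\<lambda>n. unit_seq n - y n) < 1 / L"
    using dclosureE [of unit_seq a "1 / L"] a(2) L unfolding cyclic_seq_def by auto
  obtain K c where yc: "y = (\<lambda>n. \<Sum>k=1..K. c k * dil k a n)" using y by (auto simp: dspan_def)
  have ly: "l2 y" using dspan_l2 a y by blast
  have sy: "(\<Sum>n. y n * lam n) = 0"
  proof -
    have s: "summable (\<lambda>n. c k * (dil k a n * lam n))" if "k \<in> {1..K}" for k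
      using that by (intro summable_mult l2_inner l2_dil a lam) auto
    have "(\<Sum>n. y n * lam n) = (\<Sum>n. \<Sum>k=1..K. c k * (dil k a n * lam n))"
      by (simp add: yc sum_distrib_right mult.assoc)
    also have "\<dots> = (\<Sum>k=1..K. \<Sum>n. c k * (dil k a n * lam n))" using s by (rule suminf_sum)
    also have "\<dots> = (\<Sum>k=1..K. c k * (\<Sum>n. dil k a n * lam n))"
      by (intro sum.cong refl suminf_mult l2_inner l2_dil a lam) auto
    also have "\<dots> = 0" using d by simp
    finally show ?thesis .
  qed
  have "(\<Sum>n. (unit_seq n - y n) * lam n) = (\<Sum>n. unit_seq n * lam n) - (\<Sum>n. y n * lam n)"
    using l2_inner(1) [OF l2_unit_seq lam(1)] l2_inner(1) [OF ly lam(1)]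
    by (simp add: left_diff_distrib suminf_diff)
  also have "(\<Sum>n. unit_seq n * lam n) = (\<Sum>n\<in>{1}. unit_seq n * lam n)"
    by (rule suminf_finite) (auto simp: unit_seq_def)
  finally have "(\<Sum>n. (unit_seq n - y n) * lam n) = 1" by (simp add: sy unit_seq_def lam del: One_nat_def)
  then have "1 \<le> l2norm (\<lambda>n. unit_seq n - y n) * l2norm lam"
    using l2_inner(2) [OF l2_diff(1) [OF l2_unit_seq ly] lam(1)] by simp
  also have "\<dots> \<le> 1 / L * l2norm lam" using y \<open>l2norm lam \<ge> 0\<close> by (intro mult_right_mono) auto
  also have "\<dots> < 1" using L by (simp add: L_def field_simps)
  finally show False by simp
qed

text \<open>Convolution with \<open>l\<close> is inverted by convolution with
  \<open>moebius_mu\<close> times \<open>l\<close>. Truncating this inverse to the divisors of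
  \<open>Y\<close> uses finitely many dilates and leaves \<open>lY Y\<close>, the restriction of
  \<open>l\<close> to numbers coprime to \<open>Y\<close>. For \<open>Y = fact y\<close> the only
  such number below \<open>y\<close>, if \<open>y\<close> exceeds 1, is 1, so \<open>lY Y\<close>
  tends to \<open>unit_seq\<close> in norm and the closure contains \<open>p\<close>.\<close>

lemma cyclic_seq_mult_completely_multiplicative:
  assumes p: "\<And>n. n \<notin> {1..N} \<Longrightarrow> p n = 0" "cyclic_seq p"
    and l: "l 1 = 1" "\<And>m n. l (m * n) = l m * l n" "\<And>n. norm (l n) \<le> 1 / real n"
  defines "a \<equiv> \<lambda>n. \<Sum>e=1..N. p e * dil e l n"
  shows "l2 a" "cyclic_seq a"
proof -
  have l0: "l 0 = 0" using l(3) [of 0] by simp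
  have sq: "summable (\<lambda>n. 1 / (real n)\<^sup>2)" using inverse_power_summable [of 2] by (simp add: inverse_eq_divide)
  have lsq: "(norm (l n))\<^sup>2 \<le> 1 / (real n)\<^sup>2" for n
    using power_mono [OF l(3) norm_ge_zero, of n 2] by (simp add: power_divide)
  have l2l: "l2 l" unfolding l2_def
    by (rule summable_comparison_test' [OF sq, of 0]) (use lsq in auto)
  show l2a: "l2 a" unfolding a_def by (intro l2_sum l2_scale l2_dil l2l) auto
  define lY where "lY Y n = (if coprime n Y then l n else 0)" for Y n
  have lY: "(\<Sum>d | d dvd Y. moebius_mu d * l d * dil d l n) = lY Y n" if "Y > 0" for Y n
  proof (cases "n = 0")
    case True
    then show ?thesis by (simp add: dil_def l0 lY_def)
  next
    case False
    have "(\<Sum>d | d dvd Y. moebius_mu d * l d * dil d l n) = (\<Sum>d | d dvd Y. if d dvd n then moebius_mu d * l n else 0)"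
      using False by (intro sum.cong refl) (auto simp: dil_def mult.assoc simp flip: l(2))
    also have "\<dots> = (\<Sum>d | d \<in> {d. d dvd Y} \<and> d dvd n. moebius_mu d * l n)"
      using \<open>Y > 0\<close> by (intro sum.inter_filter [symmetric]) auto
    also have "{d. d \<in> {d. d dvd Y} \<and> d dvd n} = {d. d dvd gcd n Y}" by auto
    also have "(\<Sum>d | d dvd gcd n Y. moebius_mu d * l n) = (if gcd n Y = 1 then l n else 0)"
      using \<open>Y > 0\<close> by (subst sum_distrib_right [symmetric], subst sum_moebius_mu) auto
    finally show ?thesis by (simp add: lY_def coprime_iff_gcd_eq_1)
  qed
  have span: "(\<lambda>n. \<Sum>e=1..N. p e * dil e (lY Y) n) \<in> dspan a" if "Y > 0" for Y
  proof -
    have pos: "d > 0" if "d dvd Y" for d using that \<open>Y > 0\<close> by (auto intro: Nat.gr0I)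
    have "(\<lambda>n. \<Sum>d | d dvd Y. (moebius_mu d * l d) * dil d a n) \<in> dspan a"
      using \<open>Y > 0\<close> pos by (intro dspan_sum dspan_scale dspan_dil) auto
    also have "(\<lambda>n. \<Sum>d | d dvd Y. (moebius_mu d * l d) * dil d a n) =
        (\<lambda>n. \<Sum>d | d dvd Y. \<Sum>e=1..N. p e * ((moebius_mu d * l d) * dil e (dil d l) n))"
      using pos unfolding a_def dil_sum_scale
      by (intro ext sum.cong refl) (auto simp: sum_distrib_left dil_dil mult_ac intro!: sum.cong)
    also have "\<dots> = (\<lambda>n. \<Sum>e=1..N. \<Sum>d | d dvd Y. p e * ((moebius_mu d * l d) * dil e (dil d l) n))"
      by (intro ext sum.swap)
    also have "\<dots> = (\<lambda>n. \<Sum>e=1..N. p e * dil e (lY Y) n)"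
    proof (intro ext sum.cong refl)
      fix n e
      have "(\<lambda>n. \<Sum>d | d dvd Y. (moebius_mu d * l d) * dil d l n) = lY Y" using lY [OF that] by auto
      then have "dil e (lY Y) = (\<lambda>n. \<Sum>d | d dvd Y. (moebius_mu d * l d) * dil e (dil d l) n)"
        using dil_sum_scale [of e "\<lambda>d. moebius_mu d * l d" "\<lambda>d. dil d l" "{d. d dvd Y}"] by simp
      then show "(\<Sum>d | d dvd Y. p e * ((moebius_mu d * l d) * dil e (dil d l) n)) = p e * dil e (lY Y) n"
        by (simp add: sum_distrib_left)
    qed
    finally show ?thesis .
  qed
  have l2p: "l2 p" using l2_finite_support(1) [of "{1..N}" p] p by auto
  have pe: "p = (\<lambda>n. \<Sum>e=1..N. p e * dil e unit_seq n)"
  proof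
    fix n
    have "(\<Sum>e=1..N. p e * dil e unit_seq n) = (\<Sum>e=1..N. if e = n then p n else 0)"
      by (intro sum.cong refl) (auto simp: dil_def unit_seq_def elim!: dvdE)
    then show "p n = (\<Sum>e=1..N. p e * dil e unit_seq n)" using p(1) [of n] by auto
  qed
  define C where "C = (\<Sum>e=1..N. norm (p e))"
  have C: "C \<ge> 0" unfolding C_def by (intro sum_nonneg) auto
  have "p \<in> dclosure a"
  proof (rule dclosure_limit [OF l2a l2p])
    fix \<epsilon> :: real assume "\<epsilon> > 0"
    define \<eta> where "\<eta> = \<epsilon> / (C + 1)"
    have \<eta>: "\<eta> > 0" using \<open>\<epsilon> > 0\<close> C by (simp add: \<eta>_def)
    obtain y where y: "norm (\<Sum>i. 1 / (real (i + y))\<^sup>2) < \<eta>\<^sup>2"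
      using suminf_exist_split [OF _ sq, of "\<eta>\<^sup>2"] \<eta> by auto
    define u where "u n = unit_seq n - lY (fact y) n" for n
    have u0: "u n = 0" if "n < y" for n
    proof (cases "n \<le> 1")
      case True
      then have "n = 0 \<or> n = 1" by auto
      then show ?thesis using l0 l(1) by (auto simp: u_def unit_seq_def lY_def)
    next
      case False
      then have "n dvd fact y" using that by (intro dvd_fact) auto
      then have "\<not> coprime n (fact y)" using False by (metis coprime_absorb_left le_numeral_extra(4) nat_dvd_1_iff_1)
      then show ?thesis using False by (simp add: u_def unit_seq_def lY_def)
    qed
    have un: "(norm (u n))\<^sup>2 \<le> 1 / (real n)\<^sup>2" for n
    proof (cases "n = 1")
      case True then show ?thesis using l(1) by (simp add: u_def unit_seq_def lY_def)
    next
      case False then show ?thesis using lsq [of n] by (simp add: u_def unit_seq_def lY_def)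
    qed
    have l2u: "l2 u" unfolding l2_def
      by (rule summable_comparison_test' [OF sq, of 0]) (use un in auto)
    have "(\<Sum>n. (norm (u n))\<^sup>2) = (\<Sum>i. (norm (u (i + y)))\<^sup>2) + (\<Sum>i<y. (norm (u i))\<^sup>2)"
      using l2u unfolding l2_def by (rule suminf_split_initial_segment)
    also have "\<dots> = (\<Sum>i. (norm (u (i + y)))\<^sup>2)" by (simp add: u0)
    also have "\<dots> \<le> (\<Sum>i. 1 / (real (i + y))\<^sup>2)"
      using l2u sq un unfolding l2_def by (intro suminf_le) (auto simp del: of_nat_add simp: summable_iff_shift [of "\<lambda>n. 1 / (real n)\<^sup>2"] summable_iff_shift [of "\<lambda>n. (norm (u n))\<^sup>2"])
    also have "\<dots> < \<eta>\<^sup>2" using y by (simp add: abs_less_iff del: of_nat_add)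
    finally have nu: "l2norm u < \<eta>" unfolding l2norm_def using \<eta> by (simp add: real_less_lsqrt)
    have "(\<lambda>n. p n - (\<Sum>e=1..N. p e * dil e (lY (fact y)) n)) = (\<lambda>n. \<Sum>e=1..N. p e * dil e u n)"
      by (subst pe) (auto simp: fun_eq_iff u_def dil_def sum_subtractf [symmetric] right_diff_distrib intro!: sum.cong)
    then have "l2norm (\<lambda>n. p n - (\<Sum>e=1..N. p e * dil e (lY (fact y)) n)) = l2norm (\<lambda>n. \<Sum>e=1..N. p e * dil e u n)" by simp
    also have "\<dots> \<le> (\<Sum>e=1..N. l2norm (\<lambda>n. p e * dil e u n))"
      by (intro l2_sum l2_scale l2_dil l2u) auto
    also have "\<dots> = (\<Sum>e=1..N. norm (p e) * l2norm u)"
      by (intro sum.cong refl) (auto simp: l2_scale l2_dil l2u)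
    also have "\<dots> = C * l2norm u" by (simp add: C_def sum_distrib_right)
    also have "\<dots> \<le> C * \<eta>" using nu C by (intro mult_left_mono) auto
    also have "\<dots> < \<epsilon>" using \<open>\<epsilon> > 0\<close> C by (simp add: \<eta>_def field_simps)
    finally show "\<exists>y\<in>dclosure a. l2norm (\<lambda>n. p n - y n) < \<epsilon>"
      using dspan_subset_dclosure [OF l2a span [of "fact y"]] by auto
  qed
  then show "cyclic_seq a" using dclosure_trans [OF l2a] p(2) unfolding cyclic_seq_def by blast
qed

subsection \<open>Dirichlet polynomials\<close>

text \<open>Written with \<open>exp\<close> rather than \<open>powr\<close> so that holomorphy and
  shifts of \<open>s\<close> reduce to the rules for \<open>exp\<close>.\<close>

definition dir_poly :: "(nat \<Rightarrow> complex) \<Rightarrow> nat \<Rightarrow> complex \<Rightarrow> complex" where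
  "dir_poly c N s = (\<Sum>n=1..N. c n * exp (- s * of_real (ln (real n))))"

lemma dir_poly_holomorphic [holomorphic_intros]:
  "f holomorphic_on A \<Longrightarrow> (\<lambda>s. dir_poly c N (f s)) holomorphic_on A"
  unfolding dir_poly_def by (intro holomorphic_intros)

lemma dir_poly_add: "dir_poly c N (s + \<delta>) = dir_poly (\<lambda>n. c n * exp (- \<delta> * of_real (ln (real n)))) N s"
  unfolding dir_poly_def mult.assoc exp_add [symmetric] by (simp add: algebra_simps)

lemma norm_dir_poly_term:
  "norm (c * exp (- s * of_real (ln (real n)))) = norm c * exp (- Re s * ln (real n))"
  by (simp add: norm_mult)

lemma norm_dir_poly_le:
  assumes "Re s \<ge> 0"
  shows "norm (dir_poly c N s) \<le> (\<Sum>n=1..N. norm (c n))"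
  unfolding dir_poly_def
proof (rule sum_norm_le)
  fix n assume "n \<in> {1..N}"
  then have "exp (- Re s * ln (real n)) \<le> 1" using assms by simp
  then show "norm (c n * exp (- s * of_real (ln (real n)))) \<le> norm (c n)"
    unfolding norm_dir_poly_term by (simp add: mult_left_le)
qed

lemma dir_poly_near_const:
  assumes "N \<ge> 1" "Re s \<ge> \<sigma>" "\<sigma> \<ge> 0"
  shows "norm (dir_poly c N s - c 1) \<le> (\<Sum>n=1..N. norm (c n)) * exp (- \<sigma> * ln 2)"
proof -
  have "dir_poly c N s - c 1 = (\<Sum>n=2..N. c n * exp (- s * of_real (ln (real n))))"
    unfolding dir_poly_def using assms(1) by (subst sum.atLeast_Suc_atMost) (auto simp: numeral_2_eq_2)
  also have "norm \<dots> \<le> (\<Sum>n=2..N. norm (c n) * exp (- \<sigma> * ln 2))"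
  proof (rule sum_norm_le)
    fix n assume n: "n \<in> {2..N}"
    have "\<sigma> * ln 2 \<le> Re s * ln (real n)"
      using n assms by (intro mult_mono) auto
    then show "norm (c n * exp (- s * of_real (ln (real n)))) \<le> norm (c n) * exp (- \<sigma> * ln 2)"
      unfolding norm_dir_poly_term by (intro mult_left_mono) auto
  qed
  also have "\<dots> \<le> (\<Sum>n=1..N. norm (c n) * exp (- \<sigma> * ln 2))"
    by (intro sum_mono2) auto
  finally show ?thesis by (simp add: sum_distrib_right)
qed

lemma dir_poly_far_right:
  assumes "N \<ge> 1" "\<epsilon> > 0"
  obtains \<sigma> where "\<sigma> > 0" "\<And>s. Re s \<ge> \<sigma> \<Longrightarrow> norm (dir_poly c N s - c 1) \<le> \<epsilon>"
proof -
  define B where "B = (\<Sum>n=1..N. norm (c n))"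
  obtain n where n: "B / \<epsilon> < 2 ^ n" using real_arch_pow [of 2] by auto
  define \<sigma> where "\<sigma> = real (Suc n)"
  have "exp (- \<sigma> * ln 2) \<le> exp (- (real n * ln 2))" by (simp add: \<sigma>_def algebra_simps)
  also have "\<dots> = 1 / 2 ^ n" by (simp add: exp_minus exp_of_nat_mult inverse_eq_divide)
  finally have "B * exp (- \<sigma> * ln 2) \<le> B * (1 / 2 ^ n)"
    by (intro mult_left_mono) (simp_all add: B_def sum_nonneg)
  also have "\<dots> < \<epsilon>" using n \<open>\<epsilon> > 0\<close> by (simp add: field_simps)
  finally have \<sigma>: "B * exp (- \<sigma> * ln 2) < \<epsilon>" "\<sigma> > 0" by (simp_all add: \<sigma>_def)
  have "norm (dir_poly c N s - c 1) \<le> \<epsilon>" if "Re s \<ge> \<sigma>" for s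
    using dir_poly_near_const [OF assms(1) that, of c] \<sigma> unfolding B_def by linarith
  then show thesis using that \<sigma> by blast
qed

section \<open>Mean values on a vertical line\<close>

lemma sum_norm_power_series_bounded:
  fixes w :: complex
  assumes "norm w = 1" "w \<noteq> 1"
  shows "norm (\<Sum>j<M. w ^ j) \<le> 2 / norm (1 - w)"
proof -
  have "(1 - w) * (\<Sum>j<M. w ^ j) = 1 - w ^ M" by (simp add: one_diff_power_eq)
  then have "norm (1 - w) * norm (\<Sum>j<M. w ^ j) = norm (1 - w ^ M)" by (metis norm_mult)
  also have "\<dots> \<le> 2" using norm_triangle_ineq4 [of 1 "w ^ M"] assms by (simp add: norm_power)
  finally show ?thesis using assms by (simp add: field_simps)
qed

text \<open>The mean value theorem for Dirichlet polynomials, averaging over an arithmetic progression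
  \<open>t = \<theta>j\<close> so fine that no two frequencies are identified.\<close>

lemma sum_norm_square_le_sup:
  assumes bound: "\<And>t::real. norm (dir_poly c N (\<i> * of_real t)) \<le> C"
  shows "(\<Sum>n=1..N. (norm (c n))\<^sup>2) \<le> C\<^sup>2"
proof -
  \<comment> \<open>With this spacing every phase difference \<open>\<theta> * (ln m - ln n)\<close>
    has absolute value below 1, hence below \<open>pi\<close>, so distinct \<open>n\<close> and
    \<open>m\<close> give \<open>w n m \<noteq> 1\<close>.\<close>
  define \<theta> where "\<theta> = 1 / (1 + ln (real (Suc N)))"
  have lnN: "ln (real (Suc N)) \<ge> 0" by simp
  then have \<theta>: "\<theta> > 0" unfolding \<theta>_def by (intro divide_pos_pos) linarith+
  define z where "z n = cis (- (\<theta> * ln (real n)))" for n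
  define w where "w n m = z n * cnj (z m)" for n m
  have wcis: "w n m = cis (\<theta> * (ln (real m) - ln (real n)))" for n m
    by (simp add: w_def z_def cis_mult cis_cnj algebra_simps)
  have w1: "w n n = 1" for n by (simp add: wcis)
  have wn: "norm (w n m) = 1" for n m by (simp add: wcis)
  have w_neq: "w n m \<noteq> 1" if "n \<in> {1..N}" "m \<in> {1..N}" "n \<noteq> m" for n m
  proof
    assume "w n m = 1"
    define x where "x = \<theta> * (ln (real m) - ln (real n))"
    have "sin x = 0" using \<open>w n m = 1\<close> by (metis cis.simps(2) one_complex.simps(2) wcis x_def)
    have ln: "0 \<le> ln (real k) \<and> ln (real k) \<le> ln (real (Suc N))" if "k \<in> {1..N}" for k
      using that by auto
    have "\<bar>ln (real m) - ln (real n)\<bar> \<le> ln (real (Suc N))" using ln [OF that(1)] ln [OF that(2)] by linarith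
    then have "\<bar>x\<bar> \<le> \<theta> * ln (real (Suc N))" using \<theta> by (simp add: x_def abs_mult)
    also have "\<dots> < 1" unfolding \<theta>_def using lnN by (simp only: times_divide_eq_left mult_1_left divide_less_eq_1) linarith
    finally have "\<bar>x\<bar> < pi" using pi_gt3 by linarith
    then have "- pi < x" "x < pi" by linarith+
    then have "x = 0" using \<open>sin x = 0\<close> by (rule sin_eq_0_pi)
    then have "ln (real m) = ln (real n)" using \<theta> by (simp add: x_def)
    then show False using that by auto
  qed
  define f where "f j = dir_poly c N (\<i> * of_real (\<theta> * real j))" for j
  have f: "f j = (\<Sum>n=1..N. c n * z n ^ j)" for j
    unfolding f_def dir_poly_def z_def
    by (intro sum.cong refl arg_cong2 [of _ _ _ _ "(*)"]) (simp add: cis_conv_exp mult_ac flip: exp_of_nat_mult)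
  have fC: "norm (f j) \<le> C" for j unfolding f_def by (rule bound)
  define S where "S = (\<Sum>n=1..N. (norm (c n))\<^sup>2)"
  \<comment> \<open>The off-diagonal terms are geometric sums, bounded independently of the number
    \<open>M\<close> of sample points. Letting \<open>M\<close> grow leaves only the
    diagonal.\<close>
  define K where "K = (\<Sum>n=1..N. \<Sum>m=1..N. norm (c n) * norm (c m) * (2 / norm (1 - w n m)))"
  have main: "real M * S \<le> real M * C\<^sup>2 + K" for M
  proof -
    have "(\<Sum>j<M. f j * cnj (f j)) = (\<Sum>j<M. \<Sum>n=1..N. \<Sum>m=1..N. c n * cnj (c m) * w n m ^ j)"
      by (simp add: f sum_product w_def power_mult_distrib algebra_simps)
    also have "\<dots> = (\<Sum>n=1..N. \<Sum>j<M. \<Sum>m=1..N. c n * cnj (c m) * w n m ^ j)" by (rule sum.swap)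
    also have "\<dots> = (\<Sum>n=1..N. \<Sum>m=1..N. \<Sum>j<M. c n * cnj (c m) * w n m ^ j)"
      by (intro sum.cong refl sum.swap)
    also have "\<dots> = (\<Sum>n=1..N. \<Sum>m=1..N. (if m = n then of_nat M * (c n * cnj (c n)) else 0) +
        (if m = n then 0 else c n * cnj (c m) * (\<Sum>j<M. w n m ^ j)))"
      by (intro sum.cong refl) (auto simp: w1 simp flip: sum_distrib_left)
    also have "\<dots> = of_nat M * (\<Sum>n=1..N. c n * cnj (c n)) +
        (\<Sum>n=1..N. \<Sum>m=1..N. if m = n then 0 else c n * cnj (c m) * (\<Sum>j<M. w n m ^ j))"
      by (simp add: sum.distrib sum_distrib_left)
    finally have eq: "of_nat M * (\<Sum>n=1..N. c n * cnj (c n)) = (\<Sum>j<M. f j * cnj (f j)) -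
        (\<Sum>n=1..N. \<Sum>m=1..N. if m = n then 0 else c n * cnj (c m) * (\<Sum>j<M. w n m ^ j))" by simp
    have "real M * S = norm (of_nat M * (\<Sum>n=1..N. c n * cnj (c n)))"
    proof -
      have "(\<Sum>n=1..N. c n * cnj (c n)) = of_real S"
        unfolding S_def of_real_sum by (intro sum.cong refl) (metis complex_norm_square of_real_power)
      moreover have "S \<ge> 0" unfolding S_def by (intro sum_nonneg) auto
      ultimately show ?thesis by (simp add: norm_mult)
    qed
    also have "\<dots> \<le> norm (\<Sum>j<M. f j * cnj (f j)) +
        norm (\<Sum>n=1..N. \<Sum>m=1..N. if m = n then 0 else c n * cnj (c m) * (\<Sum>j<M. w n m ^ j))"
      unfolding eq by (rule norm_triangle_ineq4)
    also have "norm (\<Sum>j<M. f j * cnj (f j)) \<le> (\<Sum>j<M. C\<^sup>2)"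
      by (rule sum_norm_le) (simp add: norm_mult power_mono fC flip: power2_eq_square)
    also have "norm (\<Sum>n=1..N. \<Sum>m=1..N. if m = n then 0 else c n * cnj (c m) * (\<Sum>j<M. w n m ^ j)) \<le> K"
      unfolding K_def
    proof (intro sum_norm_le)
      fix n m assume nm: "n \<in> {1..N}" "m \<in> {1..N}"
      show "norm (if m = n then 0 else c n * cnj (c m) * (\<Sum>j<M. w n m ^ j)) \<le>
          norm (c n) * norm (c m) * (2 / norm (1 - w n m))"
      proof (cases "m = n")
        case False
        then have "norm (\<Sum>j<M. w n m ^ j) \<le> 2 / norm (1 - w n m)"
          using nm w_neq by (intro sum_norm_power_series_bounded wn) auto
        then show ?thesis using False by (simp only: if_False norm_mult complex_mod_cnj) (intro mult_left_mono, auto)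
      qed simp
    qed
    finally show ?thesis by simp
  qed
  show ?thesis
  proof (rule ccontr)
    assume "\<not> ?thesis"
    then have d: "S - C\<^sup>2 > 0" by (simp add: S_def)
    then obtain M where "K < real M * (S - C\<^sup>2)" using reals_Archimedean3 by blast
    then show False using main [of M] by (simp add: algebra_simps)
  qed
qed

text \<open>Compactness of the vertical translates: a limit of translates is zero-free by Hurwitz.\<close>

lemma dir_poly_lower_bound:
  assumes "N \<ge> 1" "c 1 \<noteq> 0" and nz: "\<And>s. Re s > 0 \<Longrightarrow> dir_poly c N s \<noteq> 0" and "\<delta> > 0"
  obtains m where "m > 0" "\<And>s. Re s \<ge> \<delta> \<Longrightarrow> norm (dir_poly c N s) \<ge> m"
proof (rule ccontr)
  assume "\<not> thesis"
  then have "\<exists>s. Re s \<ge> \<delta> \<and> norm (dir_poly c N s) < 1 / real (Suc k)" for k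
    using that [of "1 / real (Suc k)"] by (force simp: not_le)
  then obtain S where S: "\<And>k. Re (S k) \<ge> \<delta>" "\<And>k. norm (dir_poly c N (S k)) < 1 / real (Suc k)"
    by metis
  define P where "P = dir_poly c N"
  define h where "h = norm (c 1) / 2"
  have "h > 0" using assms by (simp add: h_def)
  obtain \<sigma>0 where \<sigma>0: "\<sigma>0 > 0" "\<And>s. Re s \<ge> \<sigma>0 \<Longrightarrow> norm (P s - c 1) \<le> h"
    using dir_poly_far_right [OF \<open>N \<ge> 1\<close> \<open>h > 0\<close>, of c] unfolding P_def by metis
  have big: "norm (P s) \<ge> h" if "Re s \<ge> \<sigma>0" for s
    using \<sigma>0(2) [OF that] norm_triangle_ineq2 [of "c 1" "c 1 - P s"]
    by (simp add: h_def norm_minus_commute)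
  obtain k0 where k0: "1 / real (Suc k0) < h"
    using \<open>h > 0\<close> by (metis nat_approx_posE)
  have small: "Re (S (k + k0)) \<in> {\<delta>..\<sigma>0}" for k
  proof (rule ccontr)
    assume "\<not> ?thesis"
    then have "norm (P (S (k + k0))) \<ge> h" using S(1) [of "k + k0"] by (intro big) auto
    moreover have "1 / real (Suc (k + k0)) \<le> 1 / real (Suc k0)" by (simp add: frac_le)
    ultimately show False using S(2) [of "k + k0"] k0 unfolding P_def by linarith
  qed
  obtain x \<rho> where x: "x \<in> {\<delta>..\<sigma>0}" "strict_mono \<rho>" "((\<lambda>k. Re (S (k + k0))) \<circ> \<rho>) \<longlonglongrightarrow> x"
    using compact_imp_seq_compact [OF compact_Icc, THEN seq_compactE, of "\<lambda>k. Re (S (k + k0))" \<delta> \<sigma>0] small by metis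
  define y where "y k = Re (S (\<rho> k + k0))" for k
  have y: "y \<longlonglongrightarrow> x" using x(3) by (simp add: y_def [abs_def] comp_def)
  \<comment> \<open>The unbounded imaginary parts are moved into the function, so that the points
    where it is small lie in a compact real interval.\<close>
  define F where "F k s = P (s + \<i> * of_real (Im (S (\<rho> k + k0))))" for k s
  let ?H = "{s. Re s > 0}"
  define B where "B = (\<Sum>n=1..N. norm (c n))"
  obtain g r where g: "g holomorphic_on ?H" "strict_mono (r :: nat \<Rightarrow> nat)"
      "\<And>x. x \<in> ?H \<Longrightarrow> ((\<lambda>n. F (r n) x) \<longlonglongrightarrow> g x)"
      "\<And>K. \<lbrakk>compact K; K \<subseteq> ?H\<rbrakk> \<Longrightarrow> uniform_limit K (F \<circ> r) g sequentially"
  proof (rule Montel [of ?H "range F" F])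
    show "open ?H" by (rule open_halfspace_Re_gt)
    show "h holomorphic_on ?H" if "h \<in> range F" for h
      using that unfolding F_def P_def by (auto intro!: holomorphic_intros)
    show "\<exists>B. \<forall>h\<in>range F. \<forall>z\<in>K. norm (h z) \<le> B" if "K \<subseteq> ?H" for K
    proof -
      have "norm (F k z) \<le> B" if "z \<in> K" for k z
        using that \<open>K \<subseteq> ?H\<close> unfolding F_def P_def B_def by (intro norm_dir_poly_le) auto
      then show ?thesis by blast
    qed
  qed auto
  have yH: "of_real (y k) \<in> complex_of_real ` {\<delta>..\<sigma>0}" for k using small by (auto simp: y_def)
  have sub: "complex_of_real ` {\<delta>..\<sigma>0} \<subseteq> ?H" using \<open>\<delta> > 0\<close> by auto
  have comp: "compact (complex_of_real ` {\<delta>..\<sigma>0})"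
    by (intro compact_continuous_image continuous_intros) auto
  have xH: "complex_of_real x \<in> ?H" using x(1) \<open>\<delta> > 0\<close> by simp
  have "(\<lambda>k. g (of_real (y (r k)))) \<longlonglongrightarrow> g (of_real x)"
  proof -
    have "isCont g (of_real x)"
      using g(1) xH open_halfspace_Re_gt by (metis continuous_on_interior holomorphic_on_imp_continuous_on interior_open)
    moreover have "(\<lambda>k. complex_of_real (y (r k))) \<longlonglongrightarrow> of_real x"
      using LIMSEQ_subseq_LIMSEQ [OF y g(2)] by (intro tendsto_intros) (simp add: comp_def)
    ultimately show ?thesis by (rule isCont_tendsto_compose)
  qed
  moreover have "(\<lambda>k. g (of_real (y (r k)))) \<longlonglongrightarrow> 0"
  proof (rule LIMSEQ_I)
    fix e :: real assume "e > 0"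
    have "\<exists>n0. \<forall>n\<ge>n0. \<forall>x\<in>complex_of_real ` {\<delta>..\<sigma>0}. dist ((F \<circ> r) n x) (g x) < e / 2"
      using g(4) [OF comp sub] \<open>e > 0\<close> unfolding uniform_limit_sequentially_iff by (meson half_gt_zero)
    then obtain n0 where n0: "\<And>n x. n \<ge> n0 \<Longrightarrow> x \<in> complex_of_real ` {\<delta>..\<sigma>0} \<Longrightarrow> dist (F (r n) x) (g x) < e / 2"
      by auto
    obtain n1 where n1: "1 / real (Suc n1) < e / 2" using \<open>e > 0\<close> by (metis half_gt_zero nat_approx_posE)
    show "\<exists>no. \<forall>n\<ge>no. norm (g (of_real (y (r n))) - 0) < e"
    proof (intro exI allI impI)
      fix n assume n: "max n0 n1 \<le> n"
      have "F (r n) (of_real (y (r n))) = P (S (\<rho> (r n) + k0))"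
        by (simp add: F_def y_def complex_eq [symmetric])
      then have "norm (F (r n) (of_real (y (r n)))) < 1 / real (Suc (\<rho> (r n) + k0))"
        using S(2) unfolding P_def by metis
      also have "\<dots> \<le> 1 / real (Suc n1)"
      proof -
        have "n1 \<le> \<rho> (r n) + k0"
          using n seq_suble [OF g(2), of n] seq_suble [OF x(2), of "r n"] by linarith
        then show ?thesis by (simp add: frac_le)
      qed
      also have "\<dots> < e / 2" by (rule n1)
      finally have "norm (F (r n) (of_real (y (r n)))) < e / 2" .
      moreover have "dist (F (r n) (of_real (y (r n)))) (g (of_real (y (r n)))) < e / 2"
        using n by (intro n0 yH) auto
      ultimately show "norm (g (of_real (y (r n))) - 0) < e"
        using norm_triangle_ineq3 [of "g (of_real (y (r n)))" "F (r n) (of_real (y (r n)))"]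
        by (simp add: dist_norm norm_minus_commute)
    qed
  qed
  ultimately have gx: "g (of_real x) = 0" by (rule LIMSEQ_unique)
  \<comment> \<open>At \<open>\<sigma>0\<close> all translates stay away from 0. Together with the
    zero at \<open>x\<close> this makes the limit nonconstant, as Hurwitz's theorem
    requires.\<close>
  have g\<sigma>: "g (of_real \<sigma>0) \<noteq> 0"
  proof -
    have "(\<lambda>n. norm (F (r n) (of_real \<sigma>0))) \<longlonglongrightarrow> norm (g (of_real \<sigma>0))"
      using \<sigma>0 by (intro tendsto_norm g(3)) auto
    moreover have "norm (F k (of_real \<sigma>0)) \<ge> h" for k
      unfolding F_def by (intro big) auto
    ultimately have "norm (g (of_real \<sigma>0)) \<ge> h" by (intro LIMSEQ_le_const) auto
    then show ?thesis using \<open>h > 0\<close> by auto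
  qed
  have "g (of_real x) \<noteq> 0"
  proof (rule Hurwitz_no_zeros [of ?H "F \<circ> r" g])
    show "\<not> g constant_on ?H"
    proof
      assume "g constant_on ?H"
      then have "g (of_real x) = g (of_real \<sigma>0)" using xH \<sigma>0 by (auto simp: constant_on_def)
      then show False using gx g\<sigma> by simp
    qed
    show "(F \<circ> r) n holomorphic_on ?H" for n
      unfolding F_def P_def comp_def by (intro holomorphic_intros)
    show "(F \<circ> r) n z \<noteq> 0" if "z \<in> ?H" for n z
      using that nz unfolding F_def P_def comp_def by simp
  qed (use xH g open_halfspace_Re_gt connected_halfspace_Re_gt in auto)
  then show False using gx by simp
qed

text \<open>A bounded function need not attain its supremum on a half plane. Dividing
  \<open>f s ^ n\<close> by \<open>1 + s\<close> makes it at most 1 on large arcs, so the maximum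
  principle yields \<open>norm (f s) ^ n \<le> norm (1 + s)\<close>; for large \<open>n\<close> this
  excludes values above 1.\<close>

lemma halfplane_maximum_modulus:
  assumes hol: "f holomorphic_on {s. Re s > 0}" and cont: "continuous_on {s. Re s \<ge> 0} f"
    and bounded: "\<And>s. Re s \<ge> 0 \<Longrightarrow> norm (f s) \<le> B"
    and bdry: "\<And>s. Re s = 0 \<Longrightarrow> norm (f s) \<le> 1"
    and "Re s \<ge> 0"
  shows "norm (f s) \<le> 1"
proof (cases "Re s = 0")
  case False
  then have s: "Re s > 0" using \<open>Re s \<ge> 0\<close> by simp
  have B0: "B \<ge> 0" using order_trans [OF norm_ge_zero bounded, of 0] by simp
  have pow: "norm (f s) ^ n \<le> norm (1 + s)" for n
  proof -
    \<comment> \<open>The radius exceeds \<open>norm s\<close>, and on the arc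
      \<open>norm (1 + z) \<ge> R - 1\<close>, which is at least \<open>B ^ n\<close>.\<close>
    define R where "R = norm s + 2 + B ^ n"
    have Bn: "B ^ n \<ge> 0" using B0 by simp
    define h where "h = (\<lambda>s. f s ^ n / (1 + s))"
    define S where "S = {s. Re s > 0} \<inter> ball 0 R"
    have ne: "1 + z \<noteq> 0" if "Re z \<ge> 0" for z
    proof
      assume "1 + z = 0"
      then have "Re (1 + z) = 0" by simp
      then show False using that by simp
    qed
    have clS: "closure S \<subseteq> {s. Re s \<ge> 0} \<inter> cball 0 R"
      unfolding S_def by (rule closure_minimal) (auto intro!: closed_Int closed_halfspace_Re_ge)
    have openS: "open S" unfolding S_def by (intro open_Int open_halfspace_Re_gt open_ball)
    have "norm (h s) \<le> 1"
    proof (rule maximum_modulus_frontier [of h S])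
      show "h holomorphic_on interior S"
        unfolding h_def interior_open [OF openS]
        by (intro holomorphic_intros holomorphic_on_subset [OF hol]) (auto simp: S_def intro!: ne)
      show "continuous_on (closure S) h"
        unfolding h_def using clS
        by (intro continuous_intros continuous_on_subset [OF cont]) (auto intro!: ne)
      show "bounded S" unfolding S_def by (metis bounded_Int bounded_ball)
      show "s \<in> S" using s Bn by (auto simp: S_def R_def)
      fix z assume z: "z \<in> frontier S"
      then have z0: "Re z \<ge> 0" "norm z \<le> R" using clS by (auto simp: frontier_def)
      have "z \<notin> S" using z openS by (simp add: frontier_def interior_open)
      then have cases: "Re z = 0 \<or> norm z = R" using z0 by (auto simp: S_def)
      have one: "norm (1 + z) \<ge> 1" using complex_Re_le_cmod [of "1 + z"] z0 by simp
      have "norm (f z) ^ n \<le> norm (1 + z)"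
      proof (cases "Re z = 0")
        case True
        have "norm (f z) ^ n \<le> 1" using bdry [OF True] by (simp add: power_le_one)
        then show ?thesis using one by simp
      next
        case False
        then have "norm z = R" using cases by simp
        have "norm (f z) ^ n \<le> B ^ n" using bounded z0 by (intro power_mono) auto
        also have "\<dots> \<le> norm z - 1" using \<open>norm z = R\<close> norm_ge_zero [of s] unfolding R_def by linarith
        also have "\<dots> \<le> norm (1 + z)" using norm_triangle_ineq4 [of "1 + z" 1] by simp
        finally show ?thesis .
      qed
      then show "norm (h z) \<le> 1" using one by (simp add: h_def norm_divide norm_power divide_le_eq_1)
    qed
    moreover have "norm (1 + s) > 0" using ne [of s] s by simp
    ultimately show ?thesis by (simp add: h_def norm_divide norm_power divide_le_eq_1)
  qed
  show ?thesis
  proof (rule ccontr)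
    assume "\<not> ?thesis"
    then obtain n where "norm (1 + s) < norm (f s) ^ n" by (metis not_le real_arch_pow)
    then show False using pow [of n] by simp
  qed
qed (use bdry in simp)

text \<open>Compare \<open>P\<close> with its reflection \<open>N\<^sup>-\<^sup>s\<close> times the conjugate of \<open>P(2\<delta> - conj s)\<close> in the line
  \<open>Re s = \<delta>\<close>: they have equal modulus there and the quotient is bounded to the right of it.\<close>

lemma dir_poly_quasi_monotone:
  assumes "N \<ge> 1" "c 1 \<noteq> 0" and nz: "\<And>s. Re s > 0 \<Longrightarrow> dir_poly c N s \<noteq> 0"
    and xy: "0 \<le> x" "x < y"
  shows "norm (dir_poly c N (Complex x t)) \<le> exp ((y - x) / 2 * ln (real N)) * norm (dir_poly c N (Complex y t))"
proof -
  \<comment> \<open>The midpoint of \<open>x\<close> and \<open>y\<close>, so that reflection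
    exchanges the two abscissas.\<close>
  define \<delta> where "\<delta> = (x + y) / 2"
  define \<sigma> where "\<sigma> = (y - x) / 2"
  have "\<delta> > 0" using xy by (simp add: \<delta>_def)
  obtain m where m: "m > 0" "\<And>s. Re s \<ge> \<delta> \<Longrightarrow> norm (dir_poly c N s) \<ge> m"
    using dir_poly_lower_bound [OF assms(1-3) \<open>\<delta> > 0\<close>] by metis
  define F where "F s = dir_poly c N (s + of_real \<delta>)" for s
  \<comment> \<open>In this form all frequencies \<open>ln N - ln n\<close> are nonnegative, which
    makes \<open>G\<close> visibly bounded on the right half plane. The next fact identifies it with
    the reflected polynomial.\<close>
  define G where "G s = (\<Sum>n=1..N. cnj (c n) * of_real (exp (- \<delta> * ln (real n))) * exp (- s * of_real (ln (real N) - ln (real n))))" for s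
  have G: "G s = exp (- s * of_real (ln (real N))) * cnj (dir_poly c N (of_real \<delta> - cnj s))" for s
    unfolding G_def dir_poly_def cnj_sum sum_distrib_left
  proof (intro sum.cong refl)
    fix n
    have "complex_of_real (exp (- \<delta> * ln (real n))) * exp (- s * of_real (ln (real N) - ln (real n))) =
        exp (- s * of_real (ln (real N))) * exp (- (of_real \<delta> - s) * of_real (ln (real n)))"
      unfolding exp_of_real [symmetric] exp_add [symmetric] by (simp add: algebra_simps)
    then show "cnj (c n) * of_real (exp (- \<delta> * ln (real n))) * exp (- s * of_real (ln (real N) - ln (real n))) =
        exp (- s * of_real (ln (real N))) * cnj (c n * exp (- (of_real \<delta> - cnj s) * of_real (ln (real n))))"
      by (simp add: exp_cnj mult_ac)
  qed
  have Fm: "norm (F s) \<ge> m" if "Re s \<ge> 0" for s using that unfolding F_def by (intro m(2)) simp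
  have F0: "F s \<noteq> 0" if "Re s \<ge> 0" for s using Fm [OF that] m(1) by auto
  define B where "B = (\<Sum>n=1..N. norm (c n))"
  have GB: "norm (G s) \<le> B" if "Re s \<ge> 0" for s
    unfolding G_def B_def
  proof (rule sum_norm_le)
    fix n assume n: "n \<in> {1..N}"
    have "exp (- \<delta> * ln (real n)) \<le> 1" using n \<open>\<delta> > 0\<close> by simp
    moreover have "exp (- Re s * (ln (real N) - ln (real n))) \<le> 1"
      using n that by (simp add: mult_left_mono)
    ultimately have "exp (- \<delta> * ln (real n)) * exp (- Re s * (ln (real N) - ln (real n))) \<le> 1 * 1"
      by (intro mult_mono) auto
    then have "norm (c n) * (exp (- \<delta> * ln (real n)) * exp (- Re s * (ln (real N) - ln (real n)))) \<le> norm (c n) * 1"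
      by (intro mult_left_mono) auto
    then show "norm (cnj (c n) * of_real (exp (- \<delta> * ln (real n))) * exp (- s * of_real (ln (real N) - ln (real n)))) \<le> norm (c n)"
      by (simp add: norm_mult mult.assoc)
  qed
  define s where "s = Complex \<sigma> t"
  have s: "Re s \<ge> 0" using xy by (simp add: s_def \<sigma>_def)
  have "norm (G s / F s) \<le> 1"
  proof (rule halfplane_maximum_modulus [where f = "\<lambda>s. G s / F s" and B = "B / m"])
    show "(\<lambda>s. G s / F s) holomorphic_on {s. Re s > 0}"
      unfolding G_def using F0 by (auto simp: F_def intro!: holomorphic_intros)
    show "continuous_on {s. Re s \<ge> 0} (\<lambda>s. G s / F s)"
      by (rule holomorphic_on_imp_continuous_on) (unfold G_def, use F0 in \<open>auto simp: F_def intro!: holomorphic_intros\<close>)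
    show "norm (G s / F s) \<le> B / m" if "Re s \<ge> 0" for s
      using GB [OF that] Fm [OF that] m(1) by (auto simp: norm_divide intro!: frac_le order_trans [OF norm_ge_zero])
    show "norm (G s / F s) \<le> 1" if "Re s = 0" for s
    proof -
      have eq: "of_real \<delta> - cnj s = s + of_real \<delta>" using that by (simp add: complex_eq_iff)
      have "norm (G s) = norm (F s)" unfolding G F_def eq norm_mult complex_mod_cnj using that by simp
      then show ?thesis by (simp add: norm_divide)
    qed
  qed (use s in simp)
  then have "norm (G s) \<le> norm (F s)" using F0 [OF s] by (simp add: norm_divide divide_le_eq_1)
  moreover have "of_real \<delta> - cnj s = Complex x t" "s + of_real \<delta> = Complex y t"
    by (simp_all add: s_def \<delta>_def \<sigma>_def complex_eq_iff field_simps)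
  ultimately have "exp (- \<sigma> * ln (real N)) * norm (dir_poly c N (Complex x t)) \<le> norm (dir_poly c N (Complex y t))"
    by (simp add: G F_def norm_mult s_def)
  then have "exp (\<sigma> * ln (real N)) * (exp (- \<sigma> * ln (real N)) * norm (dir_poly c N (Complex x t))) \<le>
      exp (\<sigma> * ln (real N)) * norm (dir_poly c N (Complex y t))"
    by (intro mult_left_mono) auto
  then show ?thesis by (simp add: exp_minus_inverse \<sigma>_def flip: mult.assoc exp_add)
qed

subsection \<open>Cyclicity of zero-free Dirichlet polynomials\<close>

text \<open>Membership in the closure of the Dirichlet polynomials for the supremum norm over the
  closed right half plane. In this Banach algebra an inverse of the shifted polynomial is
  sought.\<close>

definition dir_approx :: "(complex \<Rightarrow> complex) \<Rightarrow> bool" where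
  "dir_approx F \<longleftrightarrow> (\<forall>\<epsilon>>0. \<exists>M\<ge>1. \<exists>r. \<forall>s. Re s \<ge> 0 \<longrightarrow> norm (F s - dir_poly r M s) < \<epsilon>)"

lemma dir_poly_extend:
  assumes "N \<le> M" "\<And>n. n > N \<Longrightarrow> c n = 0"
  shows "dir_poly c M s = dir_poly c N s"
  unfolding dir_poly_def using assms by (intro sum.mono_neutral_right) auto

lemma dir_poly_cutoff: "dir_poly (\<lambda>n. if n \<in> {1..N} then c n else 0) N = dir_poly c N"
  by (auto simp: dir_poly_def fun_eq_iff intro!: sum.cong)

text \<open>Multiplication by \<open>exp (- s * ln k)\<close> acts on coefficients as
  \<open>dil k\<close>. Hence multiples of the polynomial of \<open>p\<close> have their
  coefficients in \<open>dspan p\<close>.\<close>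

lemma dir_poly_mult:
  assumes "\<And>n. n \<notin> {1..N} \<Longrightarrow> p n = 0"
  shows "dir_poly r K s * dir_poly p N s = dir_poly (\<lambda>n. \<Sum>k=1..K. r k * dil k p n) (K * N) s"
proof -
  define e where "e n = exp (- s * of_real (ln (real n)))" for n
  have e: "e (k * m) = e k * e m" if "k > 0" "m > 0" for k m
    using that unfolding e_def exp_add [symmetric] by (simp add: ln_mult algebra_simps)
  have inner: "(\<Sum>n=1..K * N. dil k p n * e n) = e k * (\<Sum>m=1..N. p m * e m)" if k: "k \<in> {1..K}" for k
  proof -
    have "(\<Sum>n=1..K * N. dil k p n * e n) = (\<Sum>n\<in>(\<lambda>m. k * m) ` {1..N}. dil k p n * e n)"
    proof (rule sum.mono_neutral_right)
      show "(\<lambda>m. k * m) ` {1..N} \<subseteq> {1..K * N}" using k by (auto simp: Suc_le_eq intro!: mult_le_mono)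
      show "\<forall>i\<in>{1..K * N} - (\<lambda>m. k * m) ` {1..N}. dil k p i * e i = 0"
      proof
        fix i assume i: "i \<in> {1..K * N} - (\<lambda>m. k * m) ` {1..N}"
        show "dil k p i * e i = 0"
        proof (cases "k dvd i")
          case True
          then obtain m where m: "i = k * m" by (elim dvdE)
          then have "m \<notin> {1..N}" using i by auto
          then show ?thesis using assms m k by (simp add: dil_def)
        qed (simp add: dil_def)
      qed
    qed simp
    also have "\<dots> = (\<Sum>m=1..N. dil k p (k * m) * e (k * m))"
      using k by (subst sum.reindex) (auto simp: inj_on_def)
    also have "\<dots> = (\<Sum>m=1..N. e k * (p m * e m))" using k by (intro sum.cong refl) (auto simp: e)
    finally show ?thesis by (simp add: sum_distrib_left)
  qed
  have "dir_poly (\<lambda>n. \<Sum>k=1..K. r k * dil k p n) (K * N) s = (\<Sum>n=1..K * N. \<Sum>k=1..K. r k * (dil k p n * e n))"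
    by (simp add: dir_poly_def e_def sum_distrib_right mult.assoc)
  also have "\<dots> = (\<Sum>k=1..K. \<Sum>n=1..K * N. r k * (dil k p n * e n))" by (rule sum.swap)
  also have "\<dots> = (\<Sum>k=1..K. r k * (e k * (\<Sum>m=1..N. p m * e m)))"
    by (intro sum.cong refl) (simp only: inner flip: sum_distrib_left)
  also have "\<dots> = dir_poly r K s * dir_poly p N s"
    by (simp add: dir_poly_def e_def sum_distrib_right mult.assoc)
  finally show ?thesis ..
qed

lemma dir_approx_dir_poly:
  assumes "N \<ge> 1"
  shows "dir_approx (dir_poly c N)"
  unfolding dir_approx_def using assms by (auto intro!: exI [of _ N] exI [of _ c])

lemma dir_approx_const: "dir_approx (\<lambda>s. c)"
proof -
  have "dir_poly (\<lambda>_. c) 1 = (\<lambda>s. c)" by (simp add: dir_poly_def fun_eq_iff)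
  then show ?thesis using dir_approx_dir_poly [of 1 "\<lambda>_. c"] by simp
qed

lemma dir_approx_bounded:
  assumes "dir_approx F"
  obtains B where "B > 0" "\<And>s. Re s \<ge> 0 \<Longrightarrow> norm (F s) \<le> B"
proof -
  obtain M r where M: "\<And>s. Re s \<ge> 0 \<Longrightarrow> norm (F s - dir_poly r M s) < 1"
    using assms unfolding dir_approx_def by (meson zero_less_one)
  have "norm (F s) \<le> 1 + (\<Sum>n=1..M. norm (r n))" if "Re s \<ge> 0" for s
    using M [OF that] norm_dir_poly_le [OF that, of r M] norm_triangle_ineq2 [of "F s" "dir_poly r M s"] by linarith
  moreover have "(\<Sum>n=1..M. norm (r n)) \<ge> 0" by (intro sum_nonneg) auto
  ultimately show thesis using that [of "1 + (\<Sum>n=1..M. norm (r n))"] by auto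
qed

lemma dir_approx_add:
  assumes "dir_approx F" "dir_approx G"
  shows "dir_approx (\<lambda>s. F s + G s)"
  unfolding dir_approx_def
proof (intro allI impI)
  fix \<epsilon> :: real assume "\<epsilon> > 0"
  then have h: "\<epsilon> / 2 > 0" by simp
  obtain M r where M: "M \<ge> 1" "\<And>s. Re s \<ge> 0 \<Longrightarrow> norm (F s - dir_poly r M s) < \<epsilon> / 2"
    using assms(1) h unfolding dir_approx_def by meson
  obtain L q where L: "L \<ge> 1" "\<And>s. Re s \<ge> 0 \<Longrightarrow> norm (G s - dir_poly q L s) < \<epsilon> / 2"
    using assms(2) h unfolding dir_approx_def by meson
  define r' where "r' n = (if n \<in> {1..M} then r n else 0)" for n
  define q' where "q' n = (if n \<in> {1..L} then q n else 0)" for n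
  have "dir_poly (\<lambda>n. r' n + q' n) (max M L) s = dir_poly r' (max M L) s + dir_poly q' (max M L) s" for s
    by (simp add: dir_poly_def distrib_right sum.distrib)
  also have "dir_poly r' (max M L) s + dir_poly q' (max M L) s = dir_poly r M s + dir_poly q L s" for s
  proof -
    have "dir_poly r' M = dir_poly r M" "dir_poly q' L = dir_poly q L"
      unfolding r'_def q'_def by (rule dir_poly_cutoff)+
    then show ?thesis
      using dir_poly_extend [of M "max M L" r'] dir_poly_extend [of L "max M L" q'] by (simp add: r'_def q'_def)
  qed
  finally have eq: "dir_poly (\<lambda>n. r' n + q' n) (max M L) s = dir_poly r M s + dir_poly q L s" for s .
  have "norm (F s + G s - dir_poly (\<lambda>n. r' n + q' n) (max M L) s) < \<epsilon>" if "Re s \<ge> 0" for s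
    using M(2) [OF that] L(2) [OF that] norm_triangle_ineq [of "F s - dir_poly r M s" "G s - dir_poly q L s"]
    unfolding eq by (simp add: algebra_simps)
  then show "\<exists>M\<ge>1. \<exists>r. \<forall>s. Re s \<ge> 0 \<longrightarrow> norm (F s + G s - dir_poly r M s) < \<epsilon>"
    using M(1) by (intro exI [of _ "max M L"] conjI exI [of _ "\<lambda>n. r' n + q' n"]) auto
qed

lemma dir_approx_mult:
  assumes "dir_approx F" "dir_approx G"
  shows "dir_approx (\<lambda>s. F s * G s)"
  unfolding dir_approx_def
proof (intro allI impI)
  fix \<epsilon> :: real assume "\<epsilon> > 0"
  obtain B where B: "B > 0" "\<And>s. Re s \<ge> 0 \<Longrightarrow> norm (G s) \<le> B" using dir_approx_bounded [OF assms(2)] by metis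
  have "\<epsilon> / (2 * B) > 0" using \<open>\<epsilon> > 0\<close> B by simp
  then obtain M r where M: "M \<ge> 1" "\<And>s. Re s \<ge> 0 \<Longrightarrow> norm (F s - dir_poly r M s) < \<epsilon> / (2 * B)"
    using assms(1) unfolding dir_approx_def by meson
  define C where "C = (\<Sum>n=1..M. norm (r n)) + 1"
  have C: "C > 0" unfolding C_def by (intro add_nonneg_pos sum_nonneg) auto
  have "\<epsilon> / (2 * C) > 0" using \<open>\<epsilon> > 0\<close> C by simp
  then obtain L q where L: "L \<ge> 1" "\<And>s. Re s \<ge> 0 \<Longrightarrow> norm (G s - dir_poly q L s) < \<epsilon> / (2 * C)"
    using assms(2) unfolding dir_approx_def by meson
  define q' where "q' n = (if n \<in> {1..L} then q n else 0)" for n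
  have q': "dir_poly q' L = dir_poly q L" unfolding q'_def by (rule dir_poly_cutoff)
  have eq: "dir_poly (\<lambda>n. \<Sum>k=1..M. r k * dil k q' n) (M * L) s = dir_poly r M s * dir_poly q L s" for s
    unfolding q' [symmetric] by (rule dir_poly_mult [symmetric]) (auto simp: q'_def)
  have "norm (F s * G s - dir_poly r M s * dir_poly q L s) < \<epsilon>" if s: "Re s \<ge> 0" for s
  proof -
    have "F s * G s - dir_poly r M s * dir_poly q L s =
        (F s - dir_poly r M s) * G s + dir_poly r M s * (G s - dir_poly q L s)" by (simp add: algebra_simps)
    also have "norm \<dots> \<le> norm (F s - dir_poly r M s) * norm (G s) + norm (dir_poly r M s) * norm (G s - dir_poly q L s)"
      using norm_triangle_ineq [of "(F s - dir_poly r M s) * G s" "dir_poly r M s * (G s - dir_poly q L s)"]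
      unfolding norm_mult .
    also have "norm (F s - dir_poly r M s) * norm (G s) \<le> \<epsilon> / (2 * B) * B"
      using M(2) [OF s] B(2) [OF s] B(1) \<open>\<epsilon> > 0\<close> by (intro mult_mono) auto
    also have "norm (dir_poly r M s) * norm (G s - dir_poly q L s) < C * (\<epsilon> / (2 * C))"
    proof -
      have "norm (dir_poly r M s) < C" using norm_dir_poly_le [OF s, of r M] unfolding C_def by linarith
      then show ?thesis using L(2) [OF s] C by (intro mult_strict_mono') auto
    qed
    finally show ?thesis using B C by simp
  qed
  then have "\<forall>s. Re s \<ge> 0 \<longrightarrow> norm (F s * G s - dir_poly (\<lambda>n. \<Sum>k=1..M. r k * dil k q' n) (M * L) s) < \<epsilon>"
    unfolding eq by blast
  moreover have "M * L \<ge> 1" using M(1) L(1) by (simp add: Suc_le_eq)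
  ultimately show "\<exists>M\<ge>1. \<exists>r. \<forall>s. Re s \<ge> 0 \<longrightarrow> norm (F s * G s - dir_poly r M s) < \<epsilon>" by blast
qed

lemma dir_approx_power: "dir_approx F \<Longrightarrow> dir_approx (\<lambda>s. F s ^ n)"
  by (induction n) (auto intro: dir_approx_const dir_approx_mult)

lemma dir_approx_sum:
  assumes "\<And>j. j < J \<Longrightarrow> dir_approx (F j)"
  shows "dir_approx (\<lambda>s. \<Sum>j<(J::nat). F j s)"
  using assms by (induction J) (auto intro: dir_approx_const dir_approx_add)

lemma dir_approx_limit:
  assumes "\<And>\<epsilon>. \<epsilon> > 0 \<Longrightarrow> \<exists>G. dir_approx G \<and> (\<forall>s. Re s \<ge> 0 \<longrightarrow> norm (F s - G s) < \<epsilon>)"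
  shows "dir_approx F"
  unfolding dir_approx_def
proof (intro allI impI)
  fix \<epsilon> :: real assume "\<epsilon> > 0"
  then have h: "\<epsilon> / 2 > 0" by simp
  obtain G where G: "dir_approx G" "\<And>s. Re s \<ge> 0 \<Longrightarrow> norm (F s - G s) < \<epsilon> / 2" using assms [OF h] by blast
  obtain M r where M: "M \<ge> 1" "\<And>s. Re s \<ge> 0 \<Longrightarrow> norm (G s - dir_poly r M s) < \<epsilon> / 2"
    using G(1) h unfolding dir_approx_def by meson
  have "norm (F s - dir_poly r M s) < \<epsilon>" if "Re s \<ge> 0" for s
    using M(2) [OF that] G(2) [OF that] norm_triangle_ineq [of "F s - G s" "G s - dir_poly r M s"] by simp
  then show "\<exists>M\<ge>1. \<exists>r. \<forall>s. Re s \<ge> 0 \<longrightarrow> norm (F s - dir_poly r M s) < \<epsilon>" using M(1) by blast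
qed

text \<open>Write \<open>G = F * (1 - u)\<close> with \<open>u\<close> of norm at most 1/2 and
  invert the second factor by its Neumann series.\<close>

lemma dir_approx_inverse_perturb:
  assumes F: "dir_approx F" "dir_approx (\<lambda>s. 1 / F s)" and G: "dir_approx G"
    and m: "m > 0" "\<And>s. Re s \<ge> 0 \<Longrightarrow> norm (F s) \<ge> m"
    and FG: "\<And>s. Re s \<ge> 0 \<Longrightarrow> norm (F s - G s) \<le> m / 2"
  shows "dir_approx (\<lambda>s. 1 / G s)"
proof -
  define u where "u = (\<lambda>s. (F s + (-1) * G s) * (1 / F s))"
  have u: "dir_approx u" unfolding u_def by (intro dir_approx_mult dir_approx_add dir_approx_const F G)
  have F0: "F s \<noteq> 0" if "Re s \<ge> 0" for s using m(2) [OF that] m(1) by auto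
  have un: "norm (u s) \<le> 1 / 2" if "Re s \<ge> 0" for s
  proof -
    have "norm (u s) = norm (F s - G s) / norm (F s)" by (simp add: u_def norm_mult norm_divide)
    also have "\<dots> \<le> (m / 2) / m" using FG [OF that] m(2) [OF that] m(1) by (intro frac_le) auto
    finally show ?thesis using m(1) by simp
  qed
  have G_eq: "G s = F s * (1 - u s)" if "Re s \<ge> 0" for s
    using F0 [OF that] by (simp add: u_def field_simps)
  have "dir_approx (\<lambda>s. if Re s \<ge> 0 then 1 / (1 - u s) else 0)"
  proof (rule dir_approx_limit)
    fix \<epsilon> :: real assume "\<epsilon> > 0"
    obtain J where J: "(1 / 2) ^ J < \<epsilon> / 2" using real_arch_pow_inv [of "\<epsilon> / 2" "1 / 2"] \<open>\<epsilon> > 0\<close> by auto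
    have "norm (1 / (1 - u s) - (\<Sum>j<J. u s ^ j)) < \<epsilon>" if "Re s \<ge> 0" for s
    proof -
      have n1: "norm (1 - u s) \<ge> 1 / 2" using un [OF that] norm_triangle_ineq2 [of 1 "u s"] by simp
      then have ne: "1 - u s \<noteq> 0" by auto
      have "(1 - u s) * (\<Sum>j<J. u s ^ j) = 1 - u s ^ J" by (simp add: one_diff_power_eq)
      then have "(\<Sum>j<J. u s ^ j) = (1 - u s ^ J) / (1 - u s)" using ne by (simp add: field_simps)
      then have "1 / (1 - u s) - (\<Sum>j<J. u s ^ j) = u s ^ J / (1 - u s)" by (simp add: diff_divide_distrib [symmetric])
      then have "norm (1 / (1 - u s) - (\<Sum>j<J. u s ^ j)) = norm (u s) ^ J / norm (1 - u s)"
        by (simp add: norm_divide norm_power)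
      also have "\<dots> \<le> (1 / 2) ^ J / (1 / 2)" using n1 un [OF that] by (intro frac_le power_mono) auto
      also have "\<dots> < \<epsilon>" using J by simp
      finally show ?thesis .
    qed
    then show "\<exists>G. dir_approx G \<and> (\<forall>s. Re s \<ge> 0 \<longrightarrow> norm ((if Re s \<ge> 0 then 1 / (1 - u s) else 0) - G s) < \<epsilon>)"
      by (intro exI [of _ "\<lambda>s. \<Sum>j<J. u s ^ j"] conjI dir_approx_sum dir_approx_power u) auto
  qed
  from dir_approx_mult [OF F(2) this] show ?thesis
    unfolding dir_approx_def using G_eq by (auto simp: divide_simps)
qed

text \<open>Far to the right the constant term dominates and a Neumann series inverts the
  polynomial. Invertibility is then carried leftwards to \<open>\<delta>\<close> in steps of fixed
  length, which cannot shrink because \<open>m\<close> bounds the polynomial below throughout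
  \<open>Re s \<ge> \<delta>\<close>.\<close>

lemma dir_approx_inverse_dir_poly:
  assumes "N \<ge> 1" "c 1 \<noteq> 0" and nz: "\<And>s. Re s > 0 \<Longrightarrow> dir_poly c N s \<noteq> 0" and "\<delta> > 0"
  shows "dir_approx (\<lambda>s. 1 / dir_poly c N (s + of_real \<delta>))"
proof -
  obtain m where m: "m > 0" "\<And>s. Re s \<ge> \<delta> \<Longrightarrow> norm (dir_poly c N s) \<ge> m"
    using dir_poly_lower_bound [OF assms] by metis
  define P where "P \<sigma> s = dir_poly c N (s + complex_of_real \<sigma>)" for \<sigma> s
  have approx: "dir_approx (P \<sigma>)" for \<sigma>
    unfolding P_def dir_poly_add using \<open>N \<ge> 1\<close> by (intro dir_approx_dir_poly)
  \<comment> \<open>A Lipschitz constant with respect to the shift, uniform in \<open>s\<close>; the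
    added 1 makes it positive so that one can divide by it.\<close>
  define L where "L = (\<Sum>n=1..N. norm (c n) * ln (real n)) + 1"
  have Lpos: "L > 0" unfolding L_def by (intro add_nonneg_pos sum_nonneg) auto
  have lip: "norm (P \<sigma> s - P \<sigma>' s) \<le> L * \<bar>\<sigma> - \<sigma>'\<bar>" if "Re s \<ge> 0" "\<sigma> \<ge> 0" "\<sigma>' \<ge> 0" for s \<sigma> \<sigma>'
  proof -
    have expl: "\<bar>exp (- x) - exp (- y)\<bar> \<le> \<bar>x - y\<bar>" if "x \<ge> 0" "y \<ge> 0" for x y :: real
    proof -
      have *: "exp (- x) - exp (- y) \<le> y - x" if "0 \<le> x" "x \<le> y" for x y :: real
      proof -
        have "exp (- x) - exp (- y) = exp (- x) * (1 - exp (- (y - x)))" by (simp add: algebra_simps flip: exp_add)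
        also have "\<dots> \<le> 1 * (y - x)"
        proof (rule mult_mono)
          show "1 - exp (- (y - x)) \<le> y - x" using exp_ge_add_one_self [of "- (y - x)"] by linarith
        qed (use that in auto)
        finally show ?thesis by simp
      qed
      show ?thesis using * [of x y] * [of y x] that by (cases "x \<le> y") auto
    qed
    have "P \<sigma> s - P \<sigma>' s = (\<Sum>n=1..N. c n * exp (- s * of_real (ln (real n))) * of_real (exp (- (\<sigma> * ln (real n))) - exp (- (\<sigma>' * ln (real n)))))"
      unfolding P_def dir_poly_add dir_poly_def sum_subtractf [symmetric]
    proof (intro sum.cong refl)
      fix n
      have r: "exp (- (s + of_real x) * of_real (ln (real n))) =
          exp (- s * of_real (ln (real n))) * complex_of_real (exp (- (x * ln (real n))))" for x
        unfolding exp_of_real [symmetric] exp_add [symmetric] by (simp add: algebra_simps)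
      have ring: "k * (E * A) - k * (E * B) = k * E * (A - B)" for k A B E :: complex
        by (simp add: algebra_simps)
      show "c n * exp (- (s + of_real \<sigma>) * of_real (ln (real n))) - c n * exp (- (s + of_real \<sigma>') * of_real (ln (real n))) =
          c n * exp (- s * of_real (ln (real n))) * of_real (exp (- (\<sigma> * ln (real n))) - exp (- (\<sigma>' * ln (real n))))"
        unfolding of_real_diff r by (rule ring)
    qed
    also have "norm \<dots> \<le> (\<Sum>n=1..N. norm (c n) * ln (real n) * \<bar>\<sigma> - \<sigma>'\<bar>)"
    proof (rule sum_norm_le)
      fix n assume n: "n \<in> {1..N}"
      have "norm (exp (- s * of_real (ln (real n)))) \<le> 1" using n that by simp
      moreover have "\<bar>exp (- (\<sigma> * ln (real n))) - exp (- (\<sigma>' * ln (real n)))\<bar> \<le> \<bar>\<sigma> * ln (real n) - \<sigma>' * ln (real n)\<bar>"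
        using n that by (intro expl) auto
      moreover have "\<bar>\<sigma> * ln (real n) - \<sigma>' * ln (real n)\<bar> = ln (real n) * \<bar>\<sigma> - \<sigma>'\<bar>"
        using n by (simp add: abs_mult flip: left_diff_distrib)
      ultimately have "norm (exp (- s * of_real (ln (real n)))) * \<bar>exp (- (\<sigma> * ln (real n))) - exp (- (\<sigma>' * ln (real n)))\<bar> \<le> 1 * (ln (real n) * \<bar>\<sigma> - \<sigma>'\<bar>)"
        by (intro mult_mono) auto
      then have "norm (c n) * (norm (exp (- s * of_real (ln (real n)))) * \<bar>exp (- (\<sigma> * ln (real n))) - exp (- (\<sigma>' * ln (real n)))\<bar>) \<le>
          norm (c n) * (1 * (ln (real n) * \<bar>\<sigma> - \<sigma>'\<bar>))"
        by (intro mult_left_mono) auto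
      then show "norm (c n * exp (- s * of_real (ln (real n))) * of_real (exp (- (\<sigma> * ln (real n))) - exp (- (\<sigma>' * ln (real n))))) \<le>
          norm (c n) * ln (real n) * \<bar>\<sigma> - \<sigma>'\<bar>"
        unfolding norm_mult norm_of_real mult.assoc by simp
    qed
    also have "\<dots> \<le> L * \<bar>\<sigma> - \<sigma>'\<bar>" unfolding L_def sum_distrib_right [symmetric] by (intro mult_right_mono) auto
    finally show ?thesis .
  qed
  have "norm (c 1) / 2 > 0" using \<open>c 1 \<noteq> 0\<close> by simp
  then obtain \<sigma>0 where \<sigma>0: "\<sigma>0 > 0" "\<And>s. Re s \<ge> \<sigma>0 \<Longrightarrow> norm (dir_poly c N s - c 1) \<le> norm (c 1) / 2"
    using dir_poly_far_right [OF \<open>N \<ge> 1\<close>, of _ c] by metis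
  have base: "dir_approx (\<lambda>s. 1 / P (max \<delta> \<sigma>0) s)"
  proof (rule dir_approx_inverse_perturb [of "\<lambda>s. c 1" _ "norm (c 1)"])
    show "norm (c 1 - P (max \<delta> \<sigma>0) s) \<le> norm (c 1) / 2" if "Re s \<ge> 0" for s
      using \<sigma>0(2) [of "s + of_real (max \<delta> \<sigma>0)"] that unfolding P_def by (simp add: norm_minus_commute)
  qed (use \<open>c 1 \<noteq> 0\<close> approx dir_approx_const in auto)
  \<comment> \<open>A shift by this amount changes the polynomial by at most \<open>m / 2\<close>,
    the radius allowed by \<open>dir_approx_inverse_perturb\<close>.\<close>
  define \<eta> where "\<eta> = m / (2 * L)"
  have \<eta>: "\<eta> > 0" using m Lpos by (simp add: \<eta>_def)
  have "dir_approx (\<lambda>s. 1 / P (max \<delta> (\<sigma>0 - real j * \<eta>)) s)" for j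
  proof (induction j)
    case (Suc j)
    show ?case
    proof (rule dir_approx_inverse_perturb [OF approx Suc approx m(1)])
      fix s assume s: "Re s \<ge> 0"
      show "norm (P (max \<delta> (\<sigma>0 - real j * \<eta>)) s) \<ge> m" unfolding P_def using s by (intro m(2)) auto
      have "norm (P (max \<delta> (\<sigma>0 - real j * \<eta>)) s - P (max \<delta> (\<sigma>0 - real (Suc j) * \<eta>)) s) \<le>
          L * \<bar>max \<delta> (\<sigma>0 - real j * \<eta>) - max \<delta> (\<sigma>0 - real (Suc j) * \<eta>)\<bar>"
        using s \<open>\<delta> > 0\<close> by (intro lip) auto
      also have "\<dots> \<le> L * \<eta>"
        using Lpos \<eta> by (intro mult_left_mono) (auto simp: max_def algebra_simps)
      also have "\<dots> = m / 2" using Lpos by (simp add: \<eta>_def)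
      finally show "norm (P (max \<delta> (\<sigma>0 - real j * \<eta>)) s - P (max \<delta> (\<sigma>0 - real (Suc j) * \<eta>)) s) \<le> m / 2" .
    qed
  qed (use base in simp)
  moreover obtain j where "\<sigma>0 < real j * \<eta>" using reals_Archimedean3 [OF \<eta>] by blast
  then have "max \<delta> (\<sigma>0 - real j * \<eta>) = \<delta>" using \<open>\<delta> > 0\<close> by simp
  ultimately show ?thesis unfolding P_def by metis
qed

text \<open>The products \<open>P \<cdot> R\<close> with \<open>R \<approx> 1/P(\<cdot> + \<delta>)\<close> tend to \<open>1\<close> in norm, because their constant
  terms tend to \<open>1\<close> while their norms are at most \<open>N powr (\<delta>/2)\<close> up to a small error.\<close>

lemma cyclic_seq_of_zero_free:
  assumes N: "N \<ge> 1" and p1: "p 1 \<noteq> 0" and p: "\<And>n. n \<notin> {1..N} \<Longrightarrow> p n = 0"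
    and nz: "\<And>s. Re s > 0 \<Longrightarrow> dir_poly p N s \<noteq> 0"
  shows "cyclic_seq p"
proof -
  have l2p: "l2 p" using l2_finite_support(1) [of "{1..N}" p] p by auto
  define B where "B = (\<Sum>n=1..N. norm (p n))"
  have B: "B \<ge> 0" unfolding B_def by (intro sum_nonneg) auto
  show ?thesis unfolding cyclic_seq_def dclosure_def
  proof (intro CollectI conjI l2_unit_seq allI impI)
    fix \<epsilon> :: real assume "\<epsilon> > 0"
    \<comment> \<open>This will bound the squared distance of \<open>e\<close> from
      \<open>unit_seq\<close> when \<open>x\<close> is both the shift and the error of
      approximation. The distance is the squared norm of \<open>e\<close> plus
      \<open>1 - 2 * Re (e 1)\<close>; the first is at most the square in \<open>E x\<close>, and
      \<open>1 - Re (e 1) \<le> x * norm (p 1)\<close>.\<close>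
    define E where "E x = (exp (x / 2 * ln (real N)) + B * x)\<^sup>2 - 1 + 2 * (x * norm (p 1))" for x
    have "isCont E 0" unfolding E_def by (intro continuous_intros) auto
    then have "E \<midarrow>0\<rightarrow> E 0" by (simp add: isCont_def)
    moreover have "E 0 = 0" by (simp add: E_def)
    ultimately have "\<exists>d>0. \<forall>x. x \<noteq> 0 \<and> norm (x - 0) < d \<longrightarrow> norm (E x - 0) < \<epsilon>\<^sup>2"
      using LIM_D [of E 0 0 "\<epsilon>\<^sup>2"] \<open>\<epsilon> > 0\<close> by simp
    then obtain d where d: "d > 0" "\<And>x. x \<noteq> 0 \<Longrightarrow> norm x < d \<Longrightarrow> norm (E x) < \<epsilon>\<^sup>2" by auto
    define \<delta> where "\<delta> = d / 2"
    have \<delta>: "\<delta> > 0" "E \<delta> < \<epsilon>\<^sup>2" using d(1) d(2) [of \<delta>] by (auto simp: \<delta>_def)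
    obtain K r where K: "K \<ge> 1" and
      r: "\<And>s. Re s \<ge> 0 \<Longrightarrow> norm (1 / dir_poly p N (s + of_real \<delta>) - dir_poly r K s) < \<delta>"
      using dir_approx_inverse_dir_poly [OF N p1 nz \<delta>(1)] \<delta>(1) unfolding dir_approx_def by metis
    define e where "e = (\<lambda>n. \<Sum>k=1..K. r k * dil k p n)"
    have e: "dir_poly e (K * N) s = dir_poly r K s * dir_poly p N s" for s
      unfolding e_def by (rule dir_poly_mult [OF p, symmetric])
    have e0: "e n = 0" if "n \<notin> {1..K * N}" for n
      unfolding e_def
    proof (rule sum.neutral, safe)
      fix k assume k: "k \<in> {1..K}"
      show "r k * dil k p n = 0"
      proof (cases "k dvd n")
        case True
        then obtain j where j: "n = k * j" by (elim dvdE)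
        have "j \<notin> {1..N}"
        proof
          assume "j \<in> {1..N}"
          then have "n \<in> {1..K * N}" using j k by (auto simp: Suc_le_eq intro!: mult_le_mono)
          then show False using that by simp
        qed
        then show ?thesis using p k j by (simp add: dil_def)
      qed (simp add: dil_def)
    qed
    have bound: "norm (dir_poly e (K * N) (\<i> * of_real t)) \<le> exp (\<delta> / 2 * ln (real N)) + B * \<delta>" for t
    proof -
      let ?s = "\<i> * complex_of_real t"
      let ?a = "dir_poly p N ?s" and ?b = "dir_poly p N (?s + of_real \<delta>)"
      have b0: "?b \<noteq> 0" using \<delta>(1) by (intro nz) simp
      have st: "?s = Complex 0 t" "?s + of_real \<delta> = Complex \<delta> t" by (simp_all add: complex_eq_iff)
      have "norm ?a \<le> exp (\<delta> / 2 * ln (real N)) * norm ?b"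
        using dir_poly_quasi_monotone [OF N p1 nz, of 0 \<delta> t] \<delta>(1) unfolding st(2) unfolding st(1) by simp
      then have ab: "norm (?a / ?b) \<le> exp (\<delta> / 2 * ln (real N))" using b0 by (simp add: norm_divide divide_le_eq)
      have "dir_poly r K ?s * ?a = ?a / ?b - ?a * (1 / ?b - dir_poly r K ?s)" by (simp add: algebra_simps)
      then have "norm (dir_poly r K ?s * ?a) \<le> norm (?a / ?b) + norm ?a * norm (1 / ?b - dir_poly r K ?s)"
        by (metis norm_triangle_ineq4 norm_mult)
      also have "norm ?a * norm (1 / ?b - dir_poly r K ?s) \<le> B * \<delta>"
        using norm_dir_poly_le [of ?s p N] r [of ?s] B unfolding B_def [symmetric] by (intro mult_mono) auto
      finally show ?thesis using ab unfolding e by simp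
    qed
    have sumsq: "(\<Sum>n=1..K * N. (norm (e n))\<^sup>2) \<le> (exp (\<delta> / 2 * ln (real N)) + B * \<delta>)\<^sup>2"
      by (rule sum_norm_square_le_sup [OF bound])
    \<comment> \<open>First coefficients are limits along the real axis towards infinity, so the
      uniform bound for the functions passes to them.\<close>
    have r1: "norm (1 / p 1 - r 1) \<le> \<delta>"
    proof (rule ccontr)
      assume neg: "\<not> ?thesis"
      have tend: "((\<lambda>x. dir_poly q M (of_real (x + z))) \<longlongrightarrow> q 1) at_top" if M: "M \<ge> 1" for q M and z :: real
      proof (rule tendstoI)
        fix h :: real assume "h > 0"
        then obtain \<sigma> where \<sigma>: "\<And>s. Re s \<ge> \<sigma> \<Longrightarrow> norm (dir_poly q M s - q 1) \<le> h / 2"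
          using dir_poly_far_right [OF M, of "h / 2" q] by (metis half_gt_zero)
        show "eventually (\<lambda>x. dist (dir_poly q M (of_real (x + z))) (q 1) < h) at_top"
          using eventually_ge_at_top [of "\<sigma> - z"]
        proof eventually_elim
          case (elim x)
          then show ?case using \<sigma> [of "of_real (x + z)"] \<open>h > 0\<close> by (simp add: dist_norm)
        qed
      qed
      have "((\<lambda>x. norm (1 / dir_poly p N (of_real (x + \<delta>)) - dir_poly r K (of_real (x + 0)))) \<longlongrightarrow> norm (1 / p 1 - r 1)) at_top"
        using p1 by (intro tendsto_intros tend N K) auto
      moreover have "eventually (\<lambda>x. norm (1 / dir_poly p N (of_real (x + \<delta>)) - dir_poly r K (of_real (x + 0))) \<le> \<delta>) at_top"
        using eventually_ge_at_top [of 0]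
        by eventually_elim (use r in \<open>auto simp: less_imp_le\<close>)
      ultimately have "norm (1 / p 1 - r 1) \<le> \<delta>"
        by (rule tendsto_upperbound) simp
      then show False using neg by blast
    qed
    have "e 1 = (\<Sum>k=1..K. if k = 1 then r 1 * p 1 else 0)"
      unfolding e_def by (intro sum.cong refl) (auto simp: dil_def)
    then have e1: "e 1 = r 1 * p 1" using K by simp
    have "1 - e 1 = p 1 * (1 / p 1 - r 1)" using p1 unfolding e1 by (simp add: algebra_simps)
    then have "norm (1 - e 1) \<le> \<delta> * norm (p 1)"
      using mult_left_mono [OF r1 norm_ge_zero [of "p 1"]] by (simp add: norm_mult mult.commute)
    then have Re1: "1 - Re (e 1) \<le> \<delta> * norm (p 1)" using complex_Re_le_cmod [of "1 - e 1"] by simp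
    have KN: "1 \<in> {1..K * N}" using K N by (metis atLeastAtMost_iff le_refl mult_le_mono nat_mult_1)
    have "(norm (unit_seq n - e n))\<^sup>2 = (norm (e n))\<^sup>2 + (if n = 1 then 1 - 2 * Re (e 1) else 0)" for n
    proof (cases "n = 1")
      case True
      then show ?thesis unfolding cmod_power2 by (simp add: unit_seq_def power2_eq_square algebra_simps)
    qed (simp add: unit_seq_def)
    then have "(\<Sum>n=1..K * N. (norm (unit_seq n - e n))\<^sup>2) = (\<Sum>n=1..K * N. (norm (e n))\<^sup>2) + (1 - 2 * Re (e 1))"
      using KN by (simp add: sum.distrib)
    also have "\<dots> \<le> E \<delta>" using sumsq Re1 unfolding E_def by linarith
    also have "\<dots> < \<epsilon>\<^sup>2" by (rule \<delta>)
    finally have fin: "(\<Sum>n=1..K * N. (norm (unit_seq n - e n))\<^sup>2) < \<epsilon>\<^sup>2" .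
    have "l2norm (\<lambda>n. unit_seq n - e n) = sqrt (\<Sum>n=1..K * N. (norm (unit_seq n - e n))\<^sup>2)"
      using KN e0 by (intro l2_finite_support) (auto simp: unit_seq_def)
    also have "\<dots> < \<epsilon>" using fin \<open>\<epsilon> > 0\<close> by (simp add: real_less_lsqrt)
    finally show "\<exists>y\<in>dspan p. l2norm (\<lambda>n. unit_seq n - y n) < \<epsilon>"
      by (intro bexI [of _ e]) (auto simp: dspan_def e_def)
  qed
qed

subsection \<open>Primes outside a proper multiplicative class\<close>

lemma prod_one_minus_ge:
  fixes x :: "'a \<Rightarrow> real"
  assumes "finite A" "\<And>i. i \<in> A \<Longrightarrow> 0 \<le> x i \<and> x i \<le> 1"
  shows "(\<Prod>i\<in>A. 1 - x i) \<ge> 1 - (\<Sum>i\<in>A. x i)"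
  using assms
proof (induction A rule: finite_induct)
  case (insert i A)
  have p: "(\<Prod>i\<in>A. 1 - x i) \<le> 1" using insert by (intro prod_le_1) auto
  have "x i * (\<Prod>i\<in>A. 1 - x i) \<le> x i * 1" using insert p by (intro mult_left_mono) auto
  moreover have "(\<Prod>i\<in>A. 1 - x i) \<ge> 1 - (\<Sum>i\<in>A. x i)" using insert by auto
  ultimately show ?case using insert.hyps by (simp add: algebra_simps)
qed simp

lemma card_multiples_le:
  assumes "p > 0"
  shows "real (card {n \<in> {1..M}. p dvd n}) \<le> real M / real p"
proof -
  have "{n \<in> {1..M}. p dvd n} \<subseteq> (\<lambda>m. p * m) ` {1..M div p}"
  proof
    fix n assume "n \<in> {n \<in> {1..M}. p dvd n}"
    then obtain m where m: "n = p * m" "1 \<le> n" "n \<le> M" by auto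
    then have "m \<le> M div p" using assms by (simp add: less_eq_div_iff_mult_less_eq mult.commute)
    moreover have "m \<ge> 1" using m by (cases m) auto
    ultimately show "n \<in> (\<lambda>m. p * m) ` {1..M div p}" using m by auto
  qed
  then have "card {n \<in> {1..M}. p dvd n} \<le> card ((\<lambda>m. p * m) ` {1..M div p})" by (intro card_mono) auto
  also have "\<dots> \<le> M div p" using card_image_le [of "{1..M div p}" "\<lambda>m. p * m"] by simp
  finally have "real (card {n \<in> {1..M}. p dvd n}) \<le> real (M div p)" by simp
  also have "\<dots> \<le> real M / real p"
  proof -
    have "real (M div p * p) \<le> real M" by (intro of_nat_mono div_times_less_eq_dividend)
    then show ?thesis using assms by (simp add: pos_le_divide_eq)
  qed
  finally show ?thesis .
qed

lemma multiplicative_class_of_primes: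
  assumes K: "K 1" "\<And>m n. K m \<Longrightarrow> K n \<Longrightarrow> K (m * n)"
    and "n > 0" "\<And>p. prime p \<Longrightarrow> p dvd n \<Longrightarrow> K p"
  shows "K (n::nat)"
  using assms(3,4)
proof (induction n rule: prime_divisors_induct)
  case (unit x)
  then show ?case using K(1) by simp
next
  case (factor p x)
  then show ?case by (intro K(2)) auto
qed simp

text \<open>If the primes outside \<open>K\<close> had a convergent sum of reciprocals, sieving by them would leave a
  positive proportion of the residue class of \<open>c\<close>; but an unsieved number lies in \<open>K\<close>.\<close>

lemma not_summable_primes_outside:
  assumes q: "q > 1"
    and K: "K 1" "\<And>m n. K m \<Longrightarrow> K n \<Longrightarrow> K (m * n)" "\<And>m n. [m = n] (mod q) \<Longrightarrow> K m \<Longrightarrow> K n"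
    and c: "coprime c q" "\<not> K c"
  shows "\<not> summable (\<lambda>p. if prime p \<and> coprime p q \<and> \<not> K p then 1 / real p else 0)"
proof
  define X where "X = {p. prime p \<and> coprime p q \<and> \<not> K p}"
  define w where "w p = (if p \<in> X then 1 / real p else 0)" for p
  assume "summable (\<lambda>p. if prime p \<and> coprime p q \<and> \<not> K p then 1 / real p else 0)"
  then have sw: "summable w" by (simp add: w_def [abs_def] X_def)
  have w0: "w p \<ge> 0" for p by (simp add: w_def)
  have Xp: "prime p" if "p \<in> X" for p using that by (simp add: X_def)
  have X2: "1 / real p \<le> 1 / 2" if "p \<in> X" for p using prime_ge_2_nat [OF Xp [OF that]] by (simp add: frac_le)
  have tail: "(\<Sum>p\<in>A. 1 / real p) \<le> (\<Sum>i. w (i + y))" if A: "finite A" "A \<subseteq> X" "\<And>p. p \<in> A \<Longrightarrow> y \<le> p" for A y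
  proof -
    have "(\<Sum>p\<in>A. 1 / real p) = (\<Sum>p\<in>A. w p)" using A by (intro sum.cong) (auto simp: w_def)
    also have "\<dots> = (\<Sum>i\<in>(\<lambda>p. p - y) ` A. w (i + y))"
      using A(3) by (subst sum.reindex) (auto simp: inj_on_def intro!: sum.cong, metis le_add_diff_inverse2)
    also have "\<dots> \<le> (\<Sum>i. w (i + y))"
      using sw A(1) w0 by (intro sum_le_suminf) (auto simp: summable_iff_shift)
    finally show ?thesis .
  qed
  \<comment> \<open>The proportion of integers divisible by no prime of \<open>X\<close> below
    \<open>y\<close>.\<close>
  define \<kappa> where "\<kappa> y = (\<Prod>p\<in>{p \<in> X. p < y}. 1 - 1 / real p)" for y :: nat
  have fin: "finite {p \<in> X. p < y}" for y :: nat by (rule finite_subset [of _ "{..<y}"]) auto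
  have \<kappa>pos: "\<kappa> y > 0" for y unfolding \<kappa>_def
    by (rule prod_pos) (use X2 in fastforce)
  \<comment> \<open>Primes of \<open>X\<close> beyond \<open>y0\<close> can at most halve the
    proportion. This gives the fixed lower bound \<open>\<kappa> y0 / 2\<close>, against which
    \<open>y1\<close> is chosen next without circularity.\<close>
  obtain y0 where y0: "\<And>y. y \<ge> y0 \<Longrightarrow> norm (\<Sum>i. w (i + y)) < 1 / 2"
    using suminf_exist_split [OF _ sw, of "1 / 2"] by auto
  have "\<kappa> y0 / (2 * real q) > 0" using \<kappa>pos q by simp
  then obtain y1 where y1: "\<And>y. y \<ge> y1 \<Longrightarrow> norm (\<Sum>i. w (i + y)) < \<kappa> y0 / (2 * real q)"
    using suminf_exist_split [OF _ sw] by metis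
  define y where "y = max y0 y1"
  have \<kappa>y: "\<kappa> y \<ge> \<kappa> y0 / 2"
  proof -
    define B where "B = {p \<in> X. y0 \<le> p \<and> p < y}"
    have B: "finite B" "B \<subseteq> X" by (auto simp: B_def intro: finite_subset [of _ "{..<y}"])
    have "{p \<in> X. p < y} = {p \<in> X. p < y0} \<union> B" by (auto simp: B_def y_def)
    then have "\<kappa> y = (\<Prod>p\<in>{p \<in> X. p < y0} \<union> B. 1 - 1 / real p)" by (simp only: \<kappa>_def)
    also have "\<dots> = \<kappa> y0 * (\<Prod>p\<in>B. 1 - 1 / real p)"
      unfolding \<kappa>_def by (rule prod.union_disjoint) (use B fin [of y0] in \<open>auto simp: B_def\<close>)
    finally have "\<kappa> y = \<kappa> y0 * (\<Prod>p\<in>B. 1 - 1 / real p)" .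
    moreover have "(\<Prod>p\<in>B. 1 - 1 / real p) \<ge> 1 / 2"
    proof -
      have "(\<Sum>p\<in>B. 1 / real p) \<le> (\<Sum>i. w (i + y0))" using B by (intro tail) (auto simp: B_def)
      also have "\<dots> < 1 / 2" using y0 [of y0] by simp
      finally have "(\<Sum>p\<in>B. 1 / real p) < 1 / 2" .
      moreover have "(\<Prod>p\<in>B. 1 - 1 / real p) \<ge> 1 - (\<Sum>p\<in>B. 1 / real p)"
        using B X2 by (intro prod_one_minus_ge) force+
      ultimately show ?thesis by simp
    qed
    ultimately show ?thesis using \<kappa>pos [of y0] by (simp add: mult_left_mono)
  qed
  define Q where "Q = \<Prod>{p \<in> X. p < y}"
  have Q0: "Q > 0" unfolding Q_def by (rule prod_pos) (auto dest!: Xp simp: prime_gt_0_nat)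
  have pQ: "p dvd Q \<longleftrightarrow> p \<in> X \<and> p < y" if pp: "prime p" for p
  proof
    assume "p dvd Q"
    then obtain r where "r \<in> X" "r < y" "p dvd r"
      using prime_dvd_prod_iff [OF fin pp, of "\<lambda>x. x" y] unfolding Q_def by auto
    then show "p \<in> X \<and> p < y" using that Xp by (metis primes_dvd_imp_eq)
  next
    assume "p \<in> X \<and> p < y"
    then show "p dvd Q" unfolding Q_def using fin [of y] by (intro dvd_prodI) auto
  qed
  have pf: "prime_factors Q = {p \<in> X. p < y}" using pQ Q0 Xp by (auto simp: prime_factors_dvd)
  have tot: "real (totient Q) = real Q * \<kappa> y" by (simp add: totient_formula2 pf \<kappa>_def)
  have qQ: "coprime q Q" unfolding Q_def by (rule prod_coprime_right) (auto simp: X_def coprime_commute)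
  \<comment> \<open>One number below \<open>q * Q\<close> in the class of \<open>c\<close> for every
    residue modulo \<open>Q\<close>; those with \<open>r\<close> coprime to \<open>Q\<close> survive
    the sieve.\<close>
  have "\<exists>x. x < q * Q \<and> [x = c] (mod q) \<and> [x = r] (mod Q)" for r
    using binary_chinese_remainder_unique_nat [OF qQ, of c r] q Q0 by auto
  then obtain n where n: "\<And>r. n r < q * Q" "\<And>r. [n r = c] (mod q)" "\<And>r. [n r = r] (mod Q)" by metis
  have inj: "inj_on n (totatives Q)"
  proof (rule inj_onI)
    fix r r' assume r: "r \<in> totatives Q" "r' \<in> totatives Q" "n r = n r'"
    then have "[r = r'] (mod Q)" using n(3) by (metis cong_sym cong_trans)
    moreover have "0 < r" "r \<le> Q" "0 < r'" "r' \<le> Q" using r by (auto simp: in_totatives_iff)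
    ultimately show "r = r'"
    proof (cases "r = Q \<or> r' = Q")
      case True
      then have "Q dvd r \<and> Q dvd r'" using \<open>[r = r'] (mod Q)\<close>
        by (metis cong_dvd_iff dvd_refl)
      then show ?thesis using \<open>0 < r\<close> \<open>r \<le> Q\<close> \<open>0 < r'\<close> \<open>r' \<le> Q\<close> by (metis dvd_imp_le le_antisym)
    next
      case False
      then show ?thesis using \<open>[r = r'] (mod Q)\<close> \<open>r \<le> Q\<close> \<open>r' \<le> Q\<close> by (simp add: cong_def)
    qed
  qed
  define Y where "Y = {p \<in> X. y \<le> p \<and> p \<le> q * Q}"
  have finY: "finite Y" by (rule finite_subset [of _ "{..q * Q}"]) (auto simp: Y_def)
  \<comment> \<open>A survivor is congruent to \<open>c\<close>, hence outside \<open>K\<close> and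
    coprime to \<open>q\<close>, so it has a prime factor in \<open>X\<close>. Being coprime to
    \<open>Q\<close>, it has no such factor below \<open>y\<close>.\<close>
  have sub: "n ` totatives Q \<subseteq> (\<Union>p\<in>Y. {n \<in> {1..q * Q}. p dvd n})"
  proof safe
    fix r assume r: "r \<in> totatives Q"
    have cop: "coprime (n r) q" using n(2) c(1) by (metis cong_imp_coprime cong_sym)
    have "n r > 0"
    proof (rule Nat.gr0I)
      assume "n r = 0"
      then show False using cop q by simp
    qed
    have "\<not> K (n r)" using K(3) n(2) c(2) by blast
    then obtain p where p: "prime p" "p dvd n r" "\<not> K p"
      using multiplicative_class_of_primes [of K "n r"] K \<open>n r > 0\<close> by blast
    have "coprime p q" using p(2) cop by (meson coprime_divisors dvd_refl)
    then have "p \<in> X" using p by (simp add: X_def)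
    have "coprime (n r) Q" using n(3) r by (metis cong_imp_coprime cong_sym in_totatives_iff)
    then have "\<not> p dvd Q" using p by (meson coprime_common_divisor not_prime_unit)
    then have "y \<le> p" using pQ p \<open>p \<in> X\<close> by auto
    moreover have "p \<le> q * Q" using dvd_imp_le [OF p(2) \<open>n r > 0\<close>] n(1) [of r] by linarith
    ultimately show "n r \<in> (\<Union>p\<in>Y. {n \<in> {1..q * Q}. p dvd n})"
      using \<open>p \<in> X\<close> p n(1) [of r] \<open>n r > 0\<close> by (auto simp: Y_def intro!: bexI [of _ p] less_imp_le)
  qed
  have "real (totient Q) = real (card (n ` totatives Q))" using inj by (simp add: card_image totient_def)
  also have "\<dots> \<le> real (card (\<Union>p\<in>Y. {n \<in> {1..q * Q}. p dvd n}))"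
    using sub finY by (intro of_nat_mono card_mono) auto
  also have "\<dots> \<le> real (\<Sum>p\<in>Y. card {n \<in> {1..q * Q}. p dvd n})"
    using finY by (intro of_nat_mono card_UN_le)
  also have "\<dots> \<le> (\<Sum>p\<in>Y. real (q * Q) / real p)"
    unfolding of_nat_sum by (intro sum_mono card_multiples_le) (auto simp: Y_def dest!: Xp prime_gt_0_nat)
  also have "\<dots> = real (q * Q) * (\<Sum>p\<in>Y. 1 / real p)" by (simp add: sum_distrib_left)
  also have "\<dots> \<le> real (q * Q) * (\<Sum>i. w (i + y))"
    using finY by (intro mult_left_mono tail) (auto simp: Y_def)
  also have "\<dots> < real (q * Q) * (\<kappa> y0 / (2 * real q))"
    using y1 [of y] q Q0 by (intro mult_strict_left_mono) (auto simp: y_def)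
  also have "\<dots> = real Q * (\<kappa> y0 / 2)" using q by (simp add: field_simps)
  also have "\<dots> \<le> real Q * \<kappa> y" using \<kappa>y by (intro mult_left_mono) auto
  finally show False using tot by simp
qed

text \<open>Only finitely many residue classes lie outside \<open>K\<close>, so one of them must
  carry the divergence.\<close>

lemma residue_class_not_summable:
  assumes q: "q > 1"
    and K: "K 1" "\<And>m n. K m \<Longrightarrow> K n \<Longrightarrow> K (m * n)" "\<And>m n. [m = n] (mod q) \<Longrightarrow> K m \<Longrightarrow> K n"
    and c: "coprime c q" "\<not> K c"
  obtains a where "coprime a q" "\<not> K a" "\<not> summable (\<lambda>p. if prime p \<and> [p = a] (mod q) then 1 / real p else 0)"
proof (rule ccontr)
  assume neg: "\<not> thesis"
  define A where "A = {a. a < q \<and> coprime a q \<and> \<not> K a}"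
  have "summable (\<lambda>p. \<Sum>a\<in>A. if prime p \<and> [p = a] (mod q) then 1 / real p else 0)"
    by (rule summable_sum) (use neg that in \<open>auto simp: A_def\<close>)
  then have "summable (\<lambda>p. if prime p \<and> coprime p q \<and> \<not> K p then 1 / real p else 0)"
  proof (rule summable_comparison_test' [of _ 0])
    fix p :: nat
    show "norm (if prime p \<and> coprime p q \<and> \<not> K p then 1 / real p else 0) \<le>
      (\<Sum>a\<in>A. if prime p \<and> [p = a] (mod q) then 1 / real p else 0)"
    proof (cases "prime p \<and> coprime p q \<and> \<not> K p")
      case True
      have "[p = p mod q] (mod q)" by (simp add: cong_def)
      then have "p mod q \<in> A" using True q K(3) [of "p mod q" p]
        by (auto simp: A_def cong_sym_eq coprime_mod_left_iff)
      moreover have "finite A" by (simp add: A_def)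
      ultimately have "(if prime p \<and> [p = p mod q] (mod q) then 1 / real p else 0) \<le>
          (\<Sum>a\<in>A. if prime p \<and> [p = a] (mod q) then 1 / real p else 0)"
        by (intro member_le_sum) auto
      then show ?thesis using True \<open>[p = p mod q] (mod q)\<close> by simp
    qed (auto intro!: sum_nonneg)
  qed
  then show False using not_summable_primes_outside [OF assms] by simp
qed

subsection \<open>Zero-free entire functions of exponential type\<close>

text \<open>Without zeros there is an entire logarithm. The growth condition bounds its real part
  linearly, the Borel-Caratheodory inequality turns this into a linear bound on its modulus, and
  Liouville's theorem makes it affine.\<close>

lemma zero_free_exponential_type:
  assumes hol: "G holomorphic_on UNIV" and nz: "\<And>w. G w \<noteq> 0"
    and growth: "\<And>w. norm (G w) \<le> C * exp (norm w)"
  obtains \<alpha> where "\<And>w. G w = G 0 * exp (\<alpha> * w)"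
proof -
  have "\<exists>g. g holomorphic_on UNIV \<and> (\<forall>z\<in>UNIV. G z = exp (g z))"
    using simply_connected_eq_holomorphic_log [of UNIV] convex_imp_simply_connected [of "UNIV :: complex set"] hol nz by auto
  then obtain g where g: "g holomorphic_on UNIV" "\<And>z. G z = exp (g z)" by auto
  define u where "u z = g z - g 0" for z
  have hu: "u holomorphic_on A" for A
    unfolding u_def by (intro holomorphic_intros holomorphic_on_subset [OF g(1)]) auto
  have u0: "u 0 = 0" by (simp add: u_def)
  have C: "C > 0"
  proof -
    have "0 < norm (G 0)" using nz by simp
    also have "\<dots> \<le> C" using growth [of 0] by simp
    finally show ?thesis .
  qed
  \<comment> \<open>The added 1 makes the bound on the real part strict and \<open>D\<close>
    positive.\<close>
  define D where "D = \<bar>ln C - Re (g 0)\<bar> + 1"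
  have Re_u: "Re (u z) < norm z + D" for z
  proof -
    have "exp (Re (g z)) \<le> exp (ln C + norm z)" using growth [of z] C by (simp add: g exp_add)
    then have "Re (g z) \<le> ln C + norm z" by simp
    then show ?thesis by (simp add: u_def D_def)
  qed
  have bound: "norm (u z) \<le> 2 * (2 * norm z + D)" if z: "z \<noteq> 0" for z
  proof -
    define R where "R = 2 * norm z"
    define A where "A = R + D"
    have R: "R > 0" using z by (simp add: R_def)
    have A: "A > 0" using R by (simp add: A_def D_def)
    have ReA: "Re (u (of_real R * x)) < A" if "norm x < 1" for x
    proof -
      have "norm (of_real R * x) \<le> R" using that R by (simp add: norm_mult mult_left_le)
      then show ?thesis using Re_u [of "of_real R * x"] by (simp add: A_def)
    qed
    \<comment> \<open>The map taking \<open>w\<close> to \<open>w / (2 * A - w)\<close> sends the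
      half plane \<open>Re w < A\<close> into the unit disc and fixes 0, so the Schwarz lemma
      applies after rescaling by \<open>R\<close>.\<close>
    define v where "v x = u (of_real R * x) / (2 * of_real A - u (of_real R * x))" for x
    have ne: "2 * of_real A - u (of_real R * x) \<noteq> 0" if "norm x < 1" for x
    proof
      assume "2 * of_real A - u (of_real R * x) = 0"
      then have "Re (2 * of_real A - u (of_real R * x)) = 0" by simp
      then show False using ReA [OF that] A by simp
    qed
    have hv: "v holomorphic_on ball 0 1"
      unfolding v_def
    proof (intro holomorphic_intros)
      have "(u \<circ> (\<lambda>x. of_real R * x)) holomorphic_on ball 0 1"
        by (rule holomorphic_on_compose) (auto intro!: holomorphic_intros hu)
      then show "(\<lambda>x. u (of_real R * x)) holomorphic_on ball 0 1" "(\<lambda>x. u (of_real R * x)) holomorphic_on ball 0 1"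
        by (simp_all add: comp_def)
    qed (use ne in auto)
    have nv: "norm (v x) < 1" if "norm x < 1" for x
    proof -
      have "(norm (u (of_real R * x)))\<^sup>2 < (norm (2 * of_real A - u (of_real R * x)))\<^sup>2"
      proof -
        have "0 < 4 * A * (A - Re (u (of_real R * x)))" using ReA [OF that] A by simp
        then show ?thesis unfolding cmod_power2 by (simp add: power2_eq_square algebra_simps)
      qed
      then have "norm (u (of_real R * x)) < norm (2 * of_real A - u (of_real R * x))"
        by (rule power_less_imp_less_base) simp
      then show ?thesis using ne [OF that] by (simp add: v_def norm_divide)
    qed
    define x where "x = z / of_real R"
    have x: "norm x = 1 / 2" using z by (simp add: x_def R_def norm_divide norm_mult)
    have zx: "of_real R * x = z" using R by (simp add: x_def)
    have "norm (v x) \<le> norm x" using Schwarz_Lemma(1) [OF hv _ nv, of x] x by (simp add: v_def u0)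
    then have vx: "norm (v x) \<le> 1 / 2" using x by simp
    have eq: "u z = v x * (2 * of_real A - u z)" using ne [of x] x by (simp add: v_def zx)
    have "norm (u z) = norm (v x) * norm (2 * of_real A - u z)"
      using arg_cong [OF eq, of norm] unfolding norm_mult .
    also have "\<dots> \<le> 1 / 2 * norm (2 * of_real A - u z)" using vx by (rule mult_right_mono) simp
    also have "norm (2 * of_real A - u z) \<le> 2 * A + norm (u z)"
      using norm_triangle_ineq4 [of "2 * of_real A" "u z"] A by (simp add: norm_mult)
    finally show ?thesis by (simp add: A_def R_def)
  qed
  have "norm (u z) \<le> (4 + 2 * D) * norm z ^ 1" if "1 \<le> norm z" for z
  proof -
    have "norm (u z) \<le> 2 * (2 * norm z + D)" using that by (intro bound) auto
    also have "D \<le> D * norm z" using that by (simp add: D_def mult_le_cancel_left1)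
    finally show ?thesis by (simp add: algebra_simps)
  qed
  then have LP: "u z = (\<Sum>k\<le>1. (deriv ^^ k) u 0 / fact k * z ^ k)" for z
    by (rule Liouville_polynomial [OF hu])
  have "u z = deriv u 0 * z" for z using LP [of z] u0 by simp
  then have gz: "g z = g 0 + deriv u 0 * z" for z by (metis u_def add.commute diff_add_cancel)
  have "G z = G 0 * exp (deriv u 0 * z)" for z
  proof -
    have "G z = exp (g 0 + deriv u 0 * z)" by (subst g(2), subst gz, rule refl)
    then show ?thesis unfolding exp_add g(2) [of 0] .
  qed
  then show thesis using that by blast
qed

text \<open>A first order expansion of the logarithm. In the application the \<open>u p\<close> are
  absolutely summable and go wholly into the error, whereas for the \<open>v p\<close> only the
  squares are negligible, so their sum is kept.\<close>

lemma exp_product_estimate: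
  fixes u v :: "nat \<Rightarrow> complex"
  assumes fin: "finite S" and u: "\<And>p. p \<in> S \<Longrightarrow> norm (u p) < 1 / 2" and v: "\<And>p. p \<in> S \<Longrightarrow> norm (v p) < 1 / 2"
  obtains e where "(\<Prod>p\<in>S. (1 - u p) / (1 - v p)) = exp ((\<Sum>p\<in>S. v p) + e)"
    "norm e \<le> 2 * (\<Sum>p\<in>S. norm (u p)) + 2 * (\<Sum>p\<in>S. (norm (v p))\<^sup>2)"
proof -
  define e where "e = (\<Sum>p\<in>S. Ln (1 - u p) - (Ln (1 - v p) + v p))"
  have ne: "1 - x \<noteq> 0" if "norm x < 1 / 2" for x :: complex using that by auto
  have "exp ((\<Sum>p\<in>S. v p) + e) = exp (\<Sum>p\<in>S. Ln (1 - u p) - Ln (1 - v p))"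
    unfolding e_def sum.distrib [symmetric] by (simp add: algebra_simps)
  also have "\<dots> = (\<Prod>p\<in>S. exp (Ln (1 - u p) - Ln (1 - v p)))" using fin by (rule exp_sum)
  also have "\<dots> = (\<Prod>p\<in>S. (1 - u p) / (1 - v p))"
    using ne u v by (intro prod.cong refl) (simp add: exp_diff)
  finally have 1: "(\<Prod>p\<in>S. (1 - u p) / (1 - v p)) = exp ((\<Sum>p\<in>S. v p) + e)" ..
  have "norm e \<le> (\<Sum>p\<in>S. 2 * norm (u p) + 2 * (norm (v p))\<^sup>2)"
    unfolding e_def
  proof (rule sum_norm_le)
    fix p assume p: "p \<in> S"
    have "norm (Ln (1 - u p)) \<le> 2 * norm (u p)" using norm_Ln_le [of "- u p"] u [OF p] by simp
    moreover have "norm (Ln (1 - v p) + v p) \<le> (norm (v p))\<^sup>2 / (1 - norm (v p))"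
      using Ln_approx_linear [of "- v p"] v [OF p] by simp
    moreover have "(norm (v p))\<^sup>2 / (1 - norm (v p)) \<le> (norm (v p))\<^sup>2 / (1 / 2)"
      using v [OF p] by (intro divide_left_mono) auto
    ultimately show "norm (Ln (1 - u p) - (Ln (1 - v p) + v p)) \<le> 2 * norm (u p) + 2 * (norm (v p))\<^sup>2"
      using norm_triangle_ineq4 [of "Ln (1 - u p)" "Ln (1 - v p) + v p"] by simp
  qed
  then have "norm e \<le> 2 * (\<Sum>p\<in>S. norm (u p)) + 2 * (\<Sum>p\<in>S. (norm (v p))\<^sup>2)"
    by (simp add: sum.distrib sum_distrib_left)
  then show thesis using that 1 by blast
qed

subsection \<open>Completely multiplicative test sequences\<close>

text \<open>The value 0 at 0 preserves full multiplicativity, which the empty product would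
  destroy.\<close>

definition cmult :: "(nat \<Rightarrow> complex) \<Rightarrow> nat \<Rightarrow> complex" where
  "cmult f n = (if n = 0 then 0 else (\<Prod>p\<in>#prime_factorization n. f p))"

lemma cmult_mult: "cmult f (m * n) = cmult f m * cmult f n"
  by (simp add: cmult_def prime_factorization_mult)

lemma cmult_1 [simp]: "cmult f 1 = 1" "cmult f (Suc 0) = 1"
  by (simp_all add: cmult_def)

lemma cmult_0 [simp]: "cmult f 0 = 0"
  by (simp add: cmult_def)

lemma cmult_prime: "prime p \<Longrightarrow> cmult f p = f p"
  by (auto simp: cmult_def prime_factorization_prime)

lemma cmult_cong: "(\<And>p. prime p \<Longrightarrow> p dvd n \<Longrightarrow> f p = g p) \<Longrightarrow> cmult f n = cmult g n"
  unfolding cmult_def by (auto intro!: arg_cong [of _ _ prod_mset] image_mset_cong)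

lemma cmult_eq:
  assumes "h 1 = 1" "\<And>m n. h (m * n) = h m * h n" "n > 0"
  shows "cmult h n = h n"
  using assms(3)
proof (induction n rule: prime_divisors_induct)
  case (factor p x)
  then show ?case by (auto simp: cmult_mult cmult_prime assms)
qed (use assms in auto)

text \<open>Split a partial sum of squares by divisibility by \<open>p\<close>. The part prime to
  \<open>p\<close> is controlled by \<open>g\<close>, and the rest is at most
  \<open>norm (f p) ^ 2\<close> times the same partial sum; since this factor is below 1, the
  inequality can be solved for the partial sum.\<close>

lemma l2_cmult_change:
  assumes p: "prime p" "norm (f p) < 1" and fg: "\<And>r. r \<noteq> p \<Longrightarrow> f r = g r" and g: "l2 (cmult g)"
  shows "l2 (cmult f)"
proof -
  define u where "u n = (norm (cmult f n))\<^sup>2" for n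
  define v where "v n = (norm (cmult g n))\<^sup>2" for n
  have u0: "u n \<ge> 0" "v n \<ge> 0" for n by (simp_all add: u_def v_def)
  have sv: "summable v" using g unfolding l2_def v_def .
  have p0: "p > 0" using p prime_gt_0_nat by blast
  have up: "u p < 1" using p by (simp add: u_def cmult_prime power_less_one_iff)
  have um: "u (p * n) = u p * u n" for n by (simp add: u_def cmult_mult norm_mult power_mult_distrib)
  have uv: "u n = v n" if "\<not> p dvd n" for n
    unfolding u_def v_def by (intro arg_cong [of _ _ "\<lambda>x. (norm x)\<^sup>2"] cmult_cong fg) (use that in auto)
  have "(\<Sum>n<M. u n) \<le> suminf v / (1 - u p)" for M
  proof -
    have "(\<Sum>n<M. u n) = (\<Sum>n<M. if p dvd n then 0 else u n) + (\<Sum>n<M. if p dvd n then u n else 0)"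
      unfolding sum.distrib [symmetric] by (intro sum.cong) auto
    also have "(\<Sum>n<M. if p dvd n then 0 else u n) \<le> (\<Sum>n<M. v n)"
      using uv u0 by (intro sum_mono) auto
    also have "(\<Sum>n<M. v n) \<le> suminf v" using sv u0 by (intro sum_le_suminf) auto
    also have "(\<Sum>n<M. if p dvd n then u n else 0) = (\<Sum>n | n \<in> {..<M} \<and> p dvd n. u n)"
      by (rule sum.inter_filter [symmetric]) simp
    also have "\<dots> \<le> (\<Sum>n\<in>(\<lambda>m. p * m) ` {..<M}. u n)"
    proof (rule sum_mono2)
      show "{n. n \<in> {..<M} \<and> p dvd n} \<subseteq> (\<lambda>m. p * m) ` {..<M}"
      proof (rule subsetI)
        fix n assume n: "n \<in> {n. n \<in> {..<M} \<and> p dvd n}"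
        then obtain m where m: "n = p * m" by auto
        then have "m \<le> n" using p0 by simp
        then have "m \<in> {..<M}" using n by simp
        then show "n \<in> (\<lambda>m. p * m) ` {..<M}" using m by (rule rev_image_eqI)
      qed
    qed (use u0 in auto)
    also have "\<dots> = (\<Sum>m<M. u (p * m))" using p0 by (subst sum.reindex) (auto simp: inj_on_def)
    also have "\<dots> = u p * (\<Sum>m<M. u m)" by (simp add: um sum_distrib_left)
    finally have "(\<Sum>n<M. u n) * (1 - u p) \<le> suminf v" by (simp add: algebra_simps)
    then show ?thesis using up by (simp add: pos_le_divide_eq)
  qed
  note * = this
  have "summable u"
  proof (rule bounded_imp_summable)
    show "0 \<le> u n" for n by (rule u0)
    show "(\<Sum>k\<le>n. u k) \<le> suminf v / (1 - u p)" for n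
      using * [of "Suc n"] by (simp only: lessThan_Suc_atMost)
  qed
  then show ?thesis unfolding l2_def u_def .
qed

lemma l2_cmult_change_finite:
  assumes "finite S" "\<And>p. p \<in> S \<Longrightarrow> prime p \<and> norm (h p) < 1" "l2 (cmult g)"
  shows "l2 (cmult (\<lambda>p. if p \<in> S then h p else g p))"
  using assms(1,2)
proof (induction S rule: finite_induct)
  case empty
  then show ?case using assms(3) by simp
next
  case (insert p S)
  show ?case
  proof (rule l2_cmult_change [where p = p and g = "\<lambda>p. if p \<in> S then h p else g p"])
    show "l2 (cmult (\<lambda>p. if p \<in> S then h p else g p))" using insert by blast
  qed (use insert.prems in auto)
qed

text \<open>Multiples of \<open>p\<close> contribute \<open>\<kappa> * f p\<close> times the whole
  sum. Removing them leaves a sum over \<open>n\<close> prime to \<open>p\<close>, on which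
  \<open>cmult f\<close> and \<open>cmult g\<close> agree.\<close>

lemma euler_step:
  assumes p: "prime p" and a: "\<And>n. a (p * n) = \<kappa> * a n"
    and fg: "\<And>r. r \<noteq> p \<Longrightarrow> f r = g r" and l2: "l2 a" "l2 (cmult f)" "l2 (cmult g)"
  shows "(\<Sum>n. a n * cmult f n) * (1 - \<kappa> * f p) = (\<Sum>n. a n * cmult g n) * (1 - \<kappa> * g p)"
proof -
  have p0: "p > 0" using p prime_gt_0_nat by blast
  have main: "(\<Sum>n. a n * cmult f n) * (1 - \<kappa> * f p) = (\<Sum>n. if p dvd n then 0 else a n * cmult f n)"
    if "l2 (cmult f)" for f
  proof -
    define t where "t n = a n * cmult f n" for n
    have st: "summable t" unfolding t_def using l2(1) that by (rule l2_inner)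
    have tp: "t (p * n) = \<kappa> * f p * t n" for n
      by (simp add: t_def a cmult_mult cmult_prime [OF p])
    define t1 where "t1 n = (if p dvd n then t n else 0)" for n
    have t1p: "t1 (p * n) = \<kappa> * f p * t n" for n by (simp add: t1_def tp)
    have t1z: "t1 n = 0" if "\<not> p dvd n" for n using that by (simp add: t1_def)
    have "summable (\<lambda>n. t1 (p * n))" unfolding t1p using st by (rule summable_mult)
    then have s1: "summable t1" using dil_reindex(1) [of p t1, OF p0 t1z] by blast
    have "suminf t1 = (\<Sum>n. t1 (p * n))" by (rule dil_reindex(2) [OF p0 t1z])
    also have "\<dots> = \<kappa> * f p * suminf t" using st by (simp add: t1p suminf_mult)
    finally have "suminf t1 = \<kappa> * f p * suminf t" .
    moreover have "(\<Sum>n. if p dvd n then 0 else t n) = suminf t - suminf t1"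
      by (subst suminf_diff [OF st s1]) (auto simp: t1_def intro!: suminf_cong)
    ultimately have "suminf t * (1 - \<kappa> * f p) = (\<Sum>n. if p dvd n then 0 else t n)" by (simp add: algebra_simps)
    then show ?thesis unfolding t_def .
  qed
  have "cmult f n = cmult g n" if "\<not> p dvd n" for n
    by (intro cmult_cong fg) (use that in auto)
  then have "(\<Sum>n. if p dvd n then 0 else a n * cmult f n) = (\<Sum>n. if p dvd n then 0 else a n * cmult g n)"
    by (intro suminf_cong) auto
  then show ?thesis using main l2 by metis
qed

lemma euler_finite:
  assumes "finite S" "\<And>p. p \<in> S \<Longrightarrow> prime p" "\<And>p n. p \<in> S \<Longrightarrow> a (p * n) = \<kappa> p * a n"
    and "l2 a" "l2 (cmult g)" "norm z < 1"
  shows "(\<Sum>n. a n * cmult (\<lambda>p. if p \<in> S then z else g p) n) * (\<Prod>p\<in>S. 1 - \<kappa> p * z) =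
    (\<Sum>n. a n * cmult g n) * (\<Prod>p\<in>S. 1 - \<kappa> p * g p)"
  using assms(1,2,3)
proof (induction S rule: finite_induct)
  case (insert r S)
  let ?f = "\<lambda>S p. if p \<in> S then z else g p"
  have l2S: "l2 (cmult (?f T))" if "finite T" "\<And>p. p \<in> T \<Longrightarrow> prime p" for T
    using that assms by (intro l2_cmult_change_finite) auto
  have step: "(\<Sum>n. a n * cmult (?f (insert r S)) n) * (1 - \<kappa> r * ?f (insert r S) r) =
      (\<Sum>n. a n * cmult (?f S) n) * (1 - \<kappa> r * ?f S r)"
    using insert assms by (intro euler_step l2S) auto
  have "(\<Sum>n. a n * cmult (?f (insert r S)) n) * (\<Prod>p\<in>insert r S. 1 - \<kappa> p * z) =
      ((\<Sum>n. a n * cmult (?f (insert r S)) n) * (1 - \<kappa> r * ?f (insert r S) r)) * (\<Prod>p\<in>S. 1 - \<kappa> p * z)"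
    using insert.hyps by (simp add: mult_ac)
  also have "\<dots> = ((\<Sum>n. a n * cmult (?f S) n) * (\<Prod>p\<in>S. 1 - \<kappa> p * z)) * (1 - \<kappa> r * g r)"
    unfolding step using insert.hyps by (simp add: mult_ac)
  also have "(\<Sum>n. a n * cmult (?f S) n) * (\<Prod>p\<in>S. 1 - \<kappa> p * z) = (\<Sum>n. a n * cmult g n) * (\<Prod>p\<in>S. 1 - \<kappa> p * g p)"
    using insert by auto
  finally show ?case using insert.hyps by (simp add: mult_ac)
qed simp

subsection \<open>Exponential sums as limits of finite Euler products\<close>

text \<open>Choose finite sets of ever larger admissible \<open>p\<close> whose reciprocals have sum
  \<open>R\<close> tending to infinity, and put the weight \<open>w / R\<close> on them. The
  denominators then multiply to \<open>exp (- \<zeta> j * w)\<close> in the limit, the numerators,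
  which remove the background Euler factors, multiply to 1, and Hurwitz's theorem passes the absence
  of zeros to the limit.\<close>

lemma zero_free_exponential_sum:
  fixes A \<zeta> :: "nat \<Rightarrow> complex" and P :: "nat \<Rightarrow> bool"
  assumes \<zeta>: "\<And>j. j < k \<Longrightarrow> norm (\<zeta> j) \<le> 1"
    and s: "s \<ge> 1"
    and nonzero: "\<And>S z. finite S \<Longrightarrow> (\<And>p. p \<in> S \<Longrightarrow> P p) \<Longrightarrow> norm z < 1 \<Longrightarrow>
      (\<Sum>j<k. A j * (\<Prod>p\<in>S. (1 - \<zeta> j / of_nat p ^ Suc s) / (1 - \<zeta> j * z / of_nat p))) \<noteq> 0"
    and nonsum: "\<not> summable (\<lambda>p. if P p then 1 / real p else 0)"
    and A0: "(\<Sum>j<k. A j) \<noteq> 0"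
  shows "(\<Sum>j<k. A j * exp (\<zeta> j * w)) \<noteq> 0"
proof -
  have sq: "summable (\<lambda>n. 1 / (real n)\<^sup>2)" using inverse_power_summable [of 2] by (simp add: inverse_eq_divide)
  have "\<exists>S. finite S \<and> (\<forall>p\<in>S. P p \<and> p \<ge> l + 2) \<and> (\<Sum>p\<in>S. 1 / real p) \<ge> real l + 1" for l
  proof (rule ccontr)
    assume neg: "\<not> ?thesis"
    define L where "L = l + 2"
    define x where "x i = (if P (i + L) then 1 / real (i + L) else 0)" for i
    have "(\<Sum>i\<le>M. x i) \<le> real l + 1" for M
    proof -
      define S where "S = {p \<in> (\<lambda>i. i + L) ` {..M}. P p}"
      have "(\<Sum>i\<le>M. x i) = (\<Sum>p\<in>(\<lambda>i. i + L) ` {..M}. if P p then 1 / real p else 0)"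
        unfolding x_def by (subst sum.reindex) (auto simp: inj_on_def)
      also have "\<dots> = (\<Sum>p\<in>S. 1 / real p)" unfolding S_def by (rule sum.inter_filter [symmetric]) simp
      finally have eq: "(\<Sum>i\<le>M. x i) = (\<Sum>p\<in>S. 1 / real p)" .
      have "finite S \<and> (\<forall>p\<in>S. P p \<and> p \<ge> l + 2)" by (auto simp: S_def L_def)
      then have "\<not> (\<Sum>p\<in>S. 1 / real p) \<ge> real l + 1" using neg by blast
      then show ?thesis using eq by simp
    qed
    then have "summable x" by (intro bounded_imp_summable [where B = "real l + 1"]) (auto simp: x_def)
    then show False using nonsum summable_iff_shift [of "\<lambda>p. if P p then 1 / real p else 0" L] unfolding x_def by blast
  qed
  then obtain S where S: "\<And>l. finite (S l)" "\<And>l p. p \<in> S l \<Longrightarrow> P p" "\<And>l p. p \<in> S l \<Longrightarrow> p \<ge> l + 2"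
    "\<And>l. (\<Sum>p\<in>S l. 1 / real p) \<ge> real l + 1" by metis
  define R where "R l = (\<Sum>p\<in>S l. 1 / real p)" for l
  have R: "R l \<ge> real l + 1" "R l > 0" for l using S(4) [of l] by (auto simp: R_def)
  have R0: "R l \<noteq> 0" for l using R(2) [of l] by simp
  have Sp: "0 < p" if "p \<in> S l" for p l using S(3) [OF that] by simp
  define G where "G w = (\<Sum>j<k. A j * exp (\<zeta> j * w))" for w
  define F where "F l w = (\<Sum>j<k. A j * (\<Prod>p\<in>S l. (1 - \<zeta> j / of_nat p ^ Suc s) / (1 - \<zeta> j * (w / of_real (R l)) / of_nat p)))" for l w
  define \<rho> where "\<rho> = norm w + 1"
  have \<rho>: "\<rho> > 0" by (simp add: \<rho>_def add_nonneg_pos)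
  obtain m where m: "real m > \<rho>" using reals_Archimedean2 by blast
  have vsmall: "norm (\<zeta> j * (x / of_real (R (n + m))) / of_nat p) \<le> \<rho> / R (n + m) / real p \<and>
      norm (\<zeta> j * (x / of_real (R (n + m))) / of_nat p) < 1 / 2"
    if "norm x < \<rho>" "j < k" "p \<in> S (n + m)" for x j p n
  proof -
    have Rm: "R (n + m) > \<rho>" using R(1) [of "n + m"] m by simp
    have p2: "real p \<ge> 2" using S(3) [OF that(3)] by simp
    have "norm (\<zeta> j) * norm x \<le> 1 * \<rho>" using \<zeta> that by (intro mult_mono) auto
    then have 1: "norm (\<zeta> j) * norm x / R (n + m) / real p \<le> \<rho> / R (n + m) / real p"
      using R p2 by (intro divide_right_mono) (auto simp: less_imp_le)
    have "\<rho> / R (n + m) < 1" using Rm \<rho> by simp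
    then have "\<rho> / R (n + m) / real p < 1 / real p" using p2 by (intro divide_strict_right_mono) auto
    also have "\<dots> \<le> 1 / 2" using p2 by (simp add: frac_le)
    finally have 2: "\<rho> / R (n + m) / real p < 1 / 2" .
    have "norm (\<zeta> j * (x / of_real (R (n + m))) / of_nat p) = norm (\<zeta> j) * norm x / R (n + m) / real p"
      using R(2) [of "n + m"] by (simp add: norm_mult norm_divide)
    then show ?thesis using 1 2 by linarith
  qed
  have usmall: "norm (\<zeta> j / of_nat p ^ Suc s) \<le> 1 / (real p)\<^sup>2 \<and> norm (\<zeta> j / of_nat p ^ Suc s) < 1 / 2"
    if "j < k" "p \<in> S l" for j p l
  proof -
    have p2: "real p \<ge> 2" using S(3) [OF that(2)] by simp
    have "(real p)\<^sup>2 \<le> real p ^ Suc s" using p2 s by (intro power_increasing) auto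
    then have "norm (\<zeta> j / of_nat p ^ Suc s) \<le> 1 / (real p)\<^sup>2"
      using \<zeta> [OF that(1)] p2 unfolding norm_divide norm_power norm_of_nat by (intro frac_le) auto
    moreover have "(2::real)\<^sup>2 \<le> (real p)\<^sup>2" using p2 by (intro power_mono) auto
    then have "1 / (real p)\<^sup>2 \<le> 1 / 4" by (intro frac_le) auto
    ultimately show ?thesis by linarith
  qed
  have "G w \<noteq> 0"
  \<comment> \<open>Hurwitz's theorem excludes constant limits; a constant \<open>G\<close> has the
    value \<open>G 0\<close>, which \<open>A0\<close> makes nonzero.\<close>
  proof (cases "G constant_on ball 0 \<rho>")
    case True
    have "G w = G 0" using True \<rho> unfolding constant_on_def by (auto simp: \<rho>_def)
    then show ?thesis using A0 by (simp add: G_def)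
  next
    case False
    show ?thesis
    proof (rule Hurwitz_no_zeros [of "ball 0 \<rho>" "\<lambda>n. F (n + m)" G])
      show "F (n + m) holomorphic_on ball 0 \<rho>" for n
        unfolding F_def
      proof (intro holomorphic_intros)
        fix j p and x :: complex assume "j \<in> {..<k}" "p \<in> S (n + m)" "x \<in> ball 0 \<rho>"
        then have "norm (\<zeta> j * (x / of_real (R (n + m))) / of_nat p) < 1 / 2" using vsmall by auto
        then show "1 - \<zeta> j * (x / of_real (R (n + m))) / of_nat p \<noteq> 0" by auto
      qed (use R0 Sp in auto)
      show "G holomorphic_on ball 0 \<rho>" unfolding G_def by (intro holomorphic_intros)
      show "F (n + m) x \<noteq> 0" if "x \<in> ball 0 \<rho>" for n x
      proof -
        have "norm (x / of_real (R (n + m))) < 1"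
          using that R(1) [of "n + m"] m R(2) [of "n + m"] by (simp add: norm_divide)
        then show ?thesis unfolding F_def using S by (intro nonzero) auto
      qed
      show "w \<in> ball 0 \<rho>" by (simp add: \<rho>_def)
      fix C :: "complex set" assume C: "compact C" "C \<subseteq> ball 0 \<rho>"
      show "uniform_limit C (\<lambda>n. F (n + m)) G sequentially"
        unfolding uniform_limit_sequentially_iff
      proof (intro allI impI)
        fix e :: real assume e: "e > 0"
        define D where "D = (\<Sum>j<k. norm (A j)) + 1"
        have D: "D > 0" unfolding D_def by (intro add_nonneg_pos sum_nonneg) auto
        have "e / (D * exp \<rho>) > 0" using e D by simp
        moreover have "isCont (exp :: complex \<Rightarrow> complex) 0" by (intro continuous_intros)
        ultimately have "\<exists>d>0. \<forall>x::complex. norm (x - 0) < d \<longrightarrow> norm (exp x - exp 0) < e / (D * exp \<rho>)"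
          unfolding continuous_at_eps_delta dist_norm by blast
        then obtain d where d: "d > 0" "\<And>x::complex. norm x < d \<Longrightarrow> norm (exp x - 1) < e / (D * exp \<rho>)" by auto
        obtain n1 where n1: "\<And>n. n \<ge> n1 \<Longrightarrow> norm (\<Sum>i. 1 / (real (i + n))\<^sup>2) < d / 4"
          using suminf_exist_split [OF _ sq, of "d / 4"] d(1) by auto
        obtain n2 where n2: "real n2 > 4 * \<rho>\<^sup>2 / d" using reals_Archimedean2 by blast
        show "\<exists>N. \<forall>n\<ge>N. \<forall>x\<in>C. dist (F (n + m) x) (G x) < e"
        proof (intro exI allI impI ballI)
          fix n x assume n: "max n1 n2 \<le> n" and "x \<in> C"
          then have x: "norm x < \<rho>" using C by auto
          let ?l = "n + m"
          have term_: "norm ((\<Prod>p\<in>S ?l. (1 - \<zeta> j / of_nat p ^ Suc s) / (1 - \<zeta> j * (x / of_real (R ?l)) / of_nat p)) - exp (\<zeta> j * x))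
              \<le> exp \<rho> * (e / (D * exp \<rho>))" if j: "j < k" for j
          proof -
            let ?u = "\<lambda>p. \<zeta> j / of_nat p ^ Suc s" and ?v = "\<lambda>p. \<zeta> j * (x / of_real (R ?l)) / of_nat p"
            obtain er where er: "(\<Prod>p\<in>S ?l. (1 - ?u p) / (1 - ?v p)) = exp ((\<Sum>p\<in>S ?l. ?v p) + er)"
              "norm er \<le> 2 * (\<Sum>p\<in>S ?l. norm (?u p)) + 2 * (\<Sum>p\<in>S ?l. (norm (?v p))\<^sup>2)"
              using exp_product_estimate [of "S ?l" ?u ?v] usmall [OF j] vsmall [OF x j] S(1) by blast
            have sv: "(\<Sum>p\<in>S ?l. ?v p) = \<zeta> j * x"
            proof -
              have "(\<Sum>p\<in>S ?l. ?v p) = \<zeta> j * (x / of_real (R ?l)) * of_real (\<Sum>p\<in>S ?l. 1 / real p)"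
                by (simp add: sum_distrib_left)
              then show ?thesis using R(2) [of ?l] by (simp add: R_def [symmetric])
            qed
            have "(\<Sum>p\<in>S ?l. norm (?u p)) \<le> (\<Sum>p\<in>S ?l. 1 / (real p)\<^sup>2)" using usmall [OF j] by (intro sum_mono) blast
            also have "\<dots> = (\<Sum>i\<in>(\<lambda>p. p - ?l) ` S ?l. 1 / (real (i + ?l))\<^sup>2)"
            proof (subst sum.reindex)
              have ge: "p \<ge> ?l" if "p \<in> S ?l" for p using S(3) [OF that] by simp
              show "inj_on (\<lambda>p. p - ?l) (S ?l)" using ge by (auto simp: inj_on_def) (metis le_add_diff_inverse2)
              show "(\<Sum>p\<in>S ?l. 1 / (real p)\<^sup>2) = (\<Sum>p\<in>S ?l. ((\<lambda>i. 1 / (real (i + ?l))\<^sup>2) \<circ> (\<lambda>p. p - ?l)) p)"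
                using ge by (intro sum.cong refl) (simp only: comp_def le_add_diff_inverse2)
            qed
            also have "\<dots> \<le> (\<Sum>i. 1 / (real (i + ?l))\<^sup>2)"
              using S(1) sq summable_iff_shift [of "\<lambda>n. 1 / (real n)\<^sup>2" ?l] by (intro sum_le_suminf) auto
            also have "\<dots> < d / 4" using n1 [of ?l] n by simp
            finally have 1: "2 * (\<Sum>p\<in>S ?l. norm (?u p)) < d / 2" by simp
            have "(\<Sum>p\<in>S ?l. (norm (?v p))\<^sup>2) \<le> (\<Sum>p\<in>S ?l. \<rho> / R ?l * (\<rho> / R ?l / real p))"
            proof (rule sum_mono)
              fix p assume p: "p \<in> S ?l"
              have b: "norm (?v p) \<le> \<rho> / R ?l / real p" using vsmall [OF x j p] by blast
              have "real p \<ge> 1" using S(3) [OF p] by simp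
              then have "\<rho> / R ?l / real p \<le> \<rho> / R ?l / 1"
                using \<rho> R(2) [of ?l] by (intro divide_left_mono) auto
              then have "norm (?v p) \<le> \<rho> / R ?l" using b by simp
              then show "(norm (?v p))\<^sup>2 \<le> \<rho> / R ?l * (\<rho> / R ?l / real p)"
                unfolding power2_eq_square using b \<rho> R(2) [of ?l] by (intro mult_mono) auto
            qed
            also have "\<dots> = \<rho> / R ?l * (\<rho> / R ?l) * (\<Sum>p\<in>S ?l. 1 / real p)"
              unfolding sum_distrib_left by (intro sum.cong) (auto simp: mult.assoc)
            also have "\<dots> = \<rho>\<^sup>2 / R ?l"
              unfolding R_def [of ?l, symmetric] using R(2) [of ?l] by (simp add: power2_eq_square)
            also have "\<dots> \<le> \<rho>\<^sup>2 / real ?l"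
              using R(1) [of ?l] m \<rho> by (intro divide_left_mono) auto
            also have "\<dots> < d / 4"
            proof -
              have "4 * \<rho>\<^sup>2 / d < real ?l" using n2 n by linarith
              moreover have "real ?l > 0" using m \<rho> by simp
              ultimately show ?thesis using d(1) by (simp add: field_simps)
            qed
            finally have 2: "2 * (\<Sum>p\<in>S ?l. (norm (?v p))\<^sup>2) < d / 2" by simp
            have "norm er < d" using er(2) 1 2 by linarith
            then have ee: "norm (exp er - 1) < e / (D * exp \<rho>)" by (rule d)
            have "norm (\<zeta> j * x) \<le> 1 * \<rho>" unfolding norm_mult using \<zeta> [OF j] x by (intro mult_mono) auto
            then have "Re (\<zeta> j * x) \<le> \<rho>" using complex_Re_le_cmod [of "\<zeta> j * x"] by linarith
            then have "norm (exp (\<zeta> j * x)) \<le> exp \<rho>" by (simp only: norm_exp_eq_Re exp_le_cancel_iff)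
            have "exp (\<zeta> j * x + er) - exp (\<zeta> j * x) = exp (\<zeta> j * x) * (exp er - 1)"
              by (simp add: exp_add algebra_simps)
            then have "norm (exp (\<zeta> j * x + er) - exp (\<zeta> j * x)) = norm (exp (\<zeta> j * x)) * norm (exp er - 1)"
              by (simp only: norm_mult)
            also have "\<dots> \<le> exp \<rho> * (e / (D * exp \<rho>))"
              using \<open>norm (exp (\<zeta> j * x)) \<le> exp \<rho>\<close> ee by (intro mult_mono) auto
            finally show ?thesis unfolding er(1) sv .
          qed
          have "norm (F ?l x - G x) \<le> (\<Sum>j<k. norm (A j) * (exp \<rho> * (e / (D * exp \<rho>))))"
            unfolding F_def G_def sum_subtractf [symmetric] right_diff_distrib [symmetric]
          proof (rule sum_norm_le)
            fix j assume "j \<in> {..<k}"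
            then show "norm (A j * ((\<Prod>p\<in>S ?l. (1 - \<zeta> j / of_nat p ^ Suc s) / (1 - \<zeta> j * (x / of_real (R ?l)) / of_nat p)) - exp (\<zeta> j * x)))
                \<le> norm (A j) * (exp \<rho> * (e / (D * exp \<rho>)))"
              unfolding norm_mult by (intro mult_left_mono term_) auto
          qed
          also have "\<dots> = (\<Sum>j<k. norm (A j)) * (e / D)" unfolding sum_distrib_right [symmetric] by simp
          also have "\<dots> < D * (e / D)" using e D by (intro mult_strict_right_mono) (auto simp: D_def)
          finally show "dist (F ?l x) (G x) < e" using D by (simp add: dist_norm)
        qed
      qed
    qed (use False in auto)
  qed
  then show ?thesis by (simp add: G_def)
qed

text \<open>The sum equals \<open>G 0 * exp (\<alpha> * w)\<close>, so its derivative is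
  \<open>\<alpha>\<close> times itself, and the higher derivatives at 0 compare moments. In this
  form coinciding frequencies and vanishing coefficients need no separate treatment.\<close>

lemma zero_free_exponential_sum_ratio:
  fixes A \<zeta> :: "nat \<Rightarrow> complex"
  assumes \<zeta>: "\<And>j. j < k \<Longrightarrow> norm (\<zeta> j) \<le> 1"
    and nz: "\<And>w. (\<Sum>j<k. A j * exp (\<zeta> j * w)) \<noteq> 0"
  obtains \<alpha> where "\<And>i. (\<Sum>j<k. A j * \<zeta> j ^ Suc i) = \<alpha> * (\<Sum>j<k. A j * \<zeta> j ^ i)"
proof -
  define G where "G w = (\<Sum>j<k. A j * exp (\<zeta> j * w))" for w
  have "G holomorphic_on UNIV" unfolding G_def by (intro holomorphic_intros)
  moreover have "G w \<noteq> 0" for w using nz by (simp add: G_def)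
  moreover have "norm (G w) \<le> (\<Sum>j<k. norm (A j)) * exp (norm w)" for w
    unfolding G_def sum_distrib_right
  proof (rule sum_norm_le)
    fix j assume "j \<in> {..<k}"
    then have "norm (\<zeta> j * w) \<le> 1 * norm w" unfolding norm_mult using \<zeta> by (intro mult_right_mono) auto
    then have "Re (\<zeta> j * w) \<le> norm w" using complex_Re_le_cmod [of "\<zeta> j * w"] by linarith
    then have "norm (exp (\<zeta> j * w)) \<le> exp (norm w)" by (simp only: norm_exp_eq_Re exp_le_cancel_iff)
    then show "norm (A j * exp (\<zeta> j * w)) \<le> norm (A j) * exp (norm w)"
      unfolding norm_mult by (intro mult_left_mono) auto
  qed
  ultimately obtain \<alpha> where \<alpha>: "\<And>w. G w = G 0 * exp (\<alpha> * w)"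
    using zero_free_exponential_type [of G] by metis
  have Geq: "(\<lambda>w. G 0 * exp (\<alpha> * w)) = G" by (rule ext) (rule \<alpha> [symmetric])
  have zero: "(\<Sum>j<k. A j * (\<zeta> j - \<alpha>) * \<zeta> j ^ i * exp (\<zeta> j * w)) = 0" for i w
  proof (induction i arbitrary: w)
    case 0
    have "(G has_field_derivative (\<Sum>j<k. A j * (exp (\<zeta> j * w) * \<zeta> j))) (at w)"
      unfolding G_def by (auto intro!: derivative_eq_intros simp: mult_ac)
    moreover have "((\<lambda>w. G 0 * exp (\<alpha> * w)) has_field_derivative (\<alpha> * (G 0 * exp (\<alpha> * w)))) (at w)"
      by (auto intro!: derivative_eq_intros simp: mult_ac)
    then have "(G has_field_derivative (\<alpha> * (G 0 * exp (\<alpha> * w)))) (at w)" unfolding Geq .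
    ultimately have "(\<Sum>j<k. A j * (exp (\<zeta> j * w) * \<zeta> j)) = \<alpha> * (G 0 * exp (\<alpha> * w))" by (rule DERIV_unique)
    then have "(\<Sum>j<k. A j * (exp (\<zeta> j * w) * \<zeta> j)) = \<alpha> * G w" unfolding \<alpha> [of w, symmetric] .
    then show ?case by (simp add: G_def sum_distrib_left algebra_simps sum_subtractf)
  next
    case (Suc i)
    have "((\<lambda>w. \<Sum>j<k. A j * (\<zeta> j - \<alpha>) * \<zeta> j ^ i * exp (\<zeta> j * w)) has_field_derivative
        (\<Sum>j<k. A j * (\<zeta> j - \<alpha>) * \<zeta> j ^ i * (exp (\<zeta> j * w) * \<zeta> j))) (at w)"
      by (auto intro!: derivative_eq_intros simp: mult_ac)
    moreover have "((\<lambda>w. \<Sum>j<k. A j * (\<zeta> j - \<alpha>) * \<zeta> j ^ i * exp (\<zeta> j * w)) has_field_derivative 0) (at w)"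
      using Suc by simp
    ultimately have "(\<Sum>j<k. A j * (\<zeta> j - \<alpha>) * \<zeta> j ^ i * (exp (\<zeta> j * w) * \<zeta> j)) = 0" by (rule DERIV_unique)
    then show ?case by (simp add: mult_ac)
  qed
  have "(\<Sum>j<k. A j * \<zeta> j ^ Suc i) = \<alpha> * (\<Sum>j<k. A j * \<zeta> j ^ i)" for i
    using zero [of i 0] by (simp add: sum_distrib_left algebra_simps sum_subtractf)
  then show thesis using that by blast
qed

subsection \<open>Cyclic periodic sequences are multiplicative characters\<close>

text \<open>The first nonzero coefficient, at \<open>n0\<close>, would dominate: compared with its
  term the tail is of order \<open>(n0 / (n0 + 1)) ^ s\<close>. Exponents from an infinite set
  suffice, which is all that the pigeonhole argument below provides.\<close>

lemma dirichlet_series_unique: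
  fixes d :: "nat \<Rightarrow> complex"
  assumes bound: "\<And>n. norm (d n) \<le> D" and T: "infinite T"
    and zero: "\<And>s. s \<in> T \<Longrightarrow> (\<Sum>n. d n / of_nat n * (1 / of_nat n ^ s)) = 0" and "n \<ge> 1"
  shows "d n = 0"
proof (rule ccontr)
  assume "d n \<noteq> 0"
  then have ex: "\<exists>n. n \<ge> 1 \<and> d n \<noteq> 0" using \<open>n \<ge> 1\<close> by blast
  define n0 where "n0 = (LEAST n. n \<ge> 1 \<and> d n \<noteq> 0)"
  have n0: "n0 \<ge> 1" "d n0 \<noteq> 0" using LeastI_ex [OF ex] unfolding n0_def by auto
  have least: "d m = 0" if "m \<ge> 1" "m < n0" for m using not_less_Least [of m "\<lambda>n. n \<ge> 1 \<and> d n \<noteq> 0"] that unfolding n0_def by auto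
  have D: "D \<ge> 0" using order_trans [OF norm_ge_zero bound] .
  have sq: "summable (\<lambda>n. 1 / (real n)\<^sup>2)" using inverse_power_summable [of 2] by (simp add: inverse_eq_divide)
  define Z where "Z = (\<Sum>i. 1 / (real (i + Suc n0))\<^sup>2)"
  have sqs: "summable (\<lambda>i. 1 / (real (i + Suc n0))\<^sup>2)"
    using summable_iff_shift [of "\<lambda>n. 1 / (real n)\<^sup>2" "Suc n0"] sq by simp
  define r where "r = real n0 / real (Suc n0)"
  have r: "0 < r" "r < 1" using n0 by (auto simp: r_def)
  define C where "C = D * Z * (real n0)\<^sup>2"
  have main: "norm (d n0) \<le> C * r ^ (s - 1)" if s: "s \<in> T" "s \<ge> 1" for s
  proof -
    define f where "f n = d n / of_nat n * (1 / of_nat n ^ s)" for n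
    have fn: "norm (f n) = norm (d n) / real n ^ Suc s" for n by (simp add: f_def norm_divide norm_mult norm_power)
    have fb: "norm (f (i + Suc n0)) \<le> D / real (Suc n0) ^ (s - 1) * (1 / (real (i + Suc n0))\<^sup>2)" for i
    proof -
      let ?x = "real (i + Suc n0)"
      \<comment> \<open>Two powers are kept back to make the tail converge; the others give the
        geometric decay in \<open>s\<close>.\<close>
      have "?x ^ Suc s = ?x ^ (s - 1) * ?x\<^sup>2" using s by (simp flip: power_add)
      moreover have "real (Suc n0) ^ (s - 1) \<le> ?x ^ (s - 1)" by (intro power_mono) auto
      ultimately have le: "real (Suc n0) ^ (s - 1) * ?x\<^sup>2 \<le> ?x ^ Suc s" by (simp add: mult_right_mono del: of_nat_add of_nat_Suc)
      have "norm (f (i + Suc n0)) \<le> D / (real (Suc n0) ^ (s - 1) * ?x\<^sup>2)"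
        unfolding fn using le bound D by (intro frac_le) (auto simp del: of_nat_add of_nat_Suc)
      then show ?thesis by simp
    qed
    have sf: "summable (\<lambda>i. norm (f (i + Suc n0)))"
      by (rule summable_comparison_test' [OF summable_mult [OF sqs, of "D / real (Suc n0) ^ (s - 1)"], of 0]) (use fb in simp)
    have sumf: "summable f" using summable_norm_cancel [OF sf] summable_iff_shift by blast
    have "0 = suminf f" using zero [OF s(1)] by (simp add: f_def [abs_def])
    also have "\<dots> = (\<Sum>i. f (i + Suc n0)) + (\<Sum>i<Suc n0. f i)" by (rule suminf_split_initial_segment [OF sumf])
    also have "(\<Sum>i<Suc n0. f i) = (\<Sum>i\<in>{n0}. f i)"
    proof (rule sum.mono_neutral_right)
      show "\<forall>i\<in>{..<Suc n0} - {n0}. f i = 0"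
      proof
        fix i assume "i \<in> {..<Suc n0} - {n0}"
        then have "i < n0" by auto
        then show "f i = 0" using least [of i] by (cases "i = 0") (auto simp: f_def)
      qed
    qed auto
    finally have "f n0 = - (\<Sum>i. f (i + Suc n0))" by (simp add: eq_neg_iff_add_eq_0 add.commute)
    then have "norm (f n0) = norm (\<Sum>i. f (i + Suc n0))" by simp
    also have "\<dots> \<le> (\<Sum>i. norm (f (i + Suc n0)))" by (rule summable_norm [OF sf])
    also have "\<dots> \<le> (\<Sum>i. D / real (Suc n0) ^ (s - 1) * (1 / (real (i + Suc n0))\<^sup>2))"
      by (intro suminf_le fb sf summable_mult sqs)
    also have "\<dots> = D / real (Suc n0) ^ (s - 1) * Z" unfolding Z_def by (rule suminf_mult [OF sqs])
    finally have "norm (d n0) / real n0 ^ Suc s \<le> D * Z / real (Suc n0) ^ (s - 1)" unfolding fn by simp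
    then have "norm (d n0) \<le> D * Z / real (Suc n0) ^ (s - 1) * real n0 ^ Suc s"
      using n0(1) by (simp add: pos_divide_le_eq)
    also have "real n0 ^ Suc s = real n0 ^ (s - 1) * (real n0)\<^sup>2" using s by (simp flip: power_add)
    finally show ?thesis unfolding C_def r_def power_divide by (simp add: mult_ac)
  qed
  have "norm (d n0) > 0" using n0 by simp
  have "\<exists>N. \<bar>C\<bar> * r ^ N < norm (d n0)"
  proof -
    obtain N where N: "r ^ N < norm (d n0) / (\<bar>C\<bar> + 1)"
      using real_arch_pow_inv [of "norm (d n0) / (\<bar>C\<bar> + 1)" r] r \<open>norm (d n0) > 0\<close> by (auto simp: add_nonneg_pos)
    have "\<bar>C\<bar> * r ^ N \<le> (\<bar>C\<bar> + 1) * r ^ N" using r by (intro mult_right_mono) auto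
    also have "\<dots> < norm (d n0)" using N by (simp add: pos_less_divide_eq add_nonneg_pos mult.commute)
    finally show ?thesis ..
  qed
  then obtain N where N: "\<bar>C\<bar> * r ^ N < norm (d n0)" ..
  obtain s where s: "s \<in> T" "s > N + 1" using T unfolding infinite_nat_iff_unbounded by blast
  have "norm (d n0) \<le> C * r ^ (s - 1)" using s by (intro main) auto
  also have "\<dots> \<le> \<bar>C\<bar> * r ^ N"
    using r s by (intro mult_mono power_decreasing) auto
  finally show False using N by simp
qed

lemma periodic_bounded:
  fixes b :: "nat \<Rightarrow> complex"
  assumes "q > 0" "\<And>n. b (n + q) = b n"
  obtains B where "\<And>n. norm (b n) \<le> B"
proof -
  have "norm (b n) \<le> (\<Sum>m<q. norm (b m))" for n
  proof -
    have "[n = n mod q] (mod q)" by (simp add: cong_def)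
    then have "b n = b (n mod q)" using periodic_cong [where f = b and q = q] assms(2) by blast
    then show ?thesis using \<open>q > 0\<close> member_le_sum [of "n mod q" "{..<q}" "\<lambda>m. norm (b m)"] by simp
  qed
  then show thesis using that by blast
qed

lemma l2_over_n:
  fixes b :: "nat \<Rightarrow> complex"
  assumes "\<And>n. norm (b n) \<le> B"
  shows "l2 (\<lambda>n. b n / of_nat n)"
proof -
  have sq: "summable (\<lambda>n. B\<^sup>2 * (1 / (real n)\<^sup>2))"
    using inverse_power_summable [of 2] by (intro summable_mult) (simp add: inverse_eq_divide)
  have "(norm (b n / of_nat n))\<^sup>2 \<le> B\<^sup>2 * (1 / (real n)\<^sup>2)" for n
    using power_mono [OF assms norm_ge_zero, of n 2]
    by (simp add: norm_divide power_divide divide_right_mono)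
  then show ?thesis unfolding l2_def by (intro summable_comparison_test' [OF sq, of 0]) auto
qed

lemma cmult_inverse_power: "cmult (\<lambda>p. 1 / of_nat p ^ s) n = (if n = 0 then 0 else 1 / of_nat n ^ s)"
  using cmult_eq [of "\<lambda>p. 1 / of_nat p ^ s" n] by (auto simp: power_mult_distrib)

lemma l2_inverse_power:
  assumes "s \<ge> 1"
  shows "l2 (cmult (\<lambda>p. 1 / of_nat p ^ s))"
proof -
  have "l2 (\<lambda>n. (if n = 0 then 0 else 1 / of_nat n ^ (s - 1)) / of_nat n)"
  proof (rule l2_over_n)
    show "norm (if n = 0 then 0 else 1 / of_nat n ^ (s - 1) :: complex) \<le> 1" for n
      by (auto simp: norm_divide norm_power divide_le_eq_1 one_le_power)
  qed
  also have "(\<lambda>n. (if n = 0 then 0 else 1 / of_nat n ^ (s - 1)) / of_nat n) = cmult (\<lambda>p. 1 / of_nat p ^ s)"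
  proof
    fix n
    have "complex_of_nat n ^ (s - 1) * of_nat n = of_nat n ^ s" using assms by (intro power_minus_mult) simp
    then show "(if n = 0 then 0 else 1 / of_nat n ^ (s - 1)) / of_nat n = cmult (\<lambda>p. 1 / of_nat p ^ s) n"
      by (simp add: cmult_inverse_power)
  qed
  finally show ?thesis .
qed

text \<open>Decompose \<open>b\<close> into eigenvectors of \<open>b \<mapsto> b(a \<cdot>)\<close>. Evaluating at test sequences that are
  constant on many primes congruent to \<open>a\<close> yields in the limit a zero-free exponential sum,
  so only one eigenvalue can occur.\<close>

lemma multiplier_of_nonsummable_class:
  fixes b :: "nat \<Rightarrow> complex"
  assumes "q > 0" and per: "\<And>n. b (n + q) = b n"
    and cyc: "cyclic_seq (\<lambda>n. b n / of_nat n)" and a: "coprime a q"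
    and nonsum: "\<not> summable (\<lambda>p. if prime p \<and> [p = a] (mod q) then 1 / real p else 0)"
  shows "\<exists>\<alpha>. \<forall>n. b (a * n) = \<alpha> * b n"
proof -
  define k where "k = totient q"
  have k: "k > 0" using \<open>q > 0\<close> by (simp add: k_def)
  have ak: "[a ^ k = 1] (mod q)" unfolding k_def using a by (rule euler_theorem)
  have bcong: "b m = b n" if "[m = n] (mod q)" for m n
    by (rule periodic_cong [where q = q]) (use per that in auto)
  \<comment> \<open>The component of \<open>b\<close> in the eigenspace of the substitution of
    \<open>a * n\<close> for \<open>n\<close> belonging to \<open>\<zeta> j\<close>. It comes from
    averaging over the powers of \<open>a\<close>, which repeat modulo \<open>q\<close> after
    \<open>k\<close> steps.\<close>
  define bj where "bj j n = (\<Sum>i<k. unity_root k (j * i) * b (a ^ i * n)) / of_nat k" for j n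
  define \<zeta> where "\<zeta> j = cnj (unity_root k j)" for j
  have \<zeta>n: "norm (\<zeta> j) = 1" for j by (simp add: \<zeta>_def)
  have \<zeta>k: "\<zeta> j ^ k = 1" for j
  proof -
    have "unity_root k j ^ k = 1" using k by (simp add: unity_root_eq_1_iff flip: unity_root_mult)
    then show ?thesis unfolding \<zeta>_def by (metis complex_cnj_one complex_cnj_power)
  qed
  have bjcong: "bj j m = bj j n" if "[m = n] (mod q)" for j m n
  proof -
    have "b (a ^ i * m) = b (a ^ i * n)" for i using cong_scalar_left [OF that] by (rule bcong)
    then show ?thesis by (simp add: bj_def)
  qed
  have bja: "bj j (a * n) = \<zeta> j * bj j n" for j n
  proof -
    define f where "f i = unity_root k (j * i) * b (a ^ i * n)" for i
    have "f k = f 0"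
    proof -
      have "[a ^ k * n = 1 * n] (mod q)" using ak by (rule cong_scalar_right)
      then have "b (a ^ k * n) = b n" using bcong by fastforce
      moreover have "unity_root k (j * k) = 1" using k by (simp add: unity_root_eq_1_iff)
      ultimately show ?thesis by (simp add: f_def)
    qed
    then have "(\<Sum>i<k. f i) = (\<Sum>i=1..k. f i)" using k by (rule sum_lessThan_periodic_shift)
    also have "\<dots> = (\<Sum>i<k. f (Suc i))" by (simp add: sum.atLeast1_atMost_eq)
    also have "\<dots> = (\<Sum>i<k. unity_root k j * (unity_root k (j * i) * b (a ^ i * (a * n))))"
      by (intro sum.cong refl) (simp add: f_def unity_root_add mult_ac)
    finally have "bj j n = unity_root k j * bj j (a * n)"
      by (simp add: bj_def f_def sum_distrib_left)
    then have "\<zeta> j * bj j n = (cnj (unity_root k j) * unity_root k j) * bj j (a * n)" by (simp add: \<zeta>_def)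
    also have "cnj (unity_root k j) * unity_root k j = 1"
      using complex_norm_square [of "unity_root k j"] by (simp add: mult.commute)
    finally show ?thesis by simp
  qed
  have bjsum: "(\<Sum>j<k. bj j n) = b n" for n
  proof -
    have "(\<Sum>j<k. bj j n) = (\<Sum>j<k. \<Sum>i<k. unity_root k (j * i) * b (a ^ i * n)) / of_nat k"
      by (simp add: bj_def sum_divide_distrib)
    also have "(\<Sum>j<k. \<Sum>i<k. unity_root k (j * i) * b (a ^ i * n)) = (\<Sum>i<k. \<Sum>j<k. unity_root k (j * i) * b (a ^ i * n))"
      by (rule sum.swap)
    also have "\<dots> = (\<Sum>i<k. (\<Sum>j<k. unity_root k (i * j)) * b (a ^ i * n))"
    proof (intro sum.cong refl)
      fix i
      have "(\<Sum>j<k. unity_root k (j * i) * b (a ^ i * n)) = (\<Sum>j<k. unity_root k (j * i)) * b (a ^ i * n)"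
        by (rule sum_distrib_right [symmetric])
      then show "(\<Sum>j<k. unity_root k (j * i) * b (a ^ i * n)) = (\<Sum>j<k. unity_root k (i * j)) * b (a ^ i * n)"
        by (simp only: mult.commute [of i])
    qed
    also have "\<dots> = (\<Sum>i<k. if i = 0 then of_nat k * b n else 0)"
      using k by (intro sum.cong refl) (auto simp: sum_unity_root dest: nat_dvd_not_less)
    also have "\<dots> = of_nat k * b n" using k by simp
    finally show ?thesis using k by simp
  qed
  obtain B where B: "\<And>n. norm (b n) \<le> B" using periodic_bounded [OF \<open>q > 0\<close>, of b] per by blast
  have Bj: "norm (bj j n) \<le> B" for j n
  proof -
    have "norm (bj j n) \<le> (\<Sum>i<k. B) / real k"
      unfolding bj_def norm_divide norm_of_nat
      by (intro divide_right_mono sum_norm_le) (auto simp: norm_mult B)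
    then show ?thesis using k by simp
  qed
  have l2b: "l2 (\<lambda>n. b n / of_nat n)" by (rule l2_over_n [OF B])
  have l2bj: "l2 (\<lambda>n. bj j n / of_nat n)" for j by (rule l2_over_n [OF Bj])
  \<comment> \<open>The background sequence \<open>1 / n ^ s\<close>; varying \<open>s\<close> later
    separates the individual \<open>n\<close>.\<close>
  define g where "g s p = 1 / complex_of_nat p ^ s" for s p
  have ratio: "\<exists>\<alpha>. \<alpha> ^ k = 1 \<and> (\<Sum>n. (b (a * n) - \<alpha> * b n) / of_nat n * (1 / of_nat n ^ s)) = 0" if s: "s \<ge> 1" for s
  proof -
    have l2g: "l2 (cmult (g s))" unfolding g_def [abs_def] using s by (rule l2_inverse_power)
    define A where "A j = (\<Sum>n. bj j n / of_nat n * cmult (g s) n)" for j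
    have nonzero: "(\<Sum>j<k. A j * (\<Prod>p\<in>S. (1 - \<zeta> j / of_nat p ^ Suc s) / (1 - \<zeta> j * z / of_nat p))) \<noteq> 0"
      if S: "finite S" "\<And>p. p \<in> S \<Longrightarrow> prime p \<and> [p = a] (mod q)" and z: "norm z < 1" for S z
    proof -
      let ?f = "\<lambda>p. if p \<in> S then z else g s p"
      have l2f: "l2 (cmult ?f)" using S z l2g by (intro l2_cmult_change_finite) auto
      have each: "(\<Sum>n. bj j n / of_nat n * cmult ?f n) =
          A j * (\<Prod>p\<in>S. (1 - \<zeta> j / of_nat p ^ Suc s) / (1 - \<zeta> j * z / of_nat p))" for j
      proof -
        have mult: "bj j (p * n) / of_nat (p * n) = \<zeta> j / of_nat p * (bj j n / of_nat n)" if "p \<in> S" for p n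
        proof -
          have "[p * n = a * n] (mod q)" using S(2) [OF that] by (intro cong_scalar_right) auto
          then have "bj j (p * n) = \<zeta> j * bj j n" using bjcong bja by metis
          then show ?thesis by simp
        qed
        have "(\<Sum>n. bj j n / of_nat n * cmult ?f n) * (\<Prod>p\<in>S. 1 - \<zeta> j / of_nat p * z) =
            A j * (\<Prod>p\<in>S. 1 - \<zeta> j / of_nat p * g s p)"
          unfolding A_def using S mult z by (intro euler_finite l2bj l2g) auto
        moreover have ne: "1 - \<zeta> j * z / of_nat p \<noteq> 0" if "p \<in> S" for p
        proof
          assume "1 - \<zeta> j * z / of_nat p = 0"
          then have "norm (\<zeta> j * z / of_nat p) = 1" by (metis eq_iff_diff_eq_0 norm_one)
          moreover have "real p \<ge> 1" using S(2) [OF that] prime_ge_1_nat by simp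
          ultimately show False using z by (simp add: norm_mult norm_divide \<zeta>n)
        qed
        then have "(\<Prod>p\<in>S. 1 - \<zeta> j * z / of_nat p) \<noteq> 0" using S(1) by simp
        ultimately show ?thesis unfolding g_def prod_dividef by (simp add: field_simps)
      qed
      have "(\<Sum>n. b n / of_nat n * cmult ?f n) = (\<Sum>n. \<Sum>j<k. bj j n / of_nat n * cmult ?f n)"
        by (simp add: bjsum [symmetric] sum_divide_distrib sum_distrib_right)
      also have "\<dots> = (\<Sum>j<k. \<Sum>n. bj j n / of_nat n * cmult ?f n)"
        by (intro suminf_sum l2_inner l2bj l2f)
      also have "\<dots> = (\<Sum>j<k. A j * (\<Prod>p\<in>S. (1 - \<zeta> j / of_nat p ^ Suc s) / (1 - \<zeta> j * z / of_nat p)))"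
        by (simp only: each)
      finally show ?thesis
        using cyclic_seq_evaluation [OF l2b cyc l2f] by (simp add: cmult_mult)
    qed
    have A0: "(\<Sum>j<k. A j) \<noteq> 0" using nonzero [of "{}" 0] by simp
    have "(\<Sum>j<k. A j * exp (\<zeta> j * w)) \<noteq> 0" for w
      by (rule zero_free_exponential_sum [OF _ s nonzero nonsum A0]) (auto simp: \<zeta>n)
    then obtain \<alpha> where \<alpha>: "\<And>i. (\<Sum>j<k. A j * \<zeta> j ^ Suc i) = \<alpha> * (\<Sum>j<k. A j * \<zeta> j ^ i)"
      using zero_free_exponential_sum_ratio [of k \<zeta> A] \<zeta>n by auto
    have "(\<Sum>j<k. A j * \<zeta> j ^ i) = \<alpha> ^ i * (\<Sum>j<k. A j)" for i
      by (induction i) (simp_all only: \<alpha>, simp_all)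
    from this [of k] have "(\<Sum>j<k. A j) = \<alpha> ^ k * (\<Sum>j<k. A j)" by (simp add: \<zeta>k)
    then have \<alpha>k: "\<alpha> ^ k = 1" using A0 by simp
    have lin: "(\<Sum>j<k. A j * \<zeta> j) = \<alpha> * (\<Sum>j<k. A j)" using \<alpha> [of 0] by simp
    have "(\<Sum>n. (b (a * n) - \<alpha> * b n) / of_nat n * (1 / of_nat n ^ s)) =
        (\<Sum>n. \<Sum>j<k. (\<zeta> j - \<alpha>) * (bj j n / of_nat n * cmult (g s) n))"
    proof (rule suminf_cong)
      fix n
      have "b (a * n) - \<alpha> * b n = (\<Sum>j<k. (\<zeta> j - \<alpha>) * bj j n)"
        unfolding bjsum [symmetric] by (simp add: bja sum_distrib_left left_diff_distrib sum_subtractf)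
      moreover have "x / of_nat n * (1 / of_nat n ^ s) = x / of_nat n * cmult (g s) n" for x :: complex
        by (simp add: g_def [abs_def] cmult_inverse_power)
      ultimately show "(b (a * n) - \<alpha> * b n) / of_nat n * (1 / of_nat n ^ s) =
          (\<Sum>j<k. (\<zeta> j - \<alpha>) * (bj j n / of_nat n * cmult (g s) n))"
        by (simp add: sum_divide_distrib sum_distrib_right mult.assoc)
    qed
    also have "\<dots> = (\<Sum>j<k. \<Sum>n. (\<zeta> j - \<alpha>) * (bj j n / of_nat n * cmult (g s) n))"
      by (intro suminf_sum summable_mult l2_inner l2bj l2g)
    also have "\<dots> = (\<Sum>j<k. (\<zeta> j - \<alpha>) * A j)"
      unfolding A_def by (intro sum.cong refl suminf_mult l2_inner l2bj l2g)
    also have "\<dots> = 0" unfolding left_diff_distrib sum_subtractf using lin by (simp add: sum_distrib_left mult.commute)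
    finally show ?thesis using \<alpha>k by blast
  qed
  then obtain \<alpha> where \<alpha>: "\<And>s. s \<ge> 1 \<Longrightarrow> \<alpha> s ^ k = 1"
    "\<And>s. s \<ge> 1 \<Longrightarrow> (\<Sum>n. (b (a * n) - \<alpha> s * b n) / of_nat n * (1 / of_nat n ^ s)) = 0" by metis
  \<comment> \<open>All \<open>\<alpha> s\<close> are \<open>k\<close>-th roots of unity, so one
    value occurs for infinitely many \<open>s\<close>.\<close>
  have "finite (\<alpha> ` {1..})"
    by (rule finite_subset [OF _ finite_roots_unity [of k]]) (use \<alpha>(1) k in auto)
  moreover have "\<not> finite {1::nat..}" by (simp add: infinite_Ici)
  ultimately obtain s0 where s0: "s0 \<ge> 1" "infinite {s \<in> {1..}. \<alpha> s = \<alpha> s0}"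
    using pigeonhole_infinite [of "{1..}" \<alpha>] by auto
  have eq: "b (a * n) = \<alpha> s0 * b n" if "n \<ge> 1" for n
  proof -
    have "b (a * n) - \<alpha> s0 * b n = 0"
    proof (rule dirichlet_series_unique [OF _ s0(2) _ that])
      show "norm (b (a * n) - \<alpha> s0 * b n) \<le> B + norm (\<alpha> s0) * B" for n
        using norm_triangle_ineq4 [of "b (a * n)" "\<alpha> s0 * b n"] B [of "a * n"] mult_left_mono [OF B [of n] norm_ge_zero [of "\<alpha> s0"]]
        by (simp add: norm_mult)
      show "(\<Sum>n. (b (a * n) - \<alpha> s0 * b n) / of_nat n * (1 / of_nat n ^ s)) = 0" if "s \<in> {s \<in> {1..}. \<alpha> s = \<alpha> s0}" for s
        using \<alpha>(2) [of s] that by auto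
    qed
    then show ?thesis by simp
  qed
  \<comment> \<open>The series carry no information about index 0, which is recovered from index
    \<open>q\<close> by periodicity.\<close>
  have "b (a * n) = \<alpha> s0 * b n" for n
  proof (cases "n = 0")
    case True
    have "b (a * q) = b 0" "b q = b 0" using bcong by (auto simp: cong_def)
    then show ?thesis using eq [of q] \<open>q > 0\<close> True by simp
  qed (use eq in auto)
  then show ?thesis by blast
qed

text \<open>\<open>unit_seq\<close> is itself completely multiplicative, hence an admissible test
  sequence.\<close>

lemma cyclic_periodic_nonzero:
  assumes "l2 a" "cyclic_seq a"
  shows "a 1 \<noteq> 0"
proof -
  have "(\<Sum>n. a n * unit_seq n) \<noteq> 0"
    by (rule cyclic_seq_evaluation [OF assms l2_unit_seq]) (auto simp: unit_seq_def)
  moreover have "(\<Sum>n. a n * unit_seq n) = (\<Sum>n\<in>{1}. a n * unit_seq n)"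
    by (rule suminf_finite) (auto simp: unit_seq_def)
  ultimately show ?thesis by (simp add: unit_seq_def)
qed

text \<open>The residues acting on \<open>b\<close> by a scalar are closed under products. If they
  missed a unit, some class outside would have a divergent sum of prime reciprocals and would
  thereby act by a scalar after all. As \<open>b 1\<close> is nonzero, the scalars are determined
  and multiplicative.\<close>

lemma character_of_cyclic:
  fixes b :: "nat \<Rightarrow> complex"
  assumes "q > 1" and per: "\<And>n. b (n + q) = b n" and cyc: "cyclic_seq (\<lambda>n. b n / of_nat n)"
  obtains chi where "dirichlet_char q chi" "\<And>a n. coprime a q \<Longrightarrow> b (a * n) = chi a * b n"
proof -
  have q: "q > 0" using \<open>q > 1\<close> by simp
  obtain B where B: "\<And>n. norm (b n) \<le> B" using periodic_bounded [OF q, of b] per by blast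
  have b1: "b 1 \<noteq> 0" using cyclic_periodic_nonzero [OF l2_over_n [OF B] cyc] by simp
  have bcong: "b m = b n" if "[m = n] (mod q)" for m n
    by (rule periodic_cong [where q = q]) (use per that in auto)
  define K where "K a \<longleftrightarrow> (\<exists>\<alpha>. \<forall>n. b (a * n) = \<alpha> * b n)" for a
  have K: "K c" if "coprime c q" for c
  proof (rule ccontr)
    assume "\<not> K c"
    have Kmult: "K (m * n)" if "K m" "K n" for m n
    proof -
      obtain x y where "\<And>l. b (m * l) = x * b l" "\<And>l. b (n * l) = y * b l" using \<open>K m\<close> \<open>K n\<close> unfolding K_def by blast
      then have "b (m * n * l) = (x * y) * b l" for l by (simp add: mult.assoc)
      then show ?thesis unfolding K_def by blast
    qed
    have Kcong: "K n" if "[m = n] (mod q)" "K m" for m n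
    proof -
      obtain x where x: "\<And>l. b (m * l) = x * b l" using \<open>K m\<close> unfolding K_def by blast
      have "b (n * l) = x * b l" for l
        using bcong [OF cong_scalar_right [OF that(1), of l]] x by simp
      then show ?thesis unfolding K_def by blast
    qed
    have "K 1" unfolding K_def by (intro exI [of _ 1]) simp
    obtain a where "coprime a q" "\<not> K a" "\<not> summable (\<lambda>p. if prime p \<and> [p = a] (mod q) then 1 / real p else 0)"
    proof (rule residue_class_not_summable [of q K c])
      show "K (m * n)" if "K m" "K n" for m n using that by (rule Kmult)
      show "K n" if "[m = n] (mod q)" "K m" for m n using that by (rule Kcong)
    qed (use \<open>q > 1\<close> \<open>K 1\<close> \<open>coprime c q\<close> \<open>\<not> K c\<close> in auto)
    then show False using multiplier_of_nonsummable_class [OF q per cyc] unfolding K_def by blast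
  qed
  define chi where "chi a = (if coprime a q then b a / b 1 else 0)" for a
  have chi: "b (a * n) = chi a * b n" if cop: "coprime a q" for a n
  proof -
    obtain x where x: "\<And>l. b (a * l) = x * b l" using K [OF cop] unfolding K_def by blast
    have "chi a = x" using x [of 1] b1 cop by (simp add: chi_def)
    then show ?thesis using x by simp
  qed
  have chi_mult: "chi (m * n) = chi m * chi n" for m n
    using chi [of m n] b1 by (auto simp: chi_def)
  have "dirichlet_char q chi" unfolding dirichlet_char_def
  proof (intro conjI allI)
    show "chi 1 = 1" using b1 by (simp add: chi_def)
    show "chi (n + q) = chi n" for n
      using per by (simp add: chi_def coprime_iff_gcd_eq_1)
    show "(chi n \<noteq> 0) = coprime n q" for n
    proof
      assume "coprime n q"
      then obtain m where m: "[n * m = 1] (mod q)" using cong_solve_coprime_nat by auto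
      have "coprime (n * m) q" using m by (metis cong_imp_coprime cong_sym coprime_1_left)
      then have "chi (n * m) = 1" using bcong [OF m] b1 by (simp add: chi_def)
      then show "chi n \<noteq> 0" using chi_mult by auto
    qed (simp add: chi_def split: if_splits)
  qed (use q chi_mult in auto)
  then show thesis using chi that by blast
qed

subsection \<open>The arithmetic criterion\<close>

text \<open>Replacing \<open>m\<close> by \<open>a * m\<close> in the transform replaces
  \<open>n\<close> by its quotient by \<open>a\<close>, hence the conjugate. The difference of the
  two sides thus has vanishing transform.\<close>

lemma fourier_equivariant:
  assumes q: "q > 0" and per: "\<And>n. g (n + q) = g n"
    and b: "\<And>n. b n = (\<Sum>m<q. g m * unity_root q (m * n))"
    and chi: "dirichlet_char q chi" "\<And>a n. coprime a q \<Longrightarrow> b (a * n) = chi a * b n"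
    and a: "coprime a q"
  shows "g (a * m) = cnj (chi a) * g m"
proof -
  have gcong: "g x = g y" if "[x = y] (mod q)" for x y
    by (rule periodic_cong [where q = q]) (use per that in auto)
  have bcong: "b x = b y" if "[x = y] (mod q)" for x y
  proof -
    have "unity_root q (m * x) = unity_root q (m * y)" for m
      by (rule unity_root_cong [OF q cong_scalar_left [OF that]])
    then show ?thesis by (simp add: b)
  qed
  define D where "D m = g (a * m) - cnj (chi a) * g m" for m
  have "(\<Sum>m<q. D m * unity_root q (m * n)) = 0" for n
  proof -
    obtain a' where a': "[a * a' = 1] (mod q)" using a cong_solve_coprime_nat by auto
    define n' where "n' = a' * n"
    have "[a * a' * n = 1 * n] (mod q)" using a' by (rule cong_scalar_right)
    then have n': "[a * n' = n] (mod q)" by (simp add: n'_def mult.assoc)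
    have "(\<Sum>m<q. g (a * m) * unity_root q (m * n)) = (\<Sum>m<q. g (a * m) * unity_root q (a * m * n'))"
    proof (intro sum.cong refl)
      fix m
      have "[m * n = m * (a * n')] (mod q)" using n' by (intro cong_scalar_left) (rule cong_sym)
      then show "g (a * m) * unity_root q (m * n) = g (a * m) * unity_root q (a * m * n')"
        using unity_root_cong [OF q] by (simp add: mult_ac)
    qed
    also have "\<dots> = b n'" unfolding b
    proof (rule sum_periodic_mult [where f = "\<lambda>m. g m * unity_root q (m * n')", OF _ a q])
      show "g (m + q) * unity_root q ((m + q) * n') = g m * unity_root q (m * n')" for m
        using unity_root_cong [OF q, of "(m + q) * n'" "m * n'"] per by (simp add: cong_def distrib_right)
    qed
    also have "b n' = cnj (chi a) * b n"
    proof -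
      have "b n = chi a * b n'" using chi(2) [OF a, of n'] bcong [OF n'] by simp
      then show ?thesis using dirichlet_char_cnj_mult [OF chi(1) a] by (simp flip: mult.assoc)
    qed
    also have "\<dots> = (\<Sum>m<q. cnj (chi a) * g m * unity_root q (m * n))" by (simp add: b sum_distrib_left mult.assoc)
    finally show ?thesis by (simp add: D_def left_diff_distrib sum_subtractf)
  qed
  then have D0: "D (m mod q) = 0" using fourier_unique [OF q, of D "m mod q"] q by simp
  have "g (a * (m mod q)) = g (a * m)" "g (m mod q) = g m"
    by (intro gcong cong_scalar_left; simp)+
  then show ?thesis using D0 by (simp add: D_def)
qed

lemma l2_cmult_zero: "l2 (cmult (\<lambda>_. 0))"
proof (rule l2_finite_support [of "{1}"])
  fix n :: nat assume "n \<notin> {1}"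
  then show "cmult (\<lambda>_. 0) n = 0"
  proof (cases "n = 0")
    case False
    with \<open>n \<notin> {1}\<close> obtain p where "prime p" "p dvd n" using prime_factor_nat by auto
    then obtain k where "n = p * k" by (elim dvdE)
    then show ?thesis using \<open>prime p\<close> by (simp add: cmult_mult cmult_prime)
  qed simp
qed simp

lemma dirichlet_char_cnj:
  assumes "dirichlet_char q chi"
  shows "dirichlet_char q (\<lambda>n. cnj (chi n))"
  using assms unfolding dirichlet_char_def by auto

text \<open>Dividing by \<open>n\<close> cancels the factor \<open>e\<close> that the Gauss sums
  contribute, because \<open>n = e * (n div e)\<close>. What remains is, up to
  \<open>\<tau>\<close>, the Dirichlet convolution of \<open>p e = h (N div e)\<close> with the
  completely multiplicative sequence \<open>cnj (\<psi> n) / n\<close>.\<close>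

lemma periodic_cyclic_factor:
  assumes prim: "primitive_char q0 \<psi>" and "q0 dvd q" "q > 0"
    and per: "\<And>n. g (n + q) = g n"
    and b: "\<And>n. b n = (\<Sum>m<q. g m * unity_root q (m * n))"
    and rule: "\<And>m. m \<ge> 1 \<Longrightarrow> g m = g (gcd m (q div q0)) * \<psi> (m div gcd m (q div q0))"
  defines "N \<equiv> q div q0" and "h \<equiv> dconv g (\<lambda>n. moebius_mu n * \<psi> n)"
  obtains p \<tau> where "\<tau> \<noteq> 0" "N \<ge> 1" "p 1 = h N" "\<And>n. n \<notin> {1..N} \<Longrightarrow> p n = 0" "\<And>n. \<not> n dvd N \<Longrightarrow> p n = 0"
    "\<And>s. (\<Sum>d | d dvd N. h (q div (d * q0)) * of_nat d powr (- s)) = dir_poly p N s"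
    "\<And>n. b n / of_nat n = \<tau> * (\<Sum>e=1..N. p e * dil e (\<lambda>n. cnj (\<psi> n) / of_nat n) n)"
proof -
  have \<psi>: "dirichlet_char q0 \<psi>" using prim by (simp add: primitive_char_def)
  have q0: "q0 > 0" using \<psi> by (rule dirichlet_char_pos)
  have qN: "q = q0 * N" using \<open>q0 dvd q\<close> by (simp add: N_def)
  have N: "N > 0" using qN \<open>q > 0\<close> by (auto intro: Nat.gr0I)
  obtain \<tau> where \<tau>: "\<tau> \<noteq> 0" "\<And>n. (\<Sum>m<q0. \<psi> m * unity_root q0 (m * n)) = \<tau> * cnj (\<psi> n)"
    using gauss_sum_separable [OF prim] by blast
  have conv: "g m = (\<Sum>d | d dvd gcd m N. h d * \<psi> (m div d))" if "m \<ge> 1" for m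
    unfolding h_def by (rule twisted_convolution_of_gcd_rule [OF \<psi> N _ that]) (use rule in \<open>simp add: N_def\<close>)
  have "g (q0 * N) = g 0" using per [of 0] by (simp add: qN [symmetric])
  then have bn: "b n = \<tau> * (\<Sum>e | e dvd N. if e dvd n then h (N div e) * of_nat e * cnj (\<psi> (n div e)) else 0)" for n
    unfolding b qN by (intro fourier_twisted_convolution [OF \<psi> \<tau>(2) N _ conv])
  define p where "p e = (if e dvd N then h (N div e) else 0)" for e
  have sub: "{e. e dvd N} \<subseteq> {1..N}" using N by (auto intro: Suc_leI dvd_imp_le Nat.gr0I)
  have sumeq: "(\<Sum>e | e dvd N. f e) = (\<Sum>e=1..N. if e dvd N then f e else 0)" for f :: "nat \<Rightarrow> complex"
    using sub by (intro sum.mono_neutral_cong_left) auto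
  show thesis
  proof (rule that [of \<tau> p])
    show "p n = 0" if "n \<notin> {1..N}" for n using that sub by (auto simp: p_def)
    show "p n = 0" if "\<not> n dvd N" for n using that by (simp add: p_def)
    show "(\<Sum>d | d dvd N. h (q div (d * q0)) * of_nat d powr (- s)) = dir_poly p N s" for s
      unfolding sumeq dir_poly_def
    proof (intro sum.cong refl)
      fix d assume "d \<in> {1..N}"
      then have "of_nat d powr (- s) = exp (- s * of_real (ln (real d)))"
        by (simp add: powr_def Ln_of_nat)
      moreover have "q div (d * q0) = N div d" by (simp add: N_def div_mult2_eq [symmetric] mult.commute)
      ultimately show "(if d dvd N then h (q div (d * q0)) * of_nat d powr (- s) else 0) =
          p d * exp (- s * of_real (ln (real d)))" by (simp add: p_def)
    qed
    show "b n / of_nat n = \<tau> * (\<Sum>e=1..N. p e * dil e (\<lambda>n. cnj (\<psi> n) / of_nat n) n)" for n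
    proof (cases "n = 0")
      case False
      have "(\<Sum>e=1..N. if e dvd N then (if e dvd n then h (N div e) * of_nat e * cnj (\<psi> (n div e)) else 0) else 0) / of_nat n =
          (\<Sum>e=1..N. p e * dil e (\<lambda>n. cnj (\<psi> n) / of_nat n) n)"
        unfolding sum_divide_distrib
      proof (intro sum.cong refl)
        fix e assume e: "e \<in> {1..N}"
        show "(if e dvd N then (if e dvd n then h (N div e) * of_nat e * cnj (\<psi> (n div e)) else 0) else 0) / of_nat n =
            p e * dil e (\<lambda>n. cnj (\<psi> n) / of_nat n) n"
        proof (cases "e dvd N \<and> e dvd n")
          case True
          then obtain k where k: "n = e * k" by auto
          then have "k > 0" "e > 0" using False by auto
          then show ?thesis using True by (simp add: p_def dil_def k)
        qed (auto simp: p_def dil_def)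
      qed
      then show ?thesis unfolding bn sumeq by (simp add: mult.assoc flip: times_divide_eq_right)
    qed (simp add: dil_def)
  qed (use \<tau> N in \<open>auto simp: p_def\<close>)
qed

text \<open>Sufficiency: the zero-free polynomial makes \<open>p\<close> cyclic, and convolution
  with \<open>cnj (\<psi> n) / n\<close> preserves this. Necessity: the character of
  \<open>b\<close> yields the rule for \<open>g\<close>, and the value of the polynomial at
  \<open>s\<close> is a factor of a pairing with a test sequence, which cannot vanish.\<close>

theorem cyclic_periodic_iff:
  fixes g :: "nat \<Rightarrow> complex"
  assumes "q > 1" and per: "\<And>n. g (n + q) = g n"
    and b: "\<And>n. b n = (\<Sum>m<q. g m * unity_root q (m * n))"
  shows "cyclic_seq (\<lambda>n. b n / of_nat n) \<longleftrightarrow>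
    (\<exists>q0 \<psi>. q0 dvd q \<and> primitive_char q0 \<psi> \<and>
       (\<forall>m\<ge>1. g m = g (gcd m (q div q0)) * \<psi> (m div gcd m (q div q0))) \<and>
       dconv g (\<lambda>n. moebius_mu n * \<psi> n) (q div q0) \<noteq> 0 \<and>
       (\<forall>s::complex. Re s > 0 \<longrightarrow>
          (\<Sum>d | d dvd (q div q0).
             dconv g (\<lambda>n. moebius_mu n * \<psi> n) (q div (d * q0)) * (of_nat d) powr (- s)) \<noteq> 0))"
  (is "?cyc \<longleftrightarrow> ?crit")
proof
  have q: "q > 0" using \<open>q > 1\<close> by simp
  have bcong: "b x = b y" if "[x = y] (mod q)" for x y
  proof -
    have "unity_root q (m * x) = unity_root q (m * y)" for m
      by (rule unity_root_cong [OF q cong_scalar_left [OF that]])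
    then show ?thesis by (simp add: b)
  qed
  have perb: "b (n + q) = b n" for n by (rule bcong) (simp add: cong_def)
  obtain B where B: "\<And>n. norm (b n) \<le> B" using periodic_bounded [OF q, of b] perb by blast
  have l2b: "l2 (\<lambda>n. b n / of_nat n)" by (rule l2_over_n [OF B])
  {
    assume ?crit
    then obtain q0 \<psi> where q0: "q0 dvd q" and prim: "primitive_char q0 \<psi>"
      and rule: "\<And>m. m \<ge> 1 \<Longrightarrow> g m = g (gcd m (q div q0)) * \<psi> (m div gcd m (q div q0))"
      and c: "dconv g (\<lambda>n. moebius_mu n * \<psi> n) (q div q0) \<noteq> 0"
      and nz: "\<And>s. Re s > 0 \<Longrightarrow> (\<Sum>d | d dvd (q div q0).
             dconv g (\<lambda>n. moebius_mu n * \<psi> n) (q div (d * q0)) * (of_nat d) powr (- s)) \<noteq> 0" by blast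
    obtain p \<tau> where p: "\<tau> \<noteq> 0" "q div q0 \<ge> 1" "p 1 = dconv g (\<lambda>n. moebius_mu n * \<psi> n) (q div q0)"
        "\<And>n. n \<notin> {1..q div q0} \<Longrightarrow> p n = 0" "\<And>n. \<not> n dvd q div q0 \<Longrightarrow> p n = 0"
        "\<And>s. (\<Sum>d | d dvd q div q0. dconv g (\<lambda>n. moebius_mu n * \<psi> n) (q div (d * q0)) * of_nat d powr (- s)) = dir_poly p (q div q0) s"
        "\<And>n. b n / of_nat n = \<tau> * (\<Sum>e=1..q div q0. p e * dil e (\<lambda>n. cnj (\<psi> n) / of_nat n) n)"
    proof (rule periodic_cyclic_factor [OF prim q0 q, of g b])
      show "g (n + q) = g n" for n by (rule per)
      show "b n = (\<Sum>m<q. g m * unity_root q (m * n))" for n by (rule b)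
      show "g m = g (gcd m (q div q0)) * \<psi> (m div gcd m (q div q0))" if "m \<ge> 1" for m using that by (rule rule)
    qed (rule that)
    have \<psi>: "dirichlet_char q0 \<psi>" using prim by (simp add: primitive_char_def)
    have cp: "cyclic_seq p"
    proof (rule cyclic_seq_of_zero_free [OF p(2) _ p(4)])
      show "p 1 \<noteq> 0" using c p(3) by simp
      show "dir_poly p (q div q0) s \<noteq> 0" if "Re s > 0" for s using nz [OF that] p(6) by simp
    qed
    let ?l = "\<lambda>n. cnj (\<psi> n) / of_nat n"
    have l: "?l 1 = 1" "?l (m * n) = ?l m * ?l n" "norm (?l n) \<le> 1 / real n" for m n
    proof -
      show "?l 1 = 1" using \<psi> by (simp add: dirichlet_char_1)
      show "?l (m * n) = ?l m * ?l n" by (simp add: dirichlet_char_mult [OF \<psi>])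
      have "norm (\<psi> n) \<le> 1" using dirichlet_char_norm [OF \<psi>, of n] by simp
      then show "norm (?l n) \<le> 1 / real n" by (simp add: norm_divide divide_right_mono)
    qed
    have "l2 (\<lambda>n. \<Sum>e=1..q div q0. p e * dil e ?l n)"
      by (rule cyclic_seq_mult_completely_multiplicative(1) [OF p(4) cp l])
    moreover have "cyclic_seq (\<lambda>n. \<Sum>e=1..q div q0. p e * dil e ?l n)"
      by (rule cyclic_seq_mult_completely_multiplicative(2) [OF p(4) cp l])
    ultimately show ?cyc unfolding p(7) using p(1) cyclic_seq_scale by blast
  }
  assume ?cyc
  obtain chi where chi: "dirichlet_char q chi" "\<And>a n. coprime a q \<Longrightarrow> b (a * n) = chi a * b n"
    using character_of_cyclic [OF \<open>q > 1\<close>, of b] perb \<open>?cyc\<close> by blast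
  obtain q0 \<psi> where prim: "primitive_char q0 \<psi>" and ind: "induces q0 \<psi> q (\<lambda>n. cnj (chi n))"
    using exists_primitive_inducing [OF dirichlet_char_cnj [OF chi(1)]] by blast
  have \<psi>: "dirichlet_char q0 \<psi>" and q0: "q0 dvd q" using prim ind by (auto simp: primitive_char_def induces_def)
  have rule: "g m = g (gcd m (q div q0)) * \<psi> (m div gcd m (q div q0))" if "m \<ge> 1" for m
  proof (rule gcd_rule_of_equivariant [where g = g, OF prim ind q _ _ that])
    show "g (m + q) = g m" for m by (rule per)
    show "g (a * m) = cnj (chi a) * g m" if "coprime a q" for a m
      by (rule fourier_equivariant [where g = g and b = b, OF q _ _ chi(1) _ that]) (auto simp: per b [symmetric] chi(2))
  qed
  obtain p \<tau> where p: "\<tau> \<noteq> 0" "q div q0 \<ge> 1" "p 1 = dconv g (\<lambda>n. moebius_mu n * \<psi> n) (q div q0)"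
      "\<And>n. n \<notin> {1..q div q0} \<Longrightarrow> p n = 0" "\<And>n. \<not> n dvd q div q0 \<Longrightarrow> p n = 0"
      "\<And>s. (\<Sum>d | d dvd q div q0. dconv g (\<lambda>n. moebius_mu n * \<psi> n) (q div (d * q0)) * of_nat d powr (- s)) = dir_poly p (q div q0) s"
      "\<And>n. b n / of_nat n = \<tau> * (\<Sum>e=1..q div q0. p e * dil e (\<lambda>n. cnj (\<psi> n) / of_nat n) n)"
    proof (rule periodic_cyclic_factor [OF prim q0 q, of g b])
      show "g (n + q) = g n" for n by (rule per)
      show "b n = (\<Sum>m<q. g m * unity_root q (m * n))" for n by (rule b)
      show "g m = g (gcd m (q div q0)) * \<psi> (m div gcd m (q div q0))" if "m \<ge> 1" for m using that by (rule rule)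
    qed (rule that)
  define N where "N = q div q0"
  let ?l = "\<lambda>n. cnj (\<psi> n) / of_nat n"
  have p1: "p 1 \<noteq> 0"
  proof -
    have "b 1 \<noteq> 0" using cyclic_periodic_nonzero [OF l2b \<open>?cyc\<close>] by simp
    moreover have "(\<Sum>e=1..N. p e * dil e ?l 1) = (\<Sum>e=1..N. if e = 1 then p 1 else 0)"
      by (intro sum.cong refl) (auto simp: dil_def dirichlet_char_1 [OF \<psi>])
    then have "b 1 = \<tau> * p 1" using p(7) [of 1] p(2) by (simp add: N_def)
    ultimately show ?thesis by auto
  qed
  have nz: "dir_poly p N s \<noteq> 0" if s: "Re s > 0" for s
  proof
    assume zero: "dir_poly p N s = 0"
    define e where "e r = exp (- s * of_real (ln (real r)))" for r
    \<comment> \<open>The sequence with terms \<open>exp (- s * ln n)\<close> is square summable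
      only for \<open>Re s > 1/2\<close>. Keeping just the primes dividing \<open>N\<close> makes it
      square summable for all \<open>Re s > 0\<close> and does not change it at the divisors of
      \<open>N\<close>, the only places where it is compared with the polynomial.\<close>
    define f where "f r = (if r \<in> prime_factors N then e r else 0)" for r
    have l2f: "l2 (cmult f)" unfolding f_def
    proof (rule l2_cmult_change_finite)
      fix r assume "r \<in> prime_factors N"
      then have "prime r" by auto
      then have "ln (real r) > 0" using prime_gt_1_nat [OF \<open>prime r\<close>] by simp
      then show "prime r \<and> norm (e r) < 1" using s \<open>prime r\<close> by (simp add: e_def)
    qed (auto intro: l2_cmult_zero)
    define e' where "e' r = (if r = 0 then 0 else e r)" for r
    have e'm: "e' (m * n) = e' m * e' n" for m n
      by (auto simp: e'_def e_def ln_mult ring_distribs simp flip: exp_add)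
    have lamd: "cmult f d = e d" if "d dvd N" "d > 0" for d
    proof -
      have "cmult f d = cmult e' d"
        using that p(2) by (intro cmult_cong) (auto simp: f_def e'_def prime_factors_dvd N_def intro: dvd_trans)
      also have "\<dots> = e' d" using that e'm by (intro cmult_eq) (auto simp: e'_def e_def)
      finally show ?thesis using that by (simp add: e'_def)
    qed
    have l2l: "l2 ?l"
    proof (rule l2_over_n)
      show "norm (cnj (\<psi> n)) \<le> 1" for n using dirichlet_char_norm [OF \<psi>, of n] by simp
    qed
    have each: "(\<Sum>n. dil d ?l n * cmult f n) = cmult f d * (\<Sum>n. ?l n * cmult f n)" if "d > 0" for d
    proof -
      have "(\<Sum>n. dil d ?l n * cmult f n) = (\<Sum>n. dil d ?l (d * n) * cmult f (d * n))"
        using that by (intro dil_reindex) (auto simp: dil_def)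
      also have "\<dots> = (\<Sum>n. cmult f d * (?l n * cmult f n))"
        by (simp only: dil_times [OF that] cmult_mult) (simp add: mult_ac)
      also have "\<dots> = cmult f d * (\<Sum>n. ?l n * cmult f n)" by (intro suminf_mult l2_inner l2l l2f)
      finally show ?thesis .
    qed
    have "(\<Sum>n. b n / of_nat n * cmult f n) = (\<Sum>n. \<Sum>d=1..N. \<tau> * p d * (dil d ?l n * cmult f n))"
      unfolding p(7) N_def by (simp add: sum_distrib_left sum_distrib_right mult_ac)
    also have "\<dots> = (\<Sum>d=1..N. \<Sum>n. \<tau> * p d * (dil d ?l n * cmult f n))"
      by (intro suminf_sum summable_mult l2_inner l2_dil l2l l2f) auto
    also have "\<dots> = (\<Sum>d=1..N. \<tau> * p d * (\<Sum>n. dil d ?l n * cmult f n))"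
      by (intro sum.cong refl suminf_mult l2_inner l2_dil l2l l2f) auto
    also have "\<dots> = (\<Sum>d=1..N. \<tau> * (p d * e d) * (\<Sum>n. ?l n * cmult f n))"
    proof (intro sum.cong refl)
      fix d assume d: "d \<in> {1..N}"
      show "\<tau> * p d * (\<Sum>n. dil d ?l n * cmult f n) = \<tau> * (p d * e d) * (\<Sum>n. ?l n * cmult f n)"
      proof (cases "d dvd N")
        case True
        then show ?thesis using d each [of d] lamd [of d] by simp
      next
        case False
        then show ?thesis using p(5) by (simp add: N_def)
      qed
    qed
    also have "\<dots> = \<tau> * dir_poly p N s * (\<Sum>n. ?l n * cmult f n)"
      by (simp add: dir_poly_def e_def sum_distrib_left sum_distrib_right)
    also have "\<dots> = 0" using zero by simp
    finally show False using cyclic_seq_evaluation [OF l2b \<open>?cyc\<close> l2f] by (simp add: cmult_mult)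
  qed
  show ?crit
  proof (intro exI conjI allI impI)
    show "q0 dvd q" "primitive_char q0 \<psi>" by (fact q0, fact prim)
    show "g m = g (gcd m (q div q0)) * \<psi> (m div gcd m (q div q0))" if "m \<ge> 1" for m using that by (rule rule)
    show "dconv g (\<lambda>n. moebius_mu n * \<psi> n) (q div q0) \<noteq> 0" using p1 unfolding p(3) .
    show "(\<Sum>d | d dvd q div q0. dconv g (\<lambda>n. moebius_mu n * \<psi> n) (q div (d * q0)) * of_nat d powr (- s)) \<noteq> 0"
      if "Re s > 0" for s unfolding p(6) using nz [OF that] unfolding N_def .
  qed
qed

subsection \<open>Square integrable functions on the unit interval\<close>

abbreviation unit_interval_measure :: "real measure" (\<open>\<mu>\<^sub>I\<close>) where
  "\<mu>\<^sub>I \<equiv> restrict_space lebesgue {0<..<1}"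

definition sqint :: "(real \<Rightarrow> complex) \<Rightarrow> real" where
  "sqint f = (\<integral>x. (cmod (f x))\<^sup>2 \<partial>\<mu>\<^sub>I)"

lemma in_L2_iff: "in_L2 f \<longleftrightarrow> f \<in> borel_measurable \<mu>\<^sub>I \<and> integrable \<mu>\<^sub>I (\<lambda>x. (cmod (f x))\<^sup>2)"
  unfolding in_L2_def set_integrable_def by (subst integrable_restrict_space) auto

lemma sqint_eq: "(LINT x:{0<..<1}|lebesgue. (cmod (f x))\<^sup>2) = sqint f"
  unfolding sqint_def set_lebesgue_integral_def by (subst integral_restrict_space) auto

lemma space_unit_interval [simp]: "space \<mu>\<^sub>I = {0<..<1}"
  by (simp add: space_restrict_space)

interpretation unit_interval: finite_measure \<mu>\<^sub>I
  by (rule finite_measureI) (simp add: emeasure_restrict_space)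

lemma in_L2_bounded:
  assumes [measurable]: "f \<in> borel_measurable \<mu>\<^sub>I" and "\<And>x. 0 < x \<Longrightarrow> x < 1 \<Longrightarrow> norm (f x) \<le> B"
  shows "in_L2 f"
  unfolding in_L2_iff
proof (intro conjI assms(1))
  show "integrable \<mu>\<^sub>I (\<lambda>x. (cmod (f x))\<^sup>2)"
    by (rule unit_interval.integrable_const_bound [where B = "B\<^sup>2"])
       (auto intro!: AE_I2 power_mono assms(2))
qed

lemma in_L2_measurable: "in_L2 f \<Longrightarrow> f \<in> borel_measurable \<mu>\<^sub>I"
  by (simp add: in_L2_iff)

lemma in_L2_integrable: "in_L2 f \<Longrightarrow> integrable \<mu>\<^sub>I (\<lambda>x. (cmod (f x))\<^sup>2)"
  by (simp add: in_L2_iff)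

lemma sum_squares_bound': "(x + y)\<^sup>2 \<le> 2 * x\<^sup>2 + 2 * (y::real)\<^sup>2"
  using zero_le_power2 [of "x - y"] by (simp add: power2_eq_square algebra_simps)

lemma norm_add_square_le: "(cmod (x + y))\<^sup>2 \<le> 2 * (cmod x)\<^sup>2 + 2 * (cmod y)\<^sup>2"
  by (rule order_trans [OF power_mono [OF norm_triangle_ineq] sum_squares_bound']) simp

lemma in_L2_add:
  assumes "in_L2 f" "in_L2 g"
  shows "in_L2 (\<lambda>x. f x + g x)" "sqint (\<lambda>x. f x + g x) \<le> 2 * sqint f + 2 * sqint g"
proof -
  note [measurable] = assms [THEN in_L2_measurable]
  note i = assms [THEN in_L2_integrable]
  have dom: "integrable \<mu>\<^sub>I (\<lambda>x. 2 * (cmod (f x))\<^sup>2 + 2 * (cmod (g x))\<^sup>2)" using i by simp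
  have int: "integrable \<mu>\<^sub>I (\<lambda>x. (cmod (f x + g x))\<^sup>2)"
    by (rule Bochner_Integration.integrable_bound [OF dom]) (auto intro!: AE_I2 norm_add_square_le)
  then show "in_L2 (\<lambda>x. f x + g x)" by (simp add: in_L2_iff)
  have "sqint (\<lambda>x. f x + g x) \<le> (\<integral>x. 2 * (cmod (f x))\<^sup>2 + 2 * (cmod (g x))\<^sup>2 \<partial>\<mu>\<^sub>I)"
    unfolding sqint_def by (rule integral_mono [OF int dom]) (rule norm_add_square_le)
  also have "\<dots> = 2 * sqint f + 2 * sqint g" unfolding sqint_def using i by simp
  finally show "sqint (\<lambda>x. f x + g x) \<le> 2 * sqint f + 2 * sqint g" .
qed

lemma in_L2_scale:
  assumes "in_L2 f"
  shows "in_L2 (\<lambda>x. c * f x)" "sqint (\<lambda>x. c * f x) = (cmod c)\<^sup>2 * sqint f"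
proof -
  note [measurable] = assms [THEN in_L2_measurable]
  show "in_L2 (\<lambda>x. c * f x)"
    using in_L2_integrable [OF assms] by (simp add: in_L2_iff norm_mult power_mult_distrib)
  show "sqint (\<lambda>x. c * f x) = (cmod c)\<^sup>2 * sqint f"
    by (simp add: sqint_def norm_mult power_mult_distrib)
qed

lemma in_L2_diff:
  assumes "in_L2 f" "in_L2 g"
  shows "in_L2 (\<lambda>x. f x - g x)"
  using in_L2_add(1) [OF assms(1) in_L2_scale(1) [OF assms(2), of "-1"]] by simp

lemma in_L2_sum:
  assumes "finite A" "\<And>i. i \<in> A \<Longrightarrow> in_L2 (f i)"
  shows "in_L2 (\<lambda>x. \<Sum>i\<in>A. f i x)"
  using assms
proof (induction A rule: finite_induct)
  case empty
  show ?case by (rule in_L2_bounded [where B = 0]) auto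
qed (simp add: in_L2_add)

lemma in_L2_cnj: "in_L2 f \<Longrightarrow> in_L2 (\<lambda>x. cnj (f x))"
  unfolding in_L2_iff using measurable_compose [of f \<mu>\<^sub>I borel cnj] borel_measurable_continuous_onI [of cnj]
  by (auto intro!: continuous_intros)

lemma sqint_nonneg: "sqint f \<ge> 0"
  unfolding sqint_def by (rule integral_nonneg_AE) auto

lemma in_L2_mult:
  assumes "in_L2 f" "in_L2 g"
  shows "integrable \<mu>\<^sub>I (\<lambda>x. f x * g x)"
proof -
  note [measurable] = assms [THEN in_L2_measurable]
  have dom: "integrable \<mu>\<^sub>I (\<lambda>x. (cmod (f x))\<^sup>2 + (cmod (g x))\<^sup>2)"
    using assms [THEN in_L2_integrable] by simp
  show ?thesis
  proof (rule Bochner_Integration.integrable_bound [OF dom])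
    have "norm (f x * g x) \<le> norm ((cmod (f x))\<^sup>2 + (cmod (g x))\<^sup>2)" for x
    proof -
      have "2 * (cmod (f x) * cmod (g x)) \<le> (cmod (f x))\<^sup>2 + (cmod (g x))\<^sup>2"
        using zero_le_power2 [of "cmod (f x) - cmod (g x)"] by (simp add: power2_eq_square algebra_simps)
      moreover have "cmod (f x) * cmod (g x) \<ge> 0" by simp
      ultimately show ?thesis unfolding norm_mult real_norm_def by linarith
    qed
    then show "AE x in \<mu>\<^sub>I. norm (f x * g x) \<le> norm ((cmod (f x))\<^sup>2 + (cmod (g x))\<^sup>2)" by simp
  qed measurable
qed

subsection \<open>Sine series\<close>

definition sn :: "nat \<Rightarrow> real \<Rightarrow> complex" where
  "sn n x = of_real (sin (real n * pi * x))"

text \<open>The factor 2 compensates for the squared norm 1/2 of the sines; it reappears in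
  \<open>parseval\<close>.\<close>

definition coef :: "(real \<Rightarrow> complex) \<Rightarrow> nat \<Rightarrow> complex" where
  "coef f n = 2 * (\<integral>x. f x * sn n x \<partial>\<mu>\<^sub>I)"

lemma continuous_in_measurable: "continuous_on UNIV f \<Longrightarrow> f \<in> borel_measurable \<mu>\<^sub>I"
  for f :: "real \<Rightarrow> 'a::real_normed_vector"
  by (intro measurable_restrict_space1) (simp add: borel_measurable_continuous_onI measurable_completion)

lemma in_L2_sn: "in_L2 (sn n)"
proof (rule in_L2_bounded [where B = 1])
  show "sn n \<in> borel_measurable \<mu>\<^sub>I"
    unfolding sn_def [abs_def] by (intro continuous_in_measurable continuous_intros)
qed (simp add: sn_def)

lemma integral_unit_interval_eq:
  fixes f :: "real \<Rightarrow> 'b::euclidean_space"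
  assumes "integrable \<mu>\<^sub>I f" "(f has_integral i) {0..1}"
  shows "(\<integral>x. f x \<partial>\<mu>\<^sub>I) = i"
proof -
  have "(\<integral>x. f x \<partial>\<mu>\<^sub>I) = integral {0<..<1} f" using assms(1) by (rule lebesgue_integral_eq_integral) simp
  also have "\<dots> = i" using assms(2) by (simp add: has_integral_Icc_iff_Ioo integral_unique)
  finally show ?thesis .
qed

lemma integral_cos_multiple:
  fixes k :: int
  shows "((\<lambda>x. cos (of_int k * pi * x)) has_integral (if k = 0 then 1 else 0)) {0..1}"
proof (cases "k = 0")
  case True
  then show ?thesis using has_integral_const_real [of "1::real" 0 1] by simp
next
  case False
  have "((\<lambda>x. cos (of_int k * pi * x)) has_integral (sin (of_int k * pi * 1) / (of_int k * pi) - sin (of_int k * pi * 0) / (of_int k * pi))) {0..1}"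
    by (rule fundamental_theorem_of_calculus)
       (use False in \<open>auto intro!: derivative_eq_intros simp flip: has_real_derivative_iff_has_vector_derivative\<close>)
  moreover have "sin (of_int k * pi) = 0" by (simp add: sin_times_pi_eq_0)
  ultimately show ?thesis using False by simp
qed

lemma integral_sn_mult:
  assumes "n \<ge> 1" "m \<ge> 1"
  shows "(\<integral>x. sn m x * sn n x \<partial>\<mu>\<^sub>I) = (if m = n then 1 / 2 else 0)"
proof -
  have "((\<lambda>x. (cos (of_int (int m - int n) * pi * x) - cos (of_int (int m + int n) * pi * x)) / 2) has_integral
      ((if int m - int n = 0 then 1 else 0) - (if int m + int n = 0 then 1 else 0)) / 2) {0..1}"
    by (intro has_integral_divide has_integral_diff integral_cos_multiple)
  moreover have "(cos (of_int (int m - int n) * pi * x) - cos (of_int (int m + int n) * pi * x)) / 2 =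
      sin (real m * pi * x) * sin (real n * pi * x)" for x
    by (simp add: sin_times_sin algebra_simps)
  ultimately have "((\<lambda>x. sin (real m * pi * x) * sin (real n * pi * x)) has_integral (if m = n then 1 / 2 else 0)) {0..1}"
    using assms by (simp split: if_splits)
  then have "((\<lambda>x. complex_of_real (sin (real m * pi * x) * sin (real n * pi * x))) has_integral complex_of_real (if m = n then 1 / 2 else 0)) {0..1}"
    by (rule has_integral_linear [OF _ bounded_linear_of_real, unfolded comp_def])
  then have "((\<lambda>x. sn m x * sn n x) has_integral complex_of_real (if m = n then 1 / 2 else 0)) {0..1}"
    by (simp add: sn_def)
  from integral_unit_interval_eq [OF in_L2_mult [OF in_L2_sn in_L2_sn] this] show ?thesis by simp
qed

lemma sn_0 [simp]: "sn 0 x = 0"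
  by (simp add: sn_def)

lemma coef_0 [simp]: "coef f 0 = 0"
  by (simp add: coef_def)

lemma coef_add: "in_L2 f \<Longrightarrow> in_L2 g \<Longrightarrow> coef (\<lambda>x. f x + g x) n = coef f n + coef g n"
  unfolding coef_def distrib_right by (subst Bochner_Integration.integral_add) (auto intro!: in_L2_mult in_L2_sn simp: algebra_simps)

lemma coef_scale: "coef (\<lambda>x. c * f x) n = c * coef f n"
  unfolding coef_def by (simp add: mult.assoc)

lemma coef_diff: "in_L2 f \<Longrightarrow> in_L2 g \<Longrightarrow> coef (\<lambda>x. f x - g x) n = coef f n - coef g n"
  using coef_add [of f "\<lambda>x. (-1) * g x" n] coef_scale [of "-1" g n] in_L2_scale(1) [of g "-1"] by simp

lemma coef_sum:
  assumes "finite A" "\<And>i. i \<in> A \<Longrightarrow> in_L2 (f i)"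
  shows "coef (\<lambda>x. \<Sum>i\<in>A. f i x) n = (\<Sum>i\<in>A. coef (f i) n)"
  using assms
proof (induction A rule: finite_induct)
  case empty
  show ?case by (simp add: coef_def)
next
  case (insert i A)
  then have "in_L2 (\<lambda>x. \<Sum>i\<in>A. f i x)" by (intro in_L2_sum) auto
  then show ?case using insert by (simp add: coef_add)
qed

lemma coef_sn: "m \<ge> 1 \<Longrightarrow> coef (sn m) n = (if m = n then 1 else 0)"
  using integral_sn_mult [of n m] by (cases "n = 0") (auto simp: coef_def)

lemma sqint_complex: "in_L2 f \<Longrightarrow> complex_of_real (sqint f) = (\<integral>x. f x * cnj (f x) \<partial>\<mu>\<^sub>I)"
  unfolding sqint_def integral_complex_of_real [symmetric]
  by (intro Bochner_Integration.integral_cong refl) (metis complex_norm_square of_real_power)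

text \<open>Orthogonality lets one complete the square in the coefficients. With
  \<open>c = coef f\<close> this gives Bessel's inequality; with arbitrary \<open>c\<close> it shows
  that no other choice approximates better.\<close>

lemma sqint_minus_sine_poly:
  assumes f: "in_L2 f"
  shows "sqint (\<lambda>x. f x - (\<Sum>n=1..N. c n * sn n x)) =
    sqint f - (\<Sum>n=1..N. (cmod (coef f n))\<^sup>2) / 2 + (\<Sum>n=1..N. (cmod (coef f n - c n))\<^sup>2) / 2"
proof -
  define S where "S x = (\<Sum>n=1..N. c n * sn n x)" for x
  have S: "in_L2 S" unfolding S_def [abs_def] by (intro in_L2_sum in_L2_scale in_L2_sn) auto
  have cnjS: "cnj (S x) = (\<Sum>n=1..N. cnj (c n) * sn n x)" for x by (simp add: S_def sn_def)
  have fS: "(\<integral>x. f x * cnj (S x) \<partial>\<mu>\<^sub>I) = (\<Sum>n=1..N. cnj (c n) * coef f n) / 2" if f: "in_L2 f" for f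
  proof -
    have "(\<integral>x. f x * cnj (S x) \<partial>\<mu>\<^sub>I) = (\<integral>x. (\<Sum>n=1..N. cnj (c n) * (f x * sn n x)) \<partial>\<mu>\<^sub>I)"
      by (simp add: cnjS sum_distrib_left mult_ac)
    also have "\<dots> = (\<Sum>n=1..N. \<integral>x. cnj (c n) * (f x * sn n x) \<partial>\<mu>\<^sub>I)"
      by (intro Bochner_Integration.integral_sum integrable_mult_right in_L2_mult f in_L2_sn)
    also have "\<dots> = (\<Sum>n=1..N. cnj (c n) * coef f n) / 2"
      unfolding sum_divide_distrib by (intro sum.cong refl) (simp add: coef_def)
    finally show ?thesis .
  qed
  have Sf: "(\<integral>x. S x * cnj (f x) \<partial>\<mu>\<^sub>I) = cnj ((\<Sum>n=1..N. cnj (c n) * coef f n) / 2)"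
    unfolding fS [OF f, symmetric] by (simp add: mult.commute flip: Bochner_Integration.integral_cnj)
  have coefS: "coef S n = c n" if "n \<in> {1..N}" for n
  proof -
    have "coef S n = (\<Sum>m=1..N. c m * coef (sn m) n)"
      unfolding S_def [abs_def] by (subst coef_sum) (auto simp: coef_scale intro!: in_L2_scale in_L2_sn)
    also have "\<dots> = (\<Sum>m=1..N. if m = n then c n else 0)" by (intro sum.cong refl) (auto simp: coef_sn)
    finally show ?thesis using that by simp
  qed
  have SS: "(\<integral>x. S x * cnj (S x) \<partial>\<mu>\<^sub>I) = (\<Sum>n=1..N. cnj (c n) * c n) / 2"
    unfolding fS [OF S] by (intro arg_cong [of _ _ "\<lambda>x. x / 2"] sum.cong refl) (simp add: coefS)
  have "complex_of_real (sqint (\<lambda>x. f x - S x)) = (\<integral>x. (f x - S x) * cnj (f x - S x) \<partial>\<mu>\<^sub>I)"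
    by (rule sqint_complex) (intro in_L2_diff f S)
  also have "\<dots> = (\<integral>x. ((f x * cnj (f x) - f x * cnj (S x)) - S x * cnj (f x)) + S x * cnj (S x) \<partial>\<mu>\<^sub>I)"
    by (simp add: algebra_simps)
  also have "\<dots> = (\<integral>x. f x * cnj (f x) \<partial>\<mu>\<^sub>I) - (\<integral>x. f x * cnj (S x) \<partial>\<mu>\<^sub>I) - (\<integral>x. S x * cnj (f x) \<partial>\<mu>\<^sub>I) + (\<integral>x. S x * cnj (S x) \<partial>\<mu>\<^sub>I)"
    by (simp add: in_L2_mult in_L2_cnj f S)
  also have "\<dots> = complex_of_real (sqint f) - (\<Sum>n=1..N. cnj (c n) * coef f n) / 2
      - cnj ((\<Sum>n=1..N. cnj (c n) * coef f n) / 2) + (\<Sum>n=1..N. cnj (c n) * c n) / 2"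
    by (simp only: fS [OF f] Sf SS sqint_complex [OF f])
  finally have "Re (complex_of_real (sqint (\<lambda>x. f x - S x))) =
      Re (complex_of_real (sqint f) - (\<Sum>n=1..N. cnj (c n) * coef f n) / 2
      - cnj ((\<Sum>n=1..N. cnj (c n) * coef f n) / 2) + (\<Sum>n=1..N. cnj (c n) * c n) / 2)" by (rule arg_cong)
  then have "sqint (\<lambda>x. f x - S x) = sqint f - (\<Sum>n=1..N. Re (cnj (c n) * coef f n)) + (\<Sum>n=1..N. (cmod (c n))\<^sup>2) / 2"
    unfolding cmod_power2 by (simp add: power2_eq_square)
  also have "\<dots> = sqint f + (\<Sum>n=1..N. (cmod (c n))\<^sup>2 / 2 - Re (cnj (c n) * coef f n))"
    by (simp add: sum_subtractf sum_divide_distrib)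
  also have "(\<Sum>n=1..N. (cmod (c n))\<^sup>2 / 2 - Re (cnj (c n) * coef f n)) =
      (\<Sum>n=1..N. (cmod (coef f n - c n))\<^sup>2 / 2 - (cmod (coef f n))\<^sup>2 / 2)"
    unfolding cmod_power2 by (intro sum.cong refl) (simp add: power2_eq_square field_simps)
  finally show ?thesis by (simp add: S_def sum_subtractf sum_divide_distrib)
qed

subsection \<open>Completeness of the sines\<close>

definition sine_poly :: "(real \<Rightarrow> complex) \<Rightarrow> bool" where
  "sine_poly s \<longleftrightarrow> (\<exists>N c. \<forall>x. s x = (\<Sum>n=1..N. c n * sn n x))"

lemma sine_poly_sn: "sine_poly (sn n)"
proof (cases "n = 0")
  case True
  then show ?thesis unfolding sine_poly_def by (intro exI [of _ 0]) simp
next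
  case False
  then show ?thesis unfolding sine_poly_def
    by (intro exI [of _ n] exI [of _ "\<lambda>k. if k = n then 1 else 0"]) (auto simp: mult_delta_left)
qed

lemma sine_poly_scale: "sine_poly s \<Longrightarrow> sine_poly (\<lambda>x. c * s x)"
  unfolding sine_poly_def
proof (elim exE)
  fix N d assume "\<forall>x. s x = (\<Sum>n=1..N. d n * sn n x)"
  then show "\<exists>N d. \<forall>x. c * s x = (\<Sum>n=1..N. d n * sn n x)"
    by (intro exI [of _ N] exI [of _ "\<lambda>n. c * d n"]) (simp add: sum_distrib_left mult.assoc)
qed

lemma sine_poly_add:
  assumes "sine_poly s" "sine_poly t"
  shows "sine_poly (\<lambda>x. s x + t x)"
proof -
  obtain K c where s: "\<And>x. s x = (\<Sum>k=1..K. c k * sn k x)" using assms by (auto simp: sine_poly_def)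
  obtain L d where t: "\<And>x. t x = (\<Sum>k=1..L. d k * sn k x)" using assms by (auto simp: sine_poly_def)
  have ext: "(\<Sum>k=1..K. c k * sn k x) = (\<Sum>k=1..max K L. (if k \<le> K then c k else 0) * sn k x)" for x K L c
    by (rule sum.mono_neutral_cong_left) auto
  have "s x + t x = (\<Sum>k=1..max K L. ((if k \<le> K then c k else 0) + (if k \<le> L then d k else 0)) * sn k x)" for x
    unfolding s t ext [of c x K L] ext [of d x L K] max.commute [of L K] distrib_right sum.distrib ..
  then show ?thesis unfolding sine_poly_def by (intro exI allI)
qed

lemma sine_poly_sum: "finite A \<Longrightarrow> (\<And>i. i \<in> A \<Longrightarrow> sine_poly (s i)) \<Longrightarrow> sine_poly (\<lambda>x. \<Sum>i\<in>A. s i x)"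
proof (induction A rule: finite_induct)
  case empty
  then show ?case unfolding sine_poly_def by (intro exI [of _ 0]) simp
qed (simp add: sine_poly_add)

lemma sine_poly_mult_cos:
  assumes "sine_poly s"
  shows "sine_poly (\<lambda>x. of_real (cos (pi * x)) * s x)"
proof -
  have one: "sine_poly (\<lambda>x. of_real (cos (pi * x)) * sn n x)" if "n \<ge> 1" for n
  proof -
    have "of_real (cos (pi * x)) * sn n x = (1 / 2) * (sn (n + 1) x + sn (n - 1) x)" for x
    proof -
      have "sin (real (n + 1) * pi * x) + sin (real (n - 1) * pi * x) = 2 * (cos (pi * x) * sin (real n * pi * x))"
        using that by (simp add: of_nat_diff algebra_simps sin_add sin_diff)
      then show ?thesis unfolding sn_def of_real_add [symmetric] by simp
    qed
    then have "(\<lambda>x. of_real (cos (pi * x)) * sn n x) = (\<lambda>x. (1 / 2) * (sn (n + 1) x + sn (n - 1) x))" by (rule ext)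
    then show ?thesis by (simp only:) (intro sine_poly_scale sine_poly_add sine_poly_sn)
  qed
  obtain N c where s: "\<And>x. s x = (\<Sum>n=1..N. c n * sn n x)" using assms by (auto simp: sine_poly_def)
  have "(\<lambda>x. of_real (cos (pi * x)) * s x) = (\<lambda>x. \<Sum>n=1..N. c n * (of_real (cos (pi * x)) * sn n x))"
    by (simp add: s sum_distrib_left mult_ac)
  then show ?thesis using one by (auto intro!: sine_poly_sum sine_poly_scale)
qed

lemma sine_poly_mult_real_polynomial:
  assumes "real_polynomial_function p" "sine_poly s"
  shows "sine_poly (\<lambda>x. of_real (p (cos (pi * x))) * s x)"
  using assms
proof (induction arbitrary: s rule: real_polynomial_function.induct)
  case (linear f)
  have "f y = f 1 * y" for y :: real
    using linear_scale [OF bounded_linear.linear [OF linear(1)], of y 1] by (simp add: mult.commute)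
  then have "(\<lambda>x. of_real (f (cos (pi * x))) * s x) = (\<lambda>x. of_real (f 1) * (of_real (cos (pi * x)) * s x))"
    by (metis (no_types, opaque_lifting) mult.assoc of_real_mult)
  then show ?case using linear by (simp add: sine_poly_scale sine_poly_mult_cos)
next
  case (const c)
  then show ?case by (rule sine_poly_scale)
next
  case (add f g)
  then show ?case by (simp add: distrib_right sine_poly_add)
next
  case (mult f g)
  then show ?case by (simp add: mult.assoc)
qed

text \<open>In the variable \<open>cos (pi * x)\<close> the function \<open>K\<close> is continuous
  on \<open>{-1..1}\<close> and has polynomial approximations. A polynomial in
  \<open>cos (pi * x)\<close> becomes a sine polynomial only after multiplication by a sine, which
  is why the factor \<open>sn 1\<close> is carried along.\<close>

lemma sine_times_continuous_approx:
  fixes K :: "real \<Rightarrow> complex"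
  assumes K: "continuous_on {0..1} K" and "\<epsilon> > 0"
  obtains s where "sine_poly s" "\<And>x. 0 < x \<Longrightarrow> x < 1 \<Longrightarrow> norm (sn 1 x * K x - s x) < \<epsilon>"
proof -
  have cont: "continuous_on {-1..1} (\<lambda>y. K (arccos y / pi))"
  proof (rule continuous_on_compose2 [OF K])
    show "continuous_on {-1..1} (\<lambda>y. arccos y / pi)" by (intro continuous_intros) auto
    show "(\<lambda>y. arccos y / pi) ` {-1..1} \<subseteq> {0..1}"
      by (auto simp: arccos_lbound arccos_ubound)
  qed
  obtain P where P: "polynomial_function P" "\<And>y. y \<in> {-1..1} \<Longrightarrow> norm (K (arccos y / pi) - P y) < \<epsilon>"
    using Stone_Weierstrass_polynomial_function [OF _ cont \<open>\<epsilon> > 0\<close>] by auto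
  have "real_polynomial_function (Re \<circ> P)" "real_polynomial_function (Im \<circ> P)"
    using P(1) bounded_linear_Re bounded_linear_Im unfolding polynomial_function_def by auto
  then have rp: "real_polynomial_function (\<lambda>x. Re (P x))" "real_polynomial_function (\<lambda>x. Im (P x))"
    by (simp_all add: comp_def)
  define s where "s x = of_real (Re (P (cos (pi * x)))) * sn 1 x + \<i> * (of_real (Im (P (cos (pi * x)))) * sn 1 x)" for x
  have "sine_poly s" unfolding s_def [abs_def]
    by (intro sine_poly_add sine_poly_scale [of _ \<i>] sine_poly_mult_real_polynomial [OF rp(1)] sine_poly_mult_real_polynomial [OF rp(2)] sine_poly_sn)
  moreover have "norm (sn 1 x * K x - s x) < \<epsilon>" if x: "0 < x" "x < 1" for x
  proof -
    have "s x = (of_real (Re (P (cos (pi * x)))) + \<i> * of_real (Im (P (cos (pi * x))))) * sn 1 x"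
      by (simp add: s_def algebra_simps)
    also have "\<dots> = sn 1 x * P (cos (pi * x))" by (simp add: complex_eq [symmetric] mult.commute)
    finally have "sn 1 x * K x - s x = sn 1 x * (K x - P (cos (pi * x)))" by (simp add: algebra_simps)
    moreover have "arccos (cos (pi * x)) / pi = x" using x by (subst arccos_cos) auto
    then have "norm (K x - P (cos (pi * x))) < \<epsilon>" using P(2) [of "cos (pi * x)"] by simp
    moreover have "norm (sn 1 x) \<le> 1" by (simp add: sn_def)
    ultimately show ?thesis
      using mult_right_mono [of "norm (sn 1 x)" 1 "norm (K x - P (cos (pi * x)))"] by (simp add: norm_mult)
  qed
  ultimately show thesis using that by blast
qed

lemma sqint_small_of_bound:
  assumes "f \<in> borel_measurable \<mu>\<^sub>I" "\<And>x. 0 < x \<Longrightarrow> x < 1 \<Longrightarrow> norm (f x) \<le> B"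
  shows "sqint f \<le> B\<^sup>2"
proof -
  have "sqint f \<le> (\<integral>x. B\<^sup>2 \<partial>\<mu>\<^sub>I)"
    unfolding sqint_def
  proof (rule integral_mono)
    show "integrable \<mu>\<^sub>I (\<lambda>x. (cmod (f x))\<^sup>2)" using in_L2_bounded [OF assms] by (rule in_L2_integrable)
  qed (auto intro!: power_mono assms)
  also have "\<dots> = B\<^sup>2" by (simp add: measure_restrict_space)
  finally show ?thesis .
qed

lemma in_L2_approx_bounded:
  assumes f: "in_L2 f" and "\<epsilon> > 0"
  obtains B g where "B > 0" "g \<in> borel_measurable \<mu>\<^sub>I" "\<And>x. norm (g x) \<le> B" "sqint (\<lambda>x. f x - g x) < \<epsilon>"
proof -
  note [measurable] = in_L2_measurable [OF f]
  define h where "h n x = (if norm (f x) \<le> real n then f x else 0)" for n x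
  have [measurable]: "h n \<in> borel_measurable \<mu>\<^sub>I" for n unfolding h_def by measurable
  have "(\<lambda>n. sqint (\<lambda>x. f x - h n x)) \<longlonglongrightarrow> (\<integral>x. 0 \<partial>\<mu>\<^sub>I)"
    unfolding sqint_def
  proof (rule integral_dominated_convergence [where w = "\<lambda>x. (cmod (f x))\<^sup>2"])
    show "AE x in \<mu>\<^sub>I. (\<lambda>n. (cmod (f x - h n x))\<^sup>2) \<longlonglongrightarrow> 0"
    proof (rule AE_I2, rule tendsto_eventually)
      fix x
      obtain N where "norm (f x) \<le> real N" using real_arch_simple by blast
      then show "eventually (\<lambda>n. (cmod (f x - h n x))\<^sup>2 = 0) sequentially"
        by (intro eventually_sequentiallyI [of N]) (auto simp: h_def)
    qed
    show "AE x in \<mu>\<^sub>I. norm ((cmod (f x - h n x))\<^sup>2) \<le> (cmod (f x))\<^sup>2" for n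
      by (rule AE_I2) (simp add: h_def)
  qed (use in_L2_integrable [OF f] in auto)
  then have "eventually (\<lambda>n. sqint (\<lambda>x. f x - h n x) < \<epsilon>) sequentially"
    using \<open>\<epsilon> > 0\<close> by (intro order_tendstoD) auto
  then obtain n where n: "sqint (\<lambda>x. f x - h n x) < \<epsilon>" by (auto simp: eventually_sequentially)
  show thesis
    by (rule that [of "real n + 1" "h n"]) (use n in \<open>auto simp: h_def add_nonneg_pos\<close>)
qed

text \<open>Continuous functions converging to \<open>f\<close> almost everywhere are divided by
  \<open>sin (pi * x)\<close>, with the division softened near the endpoints. Dominated convergence
  then gives convergence in mean square.\<close>

lemma bounded_approx_sine_times_continuous:
  assumes f: "f \<in> borel_measurable \<mu>\<^sub>I" "\<And>x. norm (f x) \<le> B" "B > 0" and "\<epsilon> > 0"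
  obtains K where "continuous_on UNIV K" "sqint (\<lambda>x. f x - sn 1 x * K x) < \<epsilon>"
proof -
  have "f measurable_on {0<..<1}" using f(1) by (simp add: measurable_on_iff_borel_measurable)
  then obtain Z g where Z: "negligible Z" and g: "\<And>n. continuous_on UNIV (g n)"
    "\<And>x. x \<notin> Z \<Longrightarrow> (\<lambda>n. g n x) \<longlonglongrightarrow> (if x \<in> {0<..<1} then f x else 0)"
    unfolding measurable_on_def by blast
  \<comment> \<open>Radial truncation to the ball of radius \<open>B\<close>, which supplies the
    domination and leaves the values of \<open>f\<close> unchanged.\<close>
  define c where "c z = z / of_real (max 1 (norm z / B))" for z :: complex
  have max_ne: "max 1 x \<noteq> 0" for x :: real by simp
  have cont_c: "continuous_on UNIV c" unfolding c_def by (intro continuous_intros) (use \<open>B > 0\<close> in \<open>auto simp: max_def\<close>)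
  have norm_c: "norm (c z) \<le> B" for z
  proof -
    have "norm z \<le> B * max 1 (norm z / B)" using \<open>B > 0\<close> by (auto simp: max_def field_simps)
    moreover have "max 1 (norm z / B) > 0" by (simp add: max_def)
    ultimately show ?thesis unfolding c_def norm_divide norm_of_real by (simp add: pos_divide_le_eq)
  qed
  have c_id: "c z = z" if "norm z \<le> B" for z using that \<open>B > 0\<close> by (auto simp: c_def max_def)
  \<comment> \<open>The real factor is continuous in \<open>x\<close> and equals
    \<open>1 / sin (pi * x)\<close> as soon as \<open>n * sin (pi * x) \<ge> 1\<close>.\<close>
  define K where "K n x = c (g n x) * of_real (real n / max 1 (real n * sin (pi * x)))" for n x
  have contK: "continuous_on UNIV (K n)" for n
    unfolding K_def by (intro continuous_intros continuous_on_compose2 [OF cont_c g(1)]) auto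
  define F where "F n x = sn 1 x * K n x" for n x
  note [measurable] = f(1)
  have [measurable]: "F n \<in> borel_measurable \<mu>\<^sub>I" for n
    unfolding F_def [abs_def] sn_def [abs_def] by (intro continuous_in_measurable continuous_intros contK)
  have F: "F n x = c (g n x) * of_real (real n * sin (pi * x) / max 1 (real n * sin (pi * x)))" for n x
    by (simp add: F_def K_def sn_def)
  have sinpos: "sin (pi * x) > 0" if "0 < x" "x < 1" for x using that by (intro sin_gt_zero) auto
  have normF: "norm (F n x) \<le> B" if "0 < x" "x < 1" for n x
  proof -
    have "\<bar>real n * sin (pi * x) / max 1 (real n * sin (pi * x))\<bar> \<le> 1"
      using sinpos [OF that] by (auto simp: abs_le_iff divide_le_eq max_def)
    then have "norm (c (g n x)) * \<bar>real n * sin (pi * x) / max 1 (real n * sin (pi * x))\<bar> \<le> B * 1"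
      using norm_c \<open>B > 0\<close> by (intro mult_mono) auto
    then show ?thesis unfolding F norm_mult norm_of_real by simp
  qed
  have limF: "(\<lambda>n. F n x) \<longlonglongrightarrow> f x" if x: "0 < x" "x < 1" "x \<notin> Z" for x
  proof -
    have "(\<lambda>n. g n x) \<longlonglongrightarrow> f x" using g(2) [OF x(3)] x by simp
    moreover have "isCont c (f x)" using cont_c by (simp add: continuous_on_eq_continuous_at)
    ultimately have "(\<lambda>n. c (g n x)) \<longlonglongrightarrow> c (f x)" by (rule isCont_tendsto_compose [rotated])
    then have lim: "(\<lambda>n. c (g n x)) \<longlonglongrightarrow> f x" using c_id f(2) by simp
    obtain N where N: "1 / sin (pi * x) \<le> real N" using real_arch_simple by blast
    have "eventually (\<lambda>n. F n x = c (g n x)) sequentially"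
    proof (rule eventually_sequentiallyI [of N])
      fix n assume "N \<le> n"
      then have "1 / sin (pi * x) \<le> real n" using N by linarith
      then have "1 \<le> real n * sin (pi * x)" using sinpos [OF x(1,2)] by (simp add: divide_le_eq)
      then have "max 1 (real n * sin (pi * x)) = real n * sin (pi * x)" "real n * sin (pi * x) \<noteq> 0" by linarith+
      then show "F n x = c (g n x)" unfolding F by (metis divide_self mult.right_neutral of_real_1)
    qed
    then show ?thesis using lim tendsto_cong [of "\<lambda>n. F n x" "\<lambda>n. c (g n x)" sequentially] by blast
  qed
  have "(\<lambda>n. sqint (\<lambda>x. f x - F n x)) \<longlonglongrightarrow> (\<integral>x. 0 \<partial>\<mu>\<^sub>I)"
    unfolding sqint_def
  proof (rule integral_dominated_convergence [where w = "\<lambda>x. (2 * B)\<^sup>2"])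
    have "AE x in \<mu>\<^sub>I. x \<notin> Z"
    proof (subst AE_restrict_space_iff)
      have "AE x in lebesgue. x \<notin> Z" using Z by (simp add: negligible_iff_null_sets AE_not_in)
      then show "AE x in lebesgue. x \<in> {0<..<1} \<longrightarrow> x \<notin> Z" by eventually_elim simp
    qed simp
    moreover have "AE x in \<mu>\<^sub>I. x \<in> {0<..<1}" using AE_space [of \<mu>\<^sub>I] by simp
    ultimately show "AE x in \<mu>\<^sub>I. (\<lambda>n. (cmod (f x - F n x))\<^sup>2) \<longlonglongrightarrow> 0"
    proof eventually_elim
      case (elim x)
      then have "(\<lambda>n. (cmod (f x - F n x))\<^sup>2) \<longlonglongrightarrow> (cmod (f x - f x))\<^sup>2"
        by (intro tendsto_intros limF) auto
      then show ?case by simp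
    qed
    show "AE x in \<mu>\<^sub>I. norm ((cmod (f x - F n x))\<^sup>2) \<le> (2 * B)\<^sup>2" for n
    proof (rule AE_I2)
      fix x assume "x \<in> space \<mu>\<^sub>I"
      then have "norm (f x - F n x) \<le> 2 * B"
        using norm_triangle_ineq4 [of "f x" "F n x"] f(2) [of x] normF [of x n] by simp
      then have "(cmod (f x - F n x))\<^sup>2 \<le> (2 * B)\<^sup>2" by (rule power_mono) simp
      then show "norm ((cmod (f x - F n x))\<^sup>2) \<le> (2 * B)\<^sup>2" by (simp only: real_norm_def abs_of_nonneg [OF zero_le_power2])
    qed
  qed auto
  then have "eventually (\<lambda>n. sqint (\<lambda>x. f x - F n x) < \<epsilon>) sequentially"
    using \<open>\<epsilon> > 0\<close> by (intro order_tendstoD) auto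
  then obtain n where n: "sqint (\<lambda>x. f x - F n x) < \<epsilon>" by (auto simp: eventually_sequentially)
  then show thesis using that [of "K n"] contK unfolding F_def by blast
qed

lemma in_L2_sine_poly: "sine_poly s \<Longrightarrow> in_L2 s"
  unfolding sine_poly_def
proof (elim exE)
  fix N c assume "\<forall>x. s x = (\<Sum>n=1..N. c n * sn n x)"
  then have "s = (\<lambda>x. \<Sum>n=1..N. c n * sn n x)" by auto
  then show "in_L2 s" by (auto intro!: in_L2_sum in_L2_scale in_L2_sn)
qed

lemma sine_dense:
  assumes f: "in_L2 f" and "\<epsilon> > 0"
  obtains N c where "sqint (\<lambda>x. f x - (\<Sum>n=1..N. c n * sn n x)) < \<epsilon>"
proof -
  \<comment> \<open>Each use of \<open>in_L2_add\<close> doubles the errors: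
    \<open>2/16 + 2/16 = 1/4\<close> and then \<open>2/16 + 2/4 = 5/8\<close>, which is below
    1.\<close>
  have e: "\<epsilon> / 16 > 0" using \<open>\<epsilon> > 0\<close> by simp
  obtain B g where g: "B > 0" "g \<in> borel_measurable \<mu>\<^sub>I" "\<And>x. norm (g x) \<le> B" "sqint (\<lambda>x. f x - g x) < \<epsilon> / 16"
    using in_L2_approx_bounded [OF f e] by metis
  obtain K where K: "continuous_on UNIV K" "sqint (\<lambda>x. g x - sn 1 x * K x) < \<epsilon> / 16"
    using bounded_approx_sine_times_continuous [OF g(2,3,1) e] by metis
  have "sqrt (\<epsilon> / 16) > 0" using e by simp
  then obtain s where s: "sine_poly s" "\<And>x. 0 < x \<Longrightarrow> x < 1 \<Longrightarrow> norm (sn 1 x * K x - s x) < sqrt (\<epsilon> / 16)"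
    using sine_times_continuous_approx [OF continuous_on_subset [OF K(1)]] by (metis top_greatest)
  have L2g: "in_L2 g" using g(2,3) by (intro in_L2_bounded) auto
  have L2s: "in_L2 s" by (rule in_L2_sine_poly [OF s(1)])
  have L2K: "in_L2 (\<lambda>x. sn 1 x * K x)"
  proof -
    have meas: "(\<lambda>x. sn 1 x * K x) \<in> borel_measurable \<mu>\<^sub>I"
      unfolding sn_def [abs_def] by (intro continuous_in_measurable continuous_intros K)
    have "bounded (K ` {0..1})"
      by (intro compact_imp_bounded compact_continuous_image continuous_on_subset [OF K(1)]) auto
    then obtain C where C: "\<And>x. x \<in> {0..1} \<Longrightarrow> norm (K x) \<le> C" unfolding bounded_iff by blast
    show ?thesis
    proof (rule in_L2_bounded [OF meas])
      fix x :: real assume "0 < x" "x < 1"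
      then have "norm (sn 1 x) * norm (K x) \<le> 1 * C" by (intro mult_mono C) (auto simp: sn_def)
      then show "norm (sn 1 x * K x) \<le> C" by (simp add: norm_mult)
    qed
  qed
  have "sqint (\<lambda>x. sn 1 x * K x - s x) \<le> (sqrt (\<epsilon> / 16))\<^sup>2"
    using s(2) by (intro sqint_small_of_bound in_L2_measurable in_L2_diff L2K L2s) (auto simp: less_imp_le)
  then have 3: "sqint (\<lambda>x. sn 1 x * K x - s x) \<le> \<epsilon> / 16" using e by simp
  have "sqint (\<lambda>x. (g x - sn 1 x * K x) + (sn 1 x * K x - s x)) \<le>
      2 * sqint (\<lambda>x. g x - sn 1 x * K x) + 2 * sqint (\<lambda>x. sn 1 x * K x - s x)"
    by (intro in_L2_add in_L2_diff L2g L2K L2s)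
  then have gs: "sqint (\<lambda>x. g x - s x) < \<epsilon> / 4" using K(2) 3 by simp
  have "sqint (\<lambda>x. (f x - g x) + (g x - s x)) \<le> 2 * sqint (\<lambda>x. f x - g x) + 2 * sqint (\<lambda>x. g x - s x)"
    by (intro in_L2_add in_L2_diff L2g L2s f)
  then have "sqint (\<lambda>x. f x - s x) < \<epsilon>" using g(4) gs \<open>\<epsilon> > 0\<close> by simp
  moreover obtain N c where "\<And>x. s x = (\<Sum>n=1..N. c n * sn n x)" using s(1) by (auto simp: sine_poly_def)
  ultimately show thesis using that by simp
qed

text \<open>One inequality is Bessel's. For the other, a sine polynomial close to \<open>f\<close>
  makes the completed square small, which forces the coefficients to account for nearly all of
  \<open>2 * sqint f\<close>.\<close>

lemma parseval:
  assumes f: "in_L2 f"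
  shows "l2 (coef f)" "(l2norm (coef f))\<^sup>2 = 2 * sqint f"
proof -
  have bessel: "(\<Sum>n=1..N. (cmod (coef f n))\<^sup>2) \<le> 2 * sqint f" for N
    using sqint_minus_sine_poly [OF f, of "coef f" N] sqint_nonneg [of "\<lambda>x. f x - (\<Sum>n=1..N. coef f n * sn n x)"] by simp
  have sh: "(\<Sum>n\<le>N. (cmod (coef f n))\<^sup>2) = (\<Sum>n=1..N. (cmod (coef f n))\<^sup>2)" for N
    by (rule sum.mono_neutral_right) (auto simp: Suc_le_eq)
  have bd: "(\<Sum>n\<le>N. (cmod (coef f n))\<^sup>2) \<le> 2 * sqint f" for N unfolding sh by (rule bessel)
  show l2: "l2 (coef f)" unfolding l2_def by (rule bounded_imp_summable [OF _ bd]) simp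
  have "(\<Sum>n. (cmod (coef f n))\<^sup>2) \<le> 2 * sqint f"
  proof (rule suminf_le_const)
    show "(\<Sum>n<m. (cmod (coef f n))\<^sup>2) \<le> 2 * sqint f" for m
      by (rule order_trans [OF sum_mono2 bd [of m]]) auto
  qed (use l2 in \<open>simp add: l2_def\<close>)
  moreover have "2 * sqint f \<le> (\<Sum>n. (cmod (coef f n))\<^sup>2)"
  proof (rule field_le_epsilon)
    fix e :: real assume "e > 0"
    then have "e / 2 > 0" by simp
    then obtain N c where "sqint (\<lambda>x. f x - (\<Sum>n=1..N. c n * sn n x)) < e / 2" using sine_dense [OF f] by metis
    then have "2 * sqint f < (\<Sum>n=1..N. (cmod (coef f n))\<^sup>2) - (\<Sum>n=1..N. (cmod (coef f n - c n))\<^sup>2) + e"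
      unfolding sqint_minus_sine_poly [OF f] by simp
    also have "\<dots> \<le> (\<Sum>n=1..N. (cmod (coef f n))\<^sup>2) + e" by (simp add: sum_nonneg)
    also have "(\<Sum>n=1..N. (cmod (coef f n))\<^sup>2) \<le> (\<Sum>n. (cmod (coef f n))\<^sup>2)"
      using l2 unfolding l2_def by (intro sum_le_suminf) auto
    finally show "2 * sqint f \<le> (\<Sum>n. (cmod (coef f n))\<^sup>2) + e" by simp
  qed
  ultimately have "(\<Sum>n. (cmod (coef f n))\<^sup>2) = 2 * sqint f" by (rule antisym)
  then show "(l2norm (coef f))\<^sup>2 = 2 * sqint f" unfolding l2norm_def using sqint_nonneg [of f] by simp
qed

lemma coef_bound:
  assumes "in_L2 f"
  shows "(cmod (coef f n))\<^sup>2 \<le> 2 * sqint f"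
proof -
  have "L2_set (\<lambda>n. cmod (coef f n)) {n} \<le> l2norm (coef f)" using parseval(1) [OF assms] by (rule L2_set_le_l2norm) simp
  then have "cmod (coef f n) \<le> l2norm (coef f)" by (simp add: L2_set_def)
  then have "(cmod (coef f n))\<^sup>2 \<le> (l2norm (coef f))\<^sup>2" by (rule power_mono) simp
  then show ?thesis using parseval(2) [OF assms] by simp
qed

lemma sqint_partial_sums:
  assumes f: "in_L2 f"
  shows "(\<lambda>N. sqint (\<lambda>x. f x - (\<Sum>n=1..N. coef f n * sn n x))) \<longlonglongrightarrow> 0"
proof -
  have l2: "summable (\<lambda>n. (cmod (coef f n))\<^sup>2)" using parseval(1) [OF f] by (simp add: l2_def)
  have s: "(\<Sum>n. (cmod (coef f n))\<^sup>2) = 2 * sqint f"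
    using parseval(2) [OF f] l2 unfolding l2norm_def by (simp add: suminf_nonneg)
  have "(\<lambda>N. \<Sum>n\<le>N. (cmod (coef f n))\<^sup>2) \<longlonglongrightarrow> 2 * sqint f" using summable_LIMSEQ' [OF l2] s by simp
  then have "(\<lambda>N. sqint f - (\<Sum>n\<le>N. (cmod (coef f n))\<^sup>2) / 2) \<longlonglongrightarrow> sqint f - 2 * sqint f / 2"
    by (intro tendsto_intros) auto
  moreover have "sqint (\<lambda>x. f x - (\<Sum>n=1..N. coef f n * sn n x)) = sqint f - (\<Sum>n\<le>N. (cmod (coef f n))\<^sup>2) / 2" for N
  proof -
    have "(\<Sum>n\<le>N. (cmod (coef f n))\<^sup>2) = (\<Sum>n=1..N. (cmod (coef f n))\<^sup>2)" by (rule sum.mono_neutral_right) (auto simp: Suc_le_eq)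
    then show ?thesis unfolding sqint_minus_sine_poly [OF f] by simp
  qed
  ultimately show ?thesis by simp
qed

subsection \<open>Dilations of periodic functions\<close>

lemma integrable_bounded_interval:
  fixes W :: "real \<Rightarrow> real"
  assumes [measurable]: "W \<in> borel_measurable borel" and "\<And>x. \<bar>W x\<bar> \<le> B"
  shows "integrable lborel (\<lambda>x. indicator {a..<b} x * W x)"
proof (rule Bochner_Integration.integrable_bound)
  show "integrable lborel (\<lambda>x. B * indicator {a..<b} x :: real)"
    by (intro integrable_mult_right integrable_real_indicator emeasure_bounded_finite) auto
  show "AE x in lborel. norm (indicator {a..<b} x * W x) \<le> norm (B * indicator {a..<b} x)"
    using order_trans [OF assms(2) abs_ge_self] by (intro AE_I2) (auto simp: indicator_def)
qed measurable

lemma integral_period_shift: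
  fixes W :: "real \<Rightarrow> real"
  assumes per: "\<And>x. W (x + 2) = W x"
  shows "(\<integral>x. indicator {2 * real k..<2 * real k + 2} x * W x \<partial>lborel) = (\<integral>x. indicator {0..<2} x * W x \<partial>lborel)"
proof -
  have perk: "W (2 * real k + x) = W x" for x
  proof (induction k)
    case (Suc k)
    have "W (2 * real (Suc k) + x) = W ((2 * real k + x) + 2)" by (simp add: algebra_simps)
    then show ?case using per Suc by simp
  qed simp
  have "(\<integral>x. indicator {2 * real k..<2 * real k + 2} x * W x \<partial>lborel) =
      \<bar>1\<bar> *\<^sub>R (\<integral>x. indicator {2 * real k..<2 * real k + 2} (2 * real k + 1 * x) * W (2 * real k + 1 * x) \<partial>lborel)"
    by (rule lborel_integral_real_affine) simp
  also have "\<dots> = (\<integral>x. indicator {0..<2} x * W x \<partial>lborel)"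
    by (simp add: perk indicator_def)
  finally show ?thesis .
qed

lemma integral_periods:
  fixes W :: "real \<Rightarrow> real"
  assumes W: "W \<in> borel_measurable borel" "\<And>x. \<bar>W x\<bar> \<le> B" and per: "\<And>x. W (x + 2) = W x"
  shows "(\<integral>x. indicator {0..<2 * real k} x * W x \<partial>lborel) = real k * (\<integral>x. indicator {0..<2} x * W x \<partial>lborel)"
proof (induction k)
  case (Suc k)
  have "(\<integral>x. indicator {0..<2 * real (Suc k)} x * W x \<partial>lborel) =
      (\<integral>x. indicator {0..<2 * real k} x * W x + indicator {2 * real k..<2 * real k + 2} x * W x \<partial>lborel)"
    by (intro Bochner_Integration.integral_cong refl) (auto simp: indicator_def)
  also have "\<dots> = (\<integral>x. indicator {0..<2 * real k} x * W x \<partial>lborel) + (\<integral>x. indicator {2 * real k..<2 * real k + 2} x * W x \<partial>lborel)"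
    by (intro Bochner_Integration.integral_add integrable_bounded_interval [OF W])
  also have "\<dots> = real (Suc k) * (\<integral>x. indicator {0..<2} x * W x \<partial>lborel)"
    unfolding Suc integral_period_shift [of W, OF per] by (simp add: algebra_simps)
  finally show ?case .
qed simp

lemma integral_dilate_period:
  fixes W :: "real \<Rightarrow> real"
  assumes W: "W \<in> borel_measurable borel" "\<And>x. \<bar>W x\<bar> \<le> B" and per: "\<And>x. W (x + 2) = W x" and "k > 0"
  shows "(\<integral>x. indicator {0..<2} x * W (real k * x) \<partial>lborel) = (\<integral>x. indicator {0..<2} x * W x \<partial>lborel)"
proof -
  have "(\<integral>x. indicator {0..<2 * real k} x * W x \<partial>lborel) =
      \<bar>real k\<bar> *\<^sub>R (\<integral>x. indicator {0..<2 * real k} (0 + real k * x) * W (0 + real k * x) \<partial>lborel)"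
    using \<open>k > 0\<close> by (intro lborel_integral_real_affine) simp
  also have "(\<lambda>x. indicator {0..<2 * real k} (0 + real k * x) * W (0 + real k * x)) = (\<lambda>x. indicator {0..<2} x * W (real k * x))"
    using \<open>k > 0\<close> by (auto simp: fun_eq_iff indicator_def zero_le_mult_iff mult.commute [of 2])
  finally show ?thesis unfolding integral_periods [OF W per] using \<open>k > 0\<close> by simp
qed

lemma integral_even_period:
  fixes W :: "real \<Rightarrow> real"
  assumes W: "W \<in> borel_measurable borel" "\<And>x. \<bar>W x\<bar> \<le> B"
    and per: "\<And>x. W (x + 2) = W x" and even: "\<And>x. W (- x) = W x"
  shows "(\<integral>x. indicator {0..<2} x * W x \<partial>lborel) = 2 * (\<integral>x. indicator {0<..<1} x * W x \<partial>lborel)"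
proof -
  note [measurable] = W(1)
  have ae: "AE x in lborel. x \<noteq> (0::real) \<and> x \<noteq> 1"
    using AE_lborel_singleton [of "0::real"] AE_lborel_singleton [of "1::real"] by (rule AE_conjI)
  have "(\<integral>x. indicator {0..<2} x * W x \<partial>lborel) = (\<integral>x. indicator {0..<1} x * W x + indicator {1..<2} x * W x \<partial>lborel)"
    by (intro Bochner_Integration.integral_cong refl) (auto simp: indicator_def)
  also have "\<dots> = (\<integral>x. indicator {0..<1} x * W x \<partial>lborel) + (\<integral>x. indicator {1..<2} x * W x \<partial>lborel)"
    by (intro Bochner_Integration.integral_add integrable_bounded_interval [OF W])
  also have "(\<integral>x. indicator {0..<1} x * W x \<partial>lborel) = (\<integral>x. indicator {0<..<1} x * W x \<partial>lborel)"
  proof (rule integral_cong_AE)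
    show "AE x in lborel. indicator {0..<1} x * W x = indicator {0<..<1} x * W x"
      using ae by eventually_elim (auto simp: indicator_def)
  qed auto
  also have "(\<integral>x. indicator {1..<2} x * W x \<partial>lborel) =
      \<bar>-1\<bar> *\<^sub>R (\<integral>x. indicator {1..<2} (2 + (-1) * x) * W (2 + (-1) * x) \<partial>lborel)"
    by (rule lborel_integral_real_affine) simp
  also have "\<dots> = (\<integral>x. indicator {0<..<1} x * W x \<partial>lborel)"
  proof -
    have W2: "W (2 - x) = W x" for x using per [of "- x"] even [of x] by (simp add: algebra_simps)
    have "AE x in lborel. indicator {1..<2} (2 + (-1) * x) * W (2 + (-1) * x) = indicator {0<..<1} x * W x"
      using ae by eventually_elim (auto simp: indicator_def W2)
    then show ?thesis by (subst integral_cong_AE [where g = "\<lambda>x. indicator {0<..<1} x * W x"]) auto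
  qed
  finally show ?thesis by simp
qed

lemma sqint_lborel:
  assumes [measurable]: "F \<in> borel_measurable borel"
  shows "sqint F = (\<integral>x. indicator {0<..<1} x * (cmod (F x))\<^sup>2 \<partial>lborel)"
proof -
  have "sqint F = (\<integral>x. indicator {0<..<1} x *\<^sub>R (cmod (F x))\<^sup>2 \<partial>lebesgue)"
    unfolding sqint_def by (subst integral_restrict_space) auto
  also have "\<dots> = (\<integral>x. indicator {0<..<1} x *\<^sub>R (cmod (F x))\<^sup>2 \<partial>lborel)"
    by (rule integral_completion) measurable
  finally show ?thesis by simp
qed

text \<open>The squared modulus is even with period 2, so its integral over the unit interval is
  half of that over a period, and the integral over a period is unchanged by an integer
  dilation.\<close>

lemma sqint_dilate:
  assumes [measurable]: "F \<in> borel_measurable borel" and bd: "\<And>x. cmod (F x) \<le> B"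
    and per: "\<And>x. F (x + 2) = F x" and odd: "\<And>x. F (- x) = - F x" and "k > 0"
  shows "sqint (\<lambda>x. F (real k * x)) = sqint F"
proof -
  define W where "W x = (cmod (F x))\<^sup>2" for x
  have [measurable]: "W \<in> borel_measurable borel" unfolding W_def by measurable
  have WB: "\<bar>W x\<bar> \<le> B\<^sup>2" for x unfolding W_def using bd by (simp add: power_mono)
  have perW: "W (x + 2) = W x" for x by (simp add: W_def per)
  have evenW: "W (- x) = W x" for x by (simp add: W_def odd)
  have perF: "F (x + 2 * real k) = F x" for x k
  proof (induction k)
    case (Suc k)
    have "F (x + 2 * real (Suc k)) = F ((x + 2 * real k) + 2)" by (simp add: algebra_simps)
    then show ?case using per Suc by simp
  qed simp
  have perk: "W (real k * (x + 2)) = W (real k * x)" for x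
    using perF [of "real k * x" k] by (simp add: W_def algebra_simps)
  have mk: "(\<lambda>x. W (real k * x)) \<in> borel_measurable borel" by measurable
  have "2 * sqint (\<lambda>x. F (real k * x)) = 2 * (\<integral>x. indicator {0<..<1} x * W (real k * x) \<partial>lborel)"
    by (subst sqint_lborel) (auto simp: W_def)
  also have "\<dots> = (\<integral>x. indicator {0..<2} x * W (real k * x) \<partial>lborel)"
    by (rule integral_even_period [where W = "\<lambda>x. W (real k * x)", symmetric, OF mk WB perk]) (use evenW in simp)
  also have "\<dots> = (\<integral>x. indicator {0..<2} x * W x \<partial>lborel)"
    by (rule integral_dilate_period [where W = W, OF _ WB perW \<open>k > 0\<close>]) measurable
  also have "\<dots> = 2 * (\<integral>x. indicator {0<..<1} x * W x \<partial>lborel)"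
    by (rule integral_even_period [where W = W, OF _ WB perW evenW]) measurable
  also have "\<dots> = 2 * sqint F" by (subst sqint_lborel) (auto simp: W_def)
  finally show ?thesis by simp
qed

lemma borel_in_measurable: "f \<in> borel_measurable borel \<Longrightarrow> f \<in> borel_measurable \<mu>\<^sub>I"
  for f :: "real \<Rightarrow> 'a::real_normed_vector"
  by (intro measurable_restrict_space1) (simp add: measurable_completion)

text \<open>For sine polynomials this is the identity \<open>sn m (k * x) = sn (m * k) x\<close>. It
  passes to the limit of the partial sums because dilation preserves \<open>sqint\<close>, which
  controls every coefficient.\<close>

lemma coef_dilate:
  assumes F [measurable]: "F \<in> borel_measurable borel" and bd: "\<And>x. cmod (F x) \<le> B"
    and per: "\<And>x. F (x + 2) = F x" and odd: "\<And>x. F (- x) = - F x" and "k > 0"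
  shows "coef (\<lambda>x. F (real k * x)) n = dil k (coef F) n"
proof -
  have FL2: "in_L2 F" using bd by (intro in_L2_bounded borel_in_measurable F)
  have FkL2: "in_L2 (\<lambda>x. F (real k * x))" using bd by (intro in_L2_bounded borel_in_measurable) auto
  define S where "S N x = (\<Sum>m=1..N. coef F m * sn m x)" for N x
  have [measurable]: "S N \<in> borel_measurable borel" for N
    unfolding S_def sn_def by measurable
  have Sb: "cmod (S N x) \<le> (\<Sum>m=1..N. cmod (coef F m))" for N x
    unfolding S_def by (rule sum_norm_le) (simp add: norm_mult sn_def mult_left_le)
  have sn_per: "sn m (x + 2) = sn m x" and sn_odd: "sn m (- x) = - sn m x" for m x
  proof -
    have "sin (real m * pi * (x + 2)) = sin (real m * pi * x + 2 * pi * real m)" by (simp add: algebra_simps)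
    also have "\<dots> = sin (real m * pi * x)" using sin_2npi [of m] cos_2npi [of m] by (simp add: sin_add mult_ac)
    finally show "sn m (x + 2) = sn m x" by (simp add: sn_def)
  qed (simp add: sn_def)
  have Sk: "S N (real k * x) = (\<Sum>m=1..N. coef F m * sn (m * k) x)" for N x
    by (simp add: S_def sn_def mult_ac)
  have SkL2: "in_L2 (\<lambda>x. S N (real k * x))" for N
    unfolding Sk by (intro in_L2_sum in_L2_scale in_L2_sn) auto
  have est: "(cmod (coef (\<lambda>x. F (real k * x)) n - dil k (coef F) n))\<^sup>2 \<le> 2 * sqint (\<lambda>x. F x - S N x)" if "N \<ge> n" for N
  proof -
    have "coef (\<lambda>x. S N (real k * x)) n = (\<Sum>m=1..N. coef F m * coef (sn (m * k)) n)"
      unfolding Sk by (subst coef_sum) (auto simp: coef_scale intro!: in_L2_scale in_L2_sn)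
    also have "\<dots> = (\<Sum>m=1..N. if m * k = n then coef F m else 0)"
    proof (intro sum.cong refl)
      fix m assume "m \<in> {1..N}"
      then have "m * k \<ge> 1" using \<open>k > 0\<close> by (simp add: Suc_le_eq)
      then show "coef F m * coef (sn (m * k)) n = (if m * k = n then coef F m else 0)" by (simp add: coef_sn)
    qed
    also have "\<dots> = dil k (coef F) n"
    proof (cases "k dvd n \<and> n > 0")
      case True
      then obtain j where j: "n = k * j" by auto
      then have j1: "j \<in> {1..N}" using True that \<open>k > 0\<close> le_trans [of j n N] by (auto simp: Suc_le_eq)
      have "(\<Sum>m=1..N. if m * k = n then coef F m else 0) = (\<Sum>m=1..N. if m = j then coef F j else 0)"
        using \<open>k > 0\<close> by (intro sum.cong refl) (auto simp: j mult.commute)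
      then show ?thesis using j1 True \<open>k > 0\<close> by (simp add: dil_def j)
    next
      case False
      have "(\<Sum>m=1..N. if m * k = n then coef F m else 0) = 0"
        using False \<open>k > 0\<close> by (intro sum.neutral) auto
      then show ?thesis using False by (cases "n = 0") (auto simp: dil_def)
    qed
    finally have "coef (\<lambda>x. F (real k * x) - S N (real k * x)) n = coef (\<lambda>x. F (real k * x)) n - dil k (coef F) n"
      using coef_diff [OF FkL2 SkL2, of N n] by simp
    then have "(cmod (coef (\<lambda>x. F (real k * x)) n - dil k (coef F) n))\<^sup>2 \<le> 2 * sqint (\<lambda>x. F (real k * x) - S N (real k * x))"
      using coef_bound [OF in_L2_diff [OF FkL2 SkL2], of N n] by simp
    also have "sqint (\<lambda>x. F (real k * x) - S N (real k * x)) = sqint (\<lambda>x. F x - S N x)"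
    proof (rule sqint_dilate [where F = "\<lambda>x. F x - S N x", OF _ _ _ _ \<open>k > 0\<close>])
      show "cmod (F x - S N x) \<le> B + (\<Sum>m=1..N. cmod (coef F m))" for x
        using norm_triangle_ineq4 [of "F x" "S N x"] bd [of x] Sb [of N x] by simp
      show "F (x + 2) - S N (x + 2) = F x - S N x" for x by (simp add: per S_def sn_per)
      show "F (- x) - S N (- x) = - (F x - S N x)" for x by (simp add: odd S_def sn_odd sum_negf)
    qed measurable
    finally show ?thesis .
  qed
  have "(cmod (coef (\<lambda>x. F (real k * x)) n - dil k (coef F) n))\<^sup>2 \<le> 2 * 0"
  proof (rule LIMSEQ_le_const)
    show "(\<lambda>N. 2 * sqint (\<lambda>x. F x - S N x)) \<longlonglongrightarrow> 2 * 0"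
      unfolding S_def by (intro tendsto_intros sqint_partial_sums FL2)
    show "\<exists>N0. \<forall>N\<ge>N0. (cmod (coef (\<lambda>x. F (real k * x)) n - dil k (coef F) n))\<^sup>2 \<le> 2 * sqint (\<lambda>x. F x - S N x)"
      using est by blast
  qed
  then show ?thesis by simp
qed

subsection \<open>The odd periodic extension\<close>

lemma oddext_unit: "0 < x \<Longrightarrow> x < 1 \<Longrightarrow> oddext \<phi> x = \<phi> x"
proof -
  assume x: "0 < x" "x < 1"
  then have "\<lfloor>x / 2\<rfloor> = 0" by (simp add: floor_eq_iff)
  then show ?thesis using x by (simp add: oddext_def)
qed

lemma oddext_per: "oddext \<phi> (x + 2) = oddext \<phi> x"
proof -
  have "\<lfloor>(x + 2) / 2\<rfloor> = \<lfloor>x / 2\<rfloor> + 1" by (simp add: add_divide_distrib)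
  then show ?thesis by (simp add: oddext_def Let_def)
qed

lemma oddext_odd: "oddext \<phi> (- x) = - oddext \<phi> x"
proof -
  define k where "k = \<lfloor>x / 2\<rfloor>"
  define y where "y = x - 2 * of_int k"
  have y: "0 \<le> y" "y < 2" unfolding y_def k_def by linarith+
  show ?thesis
  proof (cases "y = 0")
    case True
    then have "x = 2 * of_int k" by (simp add: y_def)
    then show ?thesis by (simp add: oddext_def)
  next
    case False
    have "\<lfloor>- x / 2\<rfloor> = - k - 1"
      using y False unfolding y_def by (intro floor_unique) (auto simp: field_simps)
    then have "- x - 2 * of_int \<lfloor>- x / 2\<rfloor> = 2 - y" by (simp add: y_def)
    moreover have "x - 2 * of_int \<lfloor>x / 2\<rfloor> = y" by (simp add: y_def k_def)
    ultimately show ?thesis unfolding oddext_def Let_def using y False by auto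
  qed
qed

lemma oddext_measurable:
  assumes "(\<lambda>x. if 0 < x \<and> x < 1 then \<phi> x else 0) \<in> borel_measurable borel"
  shows "oddext \<phi> \<in> borel_measurable borel"
proof -
  define \<phi>' where "\<phi>' x = (if 0 < x \<and> x < 1 then \<phi> x else 0)" for x
  have [measurable]: "\<phi>' \<in> borel_measurable borel" using assms by (simp add: \<phi>'_def [abs_def])
  have "oddext \<phi> = (\<lambda>x. \<phi>' (x - 2 * of_int \<lfloor>x / 2\<rfloor>) - \<phi>' (2 - (x - 2 * of_int \<lfloor>x / 2\<rfloor>)))"
    by (auto simp: fun_eq_iff oddext_def Let_def \<phi>'_def)
  then show ?thesis by simp
qed

lemma oddext_bounded:
  assumes "\<And>x. 0 < x \<Longrightarrow> x < 1 \<Longrightarrow> norm (\<phi> x) \<le> B" "B \<ge> 0"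
  shows "norm (oddext \<phi> x) \<le> B"
  using assms by (auto simp: oddext_def Let_def)

lemma coef_oddext: "coef (oddext \<phi>) = coef \<phi>"
  unfolding coef_def
  by (intro ext arg_cong2 [of _ _ _ _ "(*)"] refl Bochner_Integration.integral_cong) (auto simp: oddext_unit)

text \<open>Through Parseval's identity, completeness of the dilates is cyclicity of the sine
  coefficients.\<close>

lemma in_C_iff_cyclic_seq:
  assumes meas: "(\<lambda>x. if 0 < x \<and> x < 1 then \<phi> x else 0) \<in> borel_measurable borel"
    and bd: "\<And>x. 0 < x \<Longrightarrow> x < 1 \<Longrightarrow> norm (\<phi> x) \<le> B" and "B \<ge> 0"
  shows "in_C \<phi> \<longleftrightarrow> cyclic_seq (coef \<phi>)" and "in_L2 \<phi>"
proof -
  define F where "F = oddext \<phi>"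
  have F [measurable]: "F \<in> borel_measurable borel" unfolding F_def using meas by (rule oddext_measurable)
  have Fb: "cmod (F x) \<le> B" for x unfolding F_def using bd \<open>B \<ge> 0\<close> by (rule oddext_bounded)
  have FkL2: "in_L2 (\<lambda>x. F (real k * x))" for k using Fb by (intro in_L2_bounded borel_in_measurable) auto
  have Fk: "coef (\<lambda>x. F (real k * x)) n = dil k (coef \<phi>) n" if "k > 0" for k n
    using coef_dilate [OF F Fb _ _ that, of n] unfolding F_def coef_oddext by (simp add: oddext_per oddext_odd)
  show L2: "in_L2 \<phi>"
  proof (rule in_L2_bounded [OF _ bd])
    have "\<phi> \<in> borel_measurable \<mu>\<^sub>I \<longleftrightarrow> F \<in> borel_measurable \<mu>\<^sub>I"
      by (rule measurable_cong) (simp add: F_def oddext_unit)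
    then show "\<phi> \<in> borel_measurable \<mu>\<^sub>I" using borel_in_measurable [OF F] by simp
  qed
  have l2c: "l2 (coef \<phi>)" by (rule parseval(1) [OF L2])
  \<comment> \<open>The factor 2 is that of \<open>parseval\<close> and explains the tolerance
    \<open>\<epsilon> ^ 2 / 2\<close> below.\<close>
  have key: "(l2norm (\<lambda>m. coef f m - (\<Sum>k=1..n. c k * dil k (coef \<phi>) m)))\<^sup>2 =
      2 * sqint (\<lambda>x. f x - (\<Sum>k=1..n. c k * F (real k * x)))" if f: "in_L2 f" for f n c
  proof -
    have L2s: "in_L2 (\<lambda>x. \<Sum>k=1..n. c k * F (real k * x))" by (intro in_L2_sum in_L2_scale FkL2) auto
    have "coef (\<lambda>x. f x - (\<Sum>k=1..n. c k * F (real k * x))) m = coef f m - (\<Sum>k=1..n. c k * dil k (coef \<phi>) m)" for m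
      unfolding coef_diff [OF f L2s] by (subst coef_sum) (auto simp: coef_scale Fk intro!: in_L2_scale FkL2)
    then have "coef (\<lambda>x. f x - (\<Sum>k=1..n. c k * F (real k * x))) = (\<lambda>m. coef f m - (\<Sum>k=1..n. c k * dil k (coef \<phi>) m))" by blast
    then show ?thesis using parseval(2) [OF in_L2_diff [OF f L2s]] by simp
  qed
  show "in_C \<phi> \<longleftrightarrow> cyclic_seq (coef \<phi>)"
  proof
    assume C: "in_C \<phi>"
    have "coef (sn 1) = unit_seq" by (rule ext) (simp add: coef_sn unit_seq_def)
    show "cyclic_seq (coef \<phi>)" unfolding cyclic_seq_def dclosure_def
    proof (intro CollectI conjI l2_unit_seq allI impI)
      fix \<epsilon> :: real assume "\<epsilon> > 0"
      then have "\<epsilon>\<^sup>2 / 2 > 0" by simp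
      moreover have "\<forall>f. in_L2 f \<longrightarrow> (\<forall>\<epsilon>>0. \<exists>n c. sqint (\<lambda>x. f x - (\<Sum>k=1..n. c k * F (real k * x))) < \<epsilon>)"
        using C unfolding in_C_def sqint_eq F_def by (rule conjunct2)
      ultimately have "\<exists>n c. sqint (\<lambda>x. sn 1 x - (\<Sum>k=1..n. c k * F (real k * x))) < \<epsilon>\<^sup>2 / 2"
        using in_L2_sn [of 1] by blast
      then obtain n c where "sqint (\<lambda>x. sn 1 x - (\<Sum>k=1..n. c k * F (real k * x))) < \<epsilon>\<^sup>2 / 2" by blast
      then have "(l2norm (\<lambda>m. unit_seq m - (\<Sum>k=1..n. c k * dil k (coef \<phi>) m)))\<^sup>2 < \<epsilon>\<^sup>2"
        using key [OF in_L2_sn [of 1], where n = n and c = c] \<open>coef (sn 1) = unit_seq\<close> by simp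
      then have "l2norm (\<lambda>m. unit_seq m - (\<Sum>k=1..n. c k * dil k (coef \<phi>) m)) < \<epsilon>"
        using \<open>\<epsilon> > 0\<close> by (intro power_less_imp_less_base [of _ 2 \<epsilon>]) auto
      then show "\<exists>y\<in>dspan (coef \<phi>). l2norm (\<lambda>n. unit_seq n - y n) < \<epsilon>"
        by (intro bexI [of _ "\<lambda>m. \<Sum>k=1..n. c k * dil k (coef \<phi>) m"]) (auto simp: dspan_def)
    qed
  next
    assume cyc: "cyclic_seq (coef \<phi>)"
    show "in_C \<phi>" unfolding in_C_def sqint_eq
    proof (intro conjI L2 allI impI)
      fix f and \<epsilon> :: real assume f: "in_L2 f" and "\<epsilon> > 0"
      have "coef f \<in> dclosure (coef \<phi>)"
        using parseval(1) [OF f] by (intro dclosure_everything l2c cyc) auto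
      moreover have "sqrt \<epsilon> > 0" using \<open>\<epsilon> > 0\<close> by simp
      ultimately obtain y where y: "y \<in> dspan (coef \<phi>)" "l2norm (\<lambda>n. coef f n - y n) < sqrt \<epsilon>"
        by (rule dclosureE)
      obtain n c where yc: "y = (\<lambda>m. \<Sum>k=1..n. c k * dil k (coef \<phi>) m)" using y(1) by (auto simp: dspan_def)
      have nn: "l2norm (\<lambda>n. coef f n - y n) \<ge> 0"
        using order_trans [OF L2_set_nonneg L2_set_le_l2norm [OF l2_diff(1) [OF parseval(1) [OF f] dspan_l2 [OF l2c y(1)]], of "{}"]] by simp
      have "(l2norm (\<lambda>n. coef f n - y n))\<^sup>2 < (sqrt \<epsilon>)\<^sup>2" using y(2) nn by (intro power_strict_mono) auto
      then have "2 * sqint (\<lambda>x. f x - (\<Sum>k=1..n. c k * F (real k * x))) < \<epsilon>"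
        using key [OF f, where n = n and c = c] \<open>\<epsilon> > 0\<close> unfolding yc by simp
      then have "sqint (\<lambda>x. f x - (\<Sum>k=1..n. c k * oddext \<phi> (real k * x))) < \<epsilon>"
        using sqint_nonneg [of "\<lambda>x. f x - (\<Sum>k=1..n. c k * oddext \<phi> (real k * x))"] unfolding F_def by linarith
      then show "\<exists>n c. sqint (\<lambda>x. f x - (\<Sum>k=1..n. c k * oddext \<phi> (real k * x))) < \<epsilon>" by blast
    qed
  qed
qed

subsection \<open>Step functions\<close>

lemma Lim_locally_constant:
  fixes f :: "real \<Rightarrow> complex"
  assumes "F \<noteq> bot" "\<forall>\<^sub>F x in F. f x = c"
  shows "Lim F f = c"
  using assms by (intro tendsto_Lim tendsto_eventually)

lemma Lim_at_right_const:
  fixes f :: "real \<Rightarrow> complex"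
  assumes "u < v" "\<And>x. u < x \<Longrightarrow> x < v \<Longrightarrow> f x = c"
  shows "Lim (at_right u) f = c"
  using assms by (intro Lim_locally_constant eventually_at_rightI [of u v]) auto

lemma Lim_at_left_const:
  fixes f :: "real \<Rightarrow> complex"
  assumes "u < v" "\<And>x. u < x \<Longrightarrow> x < v \<Longrightarrow> f x = c"
  shows "Lim (at_left v) f = c"
  using assms by (intro Lim_locally_constant eventually_at_leftI [of u v]) auto

lemma filtermap_shift_real:
  "at_right (x + d) = filtermap (\<lambda>y. y + d) (at_right (x::real))"
  "at_left (x + d) = filtermap (\<lambda>y. y + d) (at_left x)"
proof -
  have "filtermap (\<lambda>y. y + d) (at_right x) = filtermap (\<lambda>y. y + d) (filtermap (\<lambda>y. y + x) (at_right 0))"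
    by (simp only: at_right_to_0 [of x])
  also have "\<dots> = at_right (x + d)"
    by (subst at_right_to_0 [of "x + d"]) (simp add: filtermap_filtermap add.assoc)
  finally show "at_right (x + d) = filtermap (\<lambda>y. y + d) (at_right x)" ..
  have "filtermap (\<lambda>y. y + d) (at_left x) = filtermap (\<lambda>y. - y) (filtermap (\<lambda>y. y - d) (at_right (- x)))"
    by (subst at_left_minus) (simp add: filtermap_filtermap algebra_simps)
  also have "filtermap (\<lambda>y. y - d) (at_right (- x)) = at_right (- (x + d))"
    by (subst (1 2) at_right_to_0) (simp add: filtermap_filtermap algebra_simps)
  finally show "at_left (x + d) = filtermap (\<lambda>y. y + d) (at_left x)" by (subst at_left_minus) simp
qed

text \<open>\<open>Lim\<close> is a description, so it suffices that the shift carries one filter to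
  the other and preserves the function; convergence need not be known.\<close>

lemma Lim_oddext_shift:
  "Lim (at_right (x + 2)) (oddext \<phi>) = Lim (at_right x) (oddext \<phi>)"
  "Lim (at_left (x + 2)) (oddext \<phi>) = Lim (at_left x) (oddext \<phi>)"
  by (simp_all add: filtermap_shift_real Topological_Spaces.Lim_def filterlim_filtermap oddext_per)

lemma jump_per: "jump \<phi> (x + 2) = jump \<phi> x"
  by (simp add: jump_def Lim_oddext_shift)

text \<open>Values of \<open>\<phi>\<close> at the breakpoints are left free, and an inner
  breakpoint may carry no jump.\<close>

locale step_data =
  fixes \<phi> :: "real \<Rightarrow> complex" and a :: "nat \<Rightarrow> real" and n :: nat and c :: "nat \<Rightarrow> complex"
  assumes a0: "a 0 = 0" and an: "a n = 1" and mono: "\<And>i. i < n \<Longrightarrow> a i < a (Suc i)"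
    and val: "\<And>i x. i < n \<Longrightarrow> a i < x \<Longrightarrow> x < a (Suc i) \<Longrightarrow> \<phi> x = c i"
begin

lemma n_pos: "n > 0"
  using a0 an by (cases n) auto

lemma a_less: "i < j \<Longrightarrow> j \<le> n \<Longrightarrow> a i < a j"
proof (induction j)
  case (Suc j)
  then show ?case using mono [of j] by (cases "i = j") (auto intro: less_trans)
qed simp

lemma a_nonneg: "i \<le> n \<Longrightarrow> 0 \<le> a i"
  using a_less [of 0 i] a0 by (cases "i = 0") auto

lemma a_le_1: "i \<le> n \<Longrightarrow> a i \<le> 1"
  using a_less [of i n] an by (cases "i = n") auto

lemma a_pos: "0 < i \<Longrightarrow> i \<le> n \<Longrightarrow> 0 < a i"
  using a_less [of 0 i] a0 by simp

lemma a_lt_1: "i < n \<Longrightarrow> a i < 1"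
  using a_less [of i n] an by simp

lemma piece_cases:
  assumes "0 < x" "x < 1"
  obtains (piece) i where "i < n" "a i < x" "x < a (Suc i)" | (brk) i where "0 < i" "i < n" "x = a i"
proof -
  have "x < a i \<Longrightarrow> i \<le> n \<Longrightarrow> (\<exists>j<i. a j < x \<and> x < a (Suc j)) \<or> (\<exists>j<i. 0 < j \<and> x = a j)" for i
  proof (induction i)
    case 0
    then show ?case using assms a0 by simp
  next
    case (Suc i)
    consider "x < a i" | "x = a i" | "a i < x" by linarith
    then show ?case
    proof cases
      case 1
      then show ?thesis using Suc less_Suc_eq by force
    next
      case 2
      then have "i > 0" using assms a0 by (cases i) auto
      then show ?thesis using 2 by blast
    next
      case 3
      then show ?thesis using Suc.prems by blast
    qed
  qed
  from this [of n] have "(\<exists>j<n. a j < x \<and> x < a (Suc j)) \<or> (\<exists>j<n. 0 < j \<and> x = a j)"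
    using assms an by simp
  then show thesis using piece brk by (elim disjE exE conjE)
qed

lemma bounded_step: "\<exists>B\<ge>0. \<forall>x. 0 < x \<longrightarrow> x < 1 \<longrightarrow> norm (\<phi> x) \<le> B"
proof (intro exI conjI allI impI)
  let ?B = "(\<Sum>i<n. norm (c i)) + (\<Sum>i<n. norm (\<phi> (a i)))"
  show "0 \<le> ?B" by (intro add_nonneg_nonneg sum_nonneg) auto
  fix x :: real assume "0 < x" "x < 1"
  then show "norm (\<phi> x) \<le> ?B"
  proof (cases rule: piece_cases)
    case (piece i)
    then have "norm (\<phi> x) \<le> (\<Sum>i<n. norm (c i))"
      using val [of i x] member_le_sum [of i "{..<n}" "\<lambda>i. norm (c i)"] by simp
    then show ?thesis using sum_nonneg [of "{..<n}" "\<lambda>i. norm (\<phi> (a i))"] by simp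
  next
    case (brk i)
    then have "norm (\<phi> x) \<le> (\<Sum>i<n. norm (\<phi> (a i)))"
      using member_le_sum [of i "{..<n}" "\<lambda>i. norm (\<phi> (a i))"] by simp
    then show ?thesis using sum_nonneg [of "{..<n}" "\<lambda>i. norm (c i)"] by simp
  qed
qed

lemma measurable_step: "(\<lambda>x. if 0 < x \<and> x < 1 then \<phi> x else 0) \<in> borel_measurable borel"
proof -
  have "i \<le> n \<Longrightarrow> (\<lambda>x. if 0 < x \<and> x < a i then \<phi> x else 0) \<in> borel_measurable borel" for i
  proof (induction i)
    case 0
    have "(\<lambda>x. if 0 < x \<and> x < a 0 then \<phi> x else 0) = (\<lambda>x. 0)" by (auto simp: a0 fun_eq_iff)
    then show ?case by simp
  next
    case (Suc i)
    then have [measurable]: "(\<lambda>x. if 0 < x \<and> x < a i then \<phi> x else 0) \<in> borel_measurable borel" by simp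
    have m: "a i < a (Suc i)" "0 \<le> a i" using Suc.prems mono a_nonneg by auto
    have "(\<lambda>x. if 0 < x \<and> x < a (Suc i) then \<phi> x else 0) =
        (\<lambda>x. if x < a i then (if 0 < x \<and> x < a i then \<phi> x else 0)
          else if x = a i then (if 0 < a i then \<phi> (a i) else 0) else if x < a (Suc i) then c i else 0)"
      using m val [of i] Suc.prems by (auto simp: fun_eq_iff)
    moreover have "\<dots> \<in> borel_measurable borel" by measurable
    ultimately show ?case by simp
  qed
  from this [of n] show ?thesis by (simp add: an)
qed

lemma oddext_piece: "i < n \<Longrightarrow> a i < x \<Longrightarrow> x < a (Suc i) \<Longrightarrow> oddext \<phi> x = c i"
  using val [of i x] a_nonneg [of i] a_le_1 [of "Suc i"] by (subst oddext_unit) auto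

lemma Lim_right: "i < n \<Longrightarrow> a i \<le> x \<Longrightarrow> x < a (Suc i) \<Longrightarrow> Lim (at_right x) (oddext \<phi>) = c i"
  by (rule Lim_at_right_const [of x "a (Suc i)"]) (auto intro!: oddext_piece)

lemma Lim_left: "i < n \<Longrightarrow> a i < x \<Longrightarrow> x \<le> a (Suc i) \<Longrightarrow> Lim (at_left x) (oddext \<phi>) = c i"
  by (rule Lim_at_left_const [of "a i" x]) (auto intro!: oddext_piece)

lemma oddext_minus_piece: "i < n \<Longrightarrow> - a (Suc i) < x \<Longrightarrow> x < - a i \<Longrightarrow> oddext \<phi> x = - c i"
  using oddext_odd [of \<phi> "- x"] oddext_piece [of i "- x"] by simp

lemma Lim_right_minus: "i < n \<Longrightarrow> a i < x \<Longrightarrow> x \<le> a (Suc i) \<Longrightarrow> Lim (at_right (- x)) (oddext \<phi>) = - c i"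
  by (rule Lim_at_right_const [of "- x" "- a i"]) (auto intro!: oddext_minus_piece)

lemma Lim_left_minus: "i < n \<Longrightarrow> a i \<le> x \<Longrightarrow> x < a (Suc i) \<Longrightarrow> Lim (at_left (- x)) (oddext \<phi>) = - c i"
  by (rule Lim_at_left_const [of "- a (Suc i)" "- x"]) (auto intro!: oddext_minus_piece)

lemma jump_piece: "i < n \<Longrightarrow> a i < x \<Longrightarrow> x < a (Suc i) \<Longrightarrow> jump \<phi> x = 0"
  by (simp add: jump_def Lim_right [of i] Lim_left [of i])

lemma jump_brk: "Suc i < n \<Longrightarrow> jump \<phi> (a (Suc i)) = c (Suc i) - c i"
  using mono [of i] mono [of "Suc i"] by (simp add: jump_def Lim_right [of "Suc i"] Lim_left [of i])

lemma jump_0: "jump \<phi> 0 = 2 * c 0"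
  using Lim_right [of 0 0] Lim_left_minus [of 0 0] mono [of 0] n_pos by (simp add: jump_def a0)

text \<open>The right limit at 1 belongs to the reflected half of the period and is therefore read
  off at -1 after a shift by 2.\<close>

lemma jump_1: "jump \<phi> 1 = - 2 * c (n - 1)"
proof -
  have l: "n - 1 < n" "Suc (n - 1) = n" using n_pos by auto
  then have a: "a (n - 1) < 1" using mono [of "n - 1"] an by simp
  have "jump \<phi> 1 = jump \<phi> (- 1 + 2)" by simp
  also have "\<dots> = jump \<phi> (- 1)" by (rule jump_per)
  also have "jump \<phi> (- 1) = - c (n - 1) - Lim (at_left (- 1)) (oddext \<phi>)"
    using Lim_right_minus [of "n - 1" 1] l a an by (simp add: jump_def)
  also have "Lim (at_left (- 1)) (oddext \<phi>) = c (n - 1)"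
    using Lim_oddext_shift(2) [of "- 1" \<phi>] Lim_left [of "n - 1" 1] l a an by simp
  finally show ?thesis by simp
qed

lemma jump_minus:
  assumes "0 < x" "x < 1"
  shows "jump \<phi> (- x) = jump \<phi> x"
  using assms
proof (cases rule: piece_cases)
  case (piece i)
  then show ?thesis by (simp add: jump_def Lim_right [of i] Lim_left [of i] Lim_right_minus [of i] Lim_left_minus [of i])
next
  case (brk i)
  then obtain j where j: "i = Suc j" by (cases i) auto
  have "a j < x" "x \<le> a (Suc j)" "a i \<le> x" "x < a (Suc i)" "j < n" using brk j mono [of i] mono [of j] by auto
  then show ?thesis using brk
    by (simp add: jump_def Lim_right [of i] Lim_left [of j] Lim_right_minus [of j] Lim_left_minus [of i])
qed

lemma has_integral_step_sn:
  assumes "M > 0" "i \<le> n"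
  shows "((\<lambda>x. \<phi> x * sn M x) has_integral
    (\<Sum>j<i. c j * of_real ((cos (real M * pi * a j) - cos (real M * pi * a (Suc j))) / (real M * pi)))) {0..a i}"
  using assms(2)
proof (induction i)
  case 0
  then show ?case using has_integral_refl(2) [of "\<lambda>x. \<phi> x * sn M x" "0::real"] by (simp add: a0)
next
  case (Suc i)
  have lt: "a i < a (Suc i)" using Suc.prems mono by simp
  have "((\<lambda>x. sin (real M * pi * x)) has_integral
      (- cos (real M * pi * a (Suc i)) / (real M * pi) - (- cos (real M * pi * a i) / (real M * pi)))) {a i..a (Suc i)}"
    by (rule fundamental_theorem_of_calculus)
       (use lt \<open>M > 0\<close> in \<open>auto intro!: derivative_eq_intros simp flip: has_real_derivative_iff_has_vector_derivative\<close>)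
  then have "((\<lambda>x. sin (real M * pi * x)) has_integral
      ((cos (real M * pi * a i) - cos (real M * pi * a (Suc i))) / (real M * pi))) {a i..a (Suc i)}"
    by (simp add: diff_divide_distrib)
  then have "((\<lambda>x. complex_of_real (sin (real M * pi * x))) has_integral
      of_real ((cos (real M * pi * a i) - cos (real M * pi * a (Suc i))) / (real M * pi))) {a i..a (Suc i)}"
    by (rule has_integral_linear [OF _ bounded_linear_of_real, unfolded comp_def])
  then have "((\<lambda>x. c i * complex_of_real (sin (real M * pi * x))) has_integral
      c i * of_real ((cos (real M * pi * a i) - cos (real M * pi * a (Suc i))) / (real M * pi))) {a i..a (Suc i)}"
    by (rule has_integral_mult_right)
  moreover have "\<phi> x * sn M x = c i * complex_of_real (sin (real M * pi * x))" if "x \<in> box (a i) (a (Suc i))" for x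
    using Suc.prems val [of i x] that by (simp add: sn_def)
  ultimately have "((\<lambda>x. \<phi> x * sn M x) has_integral
      c i * of_real ((cos (real M * pi * a i) - cos (real M * pi * a (Suc i))) / (real M * pi))) {a i..a (Suc i)}"
    unfolding cbox_interval [symmetric] by (rule has_integral_spike_interior)
  from has_integral_combine [OF _ _ Suc.IH this] show ?case
    using Suc.prems lt a_nonneg [of i] by simp
qed

text \<open>Integrating the pieces gives differences of cosines, and summation by parts moves the
  differences onto the values, where they become jumps. At 0 and 1 oddness doubles the one-sided
  values, so these jumps appear with half the weight of the inner ones.\<close>

lemma coef_step:
  assumes "M > 0" and L2: "in_L2 \<phi>"
  shows "coef \<phi> M = (jump \<phi> 0 + jump \<phi> 1 * of_real (cos (real M * pi)) +
    2 * (\<Sum>x\<in>a ` {1..<n}. jump \<phi> x * of_real (cos (real M * pi * x)))) / (of_nat M * of_real pi)"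
proof -
  define C where "C j = complex_of_real (cos (real M * pi * a j))" for j
  have inj: "inj_on a {1..<n}"
  proof (rule linorder_inj_onI')
    fix i j assume "i \<in> {1..<n}" "j \<in> {1..<n}" "i < j"
    then show "a i \<noteq> a j" using a_less [of i j] by simp
  qed
  have abel: "(\<Sum>j<Suc k. c j * (C j - C (Suc j))) = c 0 * C 0 - c k * C (Suc k) + (\<Sum>j=1..<Suc k. (c j - c (j - 1)) * C j)" for k
    by (induction k) (simp_all add: algebra_simps)
  have n: "n = Suc (n - 1)" using n_pos by simp
  have "coef \<phi> M = 2 * (\<Sum>j<n. c j * of_real ((cos (real M * pi * a j) - cos (real M * pi * a (Suc j))) / (real M * pi)))"
    unfolding coef_def using has_integral_step_sn [OF \<open>M > 0\<close> order_refl] an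
    by (subst integral_unit_interval_eq [OF in_L2_mult [OF L2 in_L2_sn]]) auto
  also have "\<dots> = 2 * (\<Sum>j<n. c j * (C j - C (Suc j))) / (of_nat M * of_real pi)"
    by (simp add: C_def sum_divide_distrib sum_distrib_left)
  also have "(\<Sum>j<n. c j * (C j - C (Suc j))) = c 0 * C 0 - c (n - 1) * C n + (\<Sum>j=1..<n. (c j - c (j - 1)) * C j)"
    using abel [of "n - 1"] n by simp
  also have "(\<Sum>j=1..<n. (c j - c (j - 1)) * C j) = (\<Sum>x\<in>a ` {1..<n}. jump \<phi> x * of_real (cos (real M * pi * x)))"
    unfolding sum.reindex [OF inj] comp_def
  proof (intro sum.cong refl)
    fix j assume "j \<in> {1..<n}"
    then show "(c j - c (j - 1)) * C j = jump \<phi> (a j) * of_real (cos (real M * pi * a j))"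
      using jump_brk [of "j - 1"] by (simp add: C_def)
  qed
  finally show ?thesis by (simp add: jump_0 jump_1 C_def a0 an algebra_simps)
qed

text \<open>Both index sets contain every point of the open unit interval with a nonzero jump, and
  all other terms vanish.\<close>

lemma sum_breakpoints_eq_sum_multiples:
  fixes h :: "real \<Rightarrow> complex"
  assumes t: "t > 0" and rat: "\<forall>x\<in>{0<..<1}. jump \<phi> x \<noteq> 0 \<longrightarrow> (\<exists>s::int. x = real_of_int s / real t)"
  shows "(\<Sum>x\<in>a ` {1..<n}. jump \<phi> x * h x) = (\<Sum>m=1..<t. jump \<phi> (real m / real t) * h (real m / real t))"
proof -
  let ?X = "a ` {1..<n}" and ?Y = "(\<lambda>m. real m / real t) ` {1..<t}"
  have inj: "inj_on (\<lambda>m. real m / real t) {1..<t}" using t by (auto simp: inj_on_def)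
  have X: "0 < x" "x < 1" if "x \<in> ?X" for x using that a_pos a_lt_1 by auto
  have Y: "0 < x" "x < 1" if "x \<in> ?Y" for x using that t by auto
  have "jump \<phi> x = 0" if "x \<in> ?X - ?Y" for x
  proof (rule ccontr)
    assume "jump \<phi> x \<noteq> 0"
    moreover have x: "0 < x" "x < 1" using X [of x] that by blast+
    ultimately have "\<exists>s::int. x = real_of_int s / real t" using bspec [OF rat, of x] by simp
    then obtain s :: int where s: "x = real_of_int s / real t" ..
    with x have "0 < s" "s < int t" using t by (auto simp: zero_less_divide_iff)
    then have "x = real (nat s) / real t" "nat s \<in> {1..<t}" using s by auto
    then show False using that by blast
  qed
  then have "(\<Sum>x\<in>?X. jump \<phi> x * h x) = (\<Sum>x\<in>?X \<inter> ?Y. jump \<phi> x * h x)"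
    by (intro sum.mono_neutral_right) auto
  also have "\<dots> = (\<Sum>x\<in>?Y. jump \<phi> x * h x)"
  proof (intro sum.mono_neutral_left ballI)
    fix x assume x: "x \<in> ?Y - ?X \<inter> ?Y"
    then have "0 < x" "x < 1" using Y by auto
    then have "jump \<phi> x = 0"
    proof (cases rule: piece_cases)
      case (piece i)
      then show ?thesis by (rule jump_piece)
    next
      case (brk i)
      then have "x \<in> ?X" by (intro image_eqI [of _ _ i]) auto
      then show ?thesis using x by blast
    qed
    then show "jump \<phi> x * h x = 0" by simp
  qed auto
  also have "\<dots> = (\<Sum>m=1..<t. jump \<phi> (real m / real t) * h (real m / real t))"
    unfolding sum.reindex [OF inj] comp_def ..
  finally show ?thesis .
qed

end

text \<open>Pairing \<open>m\<close> with \<open>2 * t - m\<close> turns roots of unity into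
  cosines. The indices 0 and \<open>t\<close> remain unpaired, which matches the half weights of the
  end terms in \<open>coef_step\<close>.\<close>

lemma sum_symmetric_unity_root:
  fixes g :: "nat \<Rightarrow> complex"
  assumes t: "t > 0" and sym: "\<And>m. 0 < m \<Longrightarrow> m < t \<Longrightarrow> g (2 * t - m) = g m"
  shows "(\<Sum>m<2 * t. g m * unity_root (2 * t) (m * M)) =
    g 0 + g t * of_real (cos (real M * pi)) + 2 * (\<Sum>m=1..<t. g m * of_real (cos (real M * pi * (real m / real t))))"
proof -
  define u where "u m = unity_root (2 * t) (m * M)" for m
  have u: "u m = cis (real M * pi * (real m / real t))" for m
    unfolding u_def unity_root_def cis_conv_exp by (intro arg_cong [of _ _ exp]) (use t in \<open>simp add: field_simps\<close>)
  have ut: "u t = of_real (cos (real M * pi))"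
    using t u [of t] sin_npi [of M] by (simp add: complex_eq_iff)
  have pair: "u m + u (2 * t - m) = 2 * of_real (cos (real M * pi * (real m / real t)))" if "m < t" for m
  proof -
    have "real M * pi * (real (2 * t - m) / real t) = 2 * real M * pi - real M * pi * (real m / real t)"
      using that t by (simp add: of_nat_diff field_simps)
    then have "u (2 * t - m) = cis (- (real M * pi * (real m / real t)))"
      unfolding u using cos_2npi [of M] sin_2npi [of M] by (simp add: complex_eq_iff cos_diff sin_diff)
    then show ?thesis unfolding u by (simp add: complex_eq_iff)
  qed
  have split: "{..<2 * t} = insert 0 (insert t ({1..<t} \<union> {Suc t..<2 * t}))" using t by auto
  have "(\<Sum>m<2 * t. g m * u m) = g 0 * u 0 + (g t * u t + ((\<Sum>m=1..<t. g m * u m) + (\<Sum>m=Suc t..<2 * t. g m * u m)))"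
    unfolding split using t by (subst sum.insert, simp, simp, subst sum.insert, simp, simp, subst sum.union_disjoint) auto
  also have "(\<Sum>m=Suc t..<2 * t. g m * u m) = (\<Sum>m=1..<t. g (2 * t - m) * u (2 * t - m))"
    by (rule sum.reindex_bij_witness [of _ "\<lambda>m. 2 * t - m" "\<lambda>m. 2 * t - m"]) auto
  also have "\<dots> = (\<Sum>m=1..<t. g m * u (2 * t - m))" using sym by (intro sum.cong refl) auto
  also have "(\<Sum>m=1..<t. g m * u m) + \<dots> = (\<Sum>m=1..<t. g m * (u m + u (2 * t - m)))"
    by (simp add: sum.distrib distrib_left)
  also have "\<dots> = 2 * (\<Sum>m=1..<t. g m * of_real (cos (real M * pi * (real m / real t))))"
    unfolding sum_distrib_left by (intro sum.cong refl) (simp add: pair)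
  finally show ?thesis using u [of 0] ut by (simp add: u_def)
qed

theorem theorem1p4:
  fixes \<phi> :: "real \<Rightarrow> complex" and t :: nat
  assumes "\<phi> \<in> S_r" and "t > 0"
    and "\<forall>x\<in>{0<..<1}. jump \<phi> x \<noteq> 0 \<longrightarrow> (\<exists>s::int. x = real_of_int s / real t)"
  shows "in_C \<phi> \<longleftrightarrow>
    (let q = 2 * t; g = (\<lambda>m::nat. jump \<phi> (real m / real t)) in
     \<exists>q0 \<psi>. q0 dvd q \<and> primitive_char q0 \<psi> \<and>
       (\<forall>m\<ge>1. g m = g (gcd m (q div q0)) * \<psi> (m div gcd m (q div q0))) \<and>
       dconv g (\<lambda>n. moebius_mu n * \<psi> n) (q div q0) \<noteq> 0 \<and>
       (\<forall>s::complex. Re s > 0 \<longrightarrow>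
          (\<Sum>d | d dvd (q div q0).
             dconv g (\<lambda>n. moebius_mu n * \<psi> n) (q div (d * q0)) * (of_nat d) powr (- s)) \<noteq> 0))"
proof -
  have "step_fun \<phi>" using assms(1) by (simp add: S_r_def)
  then obtain a n where a: "a 0 = 0" "a n = 1" "\<And>i. i < n \<Longrightarrow> a i < a (Suc i)"
    and "\<And>i. i < n \<Longrightarrow> \<exists>c. \<forall>x\<in>{a i<..<a (Suc i)}. \<phi> x = c"
    unfolding step_fun_def by blast
  then obtain c where c: "\<And>i x. i < n \<Longrightarrow> x \<in> {a i<..<a (Suc i)} \<Longrightarrow> \<phi> x = c i" by metis
  interpret step_data \<phi> a n c using a c by unfold_locales auto
  obtain B where B: "B \<ge> 0" "\<And>x. 0 < x \<Longrightarrow> x < 1 \<Longrightarrow> norm (\<phi> x) \<le> B" using bounded_step by blast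
  note C = in_C_iff_cyclic_seq [OF measurable_step B(2,1)]
  define g where "g m = jump \<phi> (real m / real t)" for m
  define b where "b M = (\<Sum>m<2 * t. g m * unity_root (2 * t) (m * M))" for M
  have g_per: "g (m + 2 * t) = g m" for m
    using \<open>t > 0\<close> jump_per [of \<phi> "real m / real t"] by (simp add: g_def add_divide_distrib)
  have g_sym: "g (2 * t - m) = g m" if "0 < m" "m < t" for m
  proof -
    have "real (2 * t - m) / real t = - (real m / real t) + 2" using that by (simp add: of_nat_diff field_simps)
    then show ?thesis unfolding g_def using jump_per [of \<phi> "- (real m / real t)"] jump_minus [of "real m / real t"] that by simp
  qed
  \<comment> \<open>For \<open>M = 0\<close> both sides are 0, the right one because division by 0
    yields 0.\<close>
  have coef: "of_real pi * coef \<phi> M = b M / of_nat M" for M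
  proof (cases "M = 0")
    case False
    have gsum: "(\<Sum>m<2 * t. g m * unity_root (2 * t) (m * M)) =
      g 0 + g t * of_real (cos (real M * pi)) + 2 * (\<Sum>m=1..<t. g m * of_real (cos (real M * pi * (real m / real t))))"
      by (rule sum_symmetric_unity_root) (use \<open>t > 0\<close> g_sym in auto)
    have "b M = jump \<phi> 0 + jump \<phi> 1 * of_real (cos (real M * pi)) +
        2 * (\<Sum>x\<in>a ` {1..<n}. jump \<phi> x * of_real (cos (real M * pi * x)))"
      unfolding b_def gsum
        sum_breakpoints_eq_sum_multiples [OF \<open>t > 0\<close> assms(3)]
      using \<open>t > 0\<close> by (simp add: g_def)
    then show ?thesis using coef_step [OF _ C(2), of M] False by (simp add: mult.commute)
  qed simp
  have "in_C \<phi> \<longleftrightarrow> cyclic_seq (\<lambda>M. of_real pi * coef \<phi> M)"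
    using C(1) cyclic_seq_scale [OF parseval(1) [OF C(2)], of "of_real pi"] by simp
  also have "\<dots> \<longleftrightarrow> cyclic_seq (\<lambda>M. b M / of_nat M)" unfolding coef ..
  also have "\<dots> \<longleftrightarrow> (\<exists>q0 \<psi>. q0 dvd 2 * t \<and> primitive_char q0 \<psi> \<and>
       (\<forall>m\<ge>1. g m = g (gcd m (2 * t div q0)) * \<psi> (m div gcd m (2 * t div q0))) \<and>
       dconv g (\<lambda>n. moebius_mu n * \<psi> n) (2 * t div q0) \<noteq> 0 \<and>
       (\<forall>s::complex. Re s > 0 \<longrightarrow>
          (\<Sum>d | d dvd (2 * t div q0).
             dconv g (\<lambda>n. moebius_mu n * \<psi> n) (2 * t div (d * q0)) * (of_nat d) powr (- s)) \<noteq> 0))"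
  proof (rule cyclic_periodic_iff)
    show "2 * t > 1" using \<open>t > 0\<close> by simp
    show "g (m + 2 * t) = g m" for m by (rule g_per)
    show "b M = (\<Sum>m<2 * t. g m * unity_root (2 * t) (m * M))" for M by (rule b_def)
  qed
  finally show ?thesis unfolding Let_def g_def [abs_def] .
qed

end
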